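(* Let $f=[f_0,f_1,f_2]:\mathbb{P}^2\dashrightarrow\mathbb{P}^2$ be a birational map defined over $\mathbb{Z}$, i.e. all coefficients of the homogeneous polynomials $f_0,f_1,f_2$ are integers. Then for every sufficiently large prime $p$, $f$ induces a birational map $f_p:\mathbb{P}^2\dashrightarrow\mathbb{P}^2$ over $\mathbb{F}_p$ on the special fibre at $p$, and $$\lim_{p\to\infty}\lambda_1(f_p)=\lambda_1(f).$$
   Context: Here $f_0,f_1,f_2\in\mathbb{Z}[x,y,z]$ are homogeneous of the same degree and define a birational self-map of $\mathbb{P}^2$ over $\overline{\mathbb{Q}}$. The map $f_p$ is obtained by reducing the coefficients of $f_0,f_1,f_2$ modulo $p$. For a birational map $g$ of $\mathbb{P}^2$ over a field, $\deg(g)$ is the common degree of homogeneous polynomials without common factor defining $g$, and the first dynamical degree is $\lambda_1(g)=\lim_{n\to\infty}\deg(g^n)^{1/n}\ge1$ (computed over the algebraic closure of the field; the limit exists). *)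

theory Defs
  imports Complex_Main
    "HOL-Library.Numeral_Type"
    "HOL-Algebra.Indexed_Polynomials"
    "HOL-Algebra.Algebraic_Closure_Type"
    "HOL-Algebra.IntRing"
    "HOL-Number_Theory.Residues"
begin

text \<open>
  The coefficient fields (an algebraic closure of the rationals, \<open>F\<^sub>p\<close> and its algebraic closure
  for varying \<open>p\<close>) are \<open>HOL-Algebra\<close> records, since a field depending on \<open>p\<close> cannot be a type.
  The three homogeneous coordinates are indexed by the three-element type \<open>3\<close>, and polynomials in
  them are the indexed polynomials of \<open>HOL-Algebra\<close>: coefficient functions on monomials, a
  monomial being a multiset of variables. The library provides the set of these polynomials but
  not the ring; multiplication is convolution over the factorisations \<open>m = n + (m - n)\<close>.
\<close>

type_synonym 'a poly3 = "3 multiset \<Rightarrow> 'a"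

definition poly3_ring :: "('a, 'b) ring_scheme \<Rightarrow> 'a poly3 ring" where
  "poly3_ring R =
    \<lparr>carrier = ring.indexed_pset R UNIV (carrier R),
     monoid.mult = (\<lambda>P Q m. \<Oplus>\<^bsub>R\<^esub>n\<in>{n. n \<subseteq># m}. P n \<otimes>\<^bsub>R\<^esub> Q (m - n)),
     one = ring.indexed_const R \<one>\<^bsub>R\<^esub>,
     zero = ring.indexed_const R \<zero>\<^bsub>R\<^esub>,
     add = ring.indexed_padd R\<rparr>"

definition homogeneous :: "('a, 'b) ring_scheme \<Rightarrow> nat \<Rightarrow> 'a poly3 \<Rightarrow> bool" where
  "homogeneous R d P \<longleftrightarrow> P \<in> carrier (poly3_ring R) \<and> (\<forall>m. P m \<noteq> \<zero>\<^bsub>R\<^esub> \<longrightarrow> size m = d)"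

definition subst3 :: "('a, 'b) ring_scheme \<Rightarrow> 'a poly3 \<Rightarrow> (3 \<Rightarrow> 'a poly3) \<Rightarrow> 'a poly3" where
  "subst3 R P G =
    (\<Oplus>\<^bsub>poly3_ring R\<^esub>m\<in>{m. P m \<noteq> \<zero>\<^bsub>R\<^esub>}.
       ring.indexed_const R (P m) \<otimes>\<^bsub>poly3_ring R\<^esub>
       (\<Otimes>\<^bsub>poly3_ring R\<^esub>i\<in>UNIV. G i [^]\<^bsub>poly3_ring R\<^esub> count m i))"

subsection \<open>Rational self-maps of the projective plane\<close>

text \<open>
  A rational self-map of the plane is represented by a triple of forms of one degree, not all
  zero. The representative need not be free of common factors, so it is not unique:
  \<open>same_map\<close> is the relation of representing the same rational map (it is meaningful only for
  triples that are not identically zero).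
\<close>

definition rat_map_of_degree :: "('a, 'b) ring_scheme \<Rightarrow> nat \<Rightarrow> (3 \<Rightarrow> 'a poly3) \<Rightarrow> bool" where
  "rat_map_of_degree R d F \<longleftrightarrow>
    (\<forall>i. homogeneous R d (F i)) \<and> (\<exists>i. F i \<noteq> \<zero>\<^bsub>poly3_ring R\<^esub>)"

definition rat_map :: "('a, 'b) ring_scheme \<Rightarrow> (3 \<Rightarrow> 'a poly3) \<Rightarrow> bool" where
  "rat_map R F \<longleftrightarrow> (\<exists>d. rat_map_of_degree R d F)"

definition same_map :: "('a, 'b) ring_scheme \<Rightarrow> (3 \<Rightarrow> 'a poly3) \<Rightarrow> (3 \<Rightarrow> 'a poly3) \<Rightarrow> bool" where
  "same_map R F G \<longleftrightarrow>
    rat_map R F \<and> rat_map R G \<and>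
    (\<forall>i j. F i \<otimes>\<^bsub>poly3_ring R\<^esub> G j = F j \<otimes>\<^bsub>poly3_ring R\<^esub> G i)"

definition id_map :: "('a, 'b) ring_scheme \<Rightarrow> 3 \<Rightarrow> 'a poly3" where
  "id_map R = ring.indexed_var R"

definition comp_map ::
    "('a, 'b) ring_scheme \<Rightarrow> (3 \<Rightarrow> 'a poly3) \<Rightarrow> (3 \<Rightarrow> 'a poly3) \<Rightarrow> 3 \<Rightarrow> 'a poly3" where
  "comp_map R F G = (\<lambda>i. subst3 R (F i) G)"

definition birational :: "('a, 'b) ring_scheme \<Rightarrow> (3 \<Rightarrow> 'a poly3) \<Rightarrow> bool" where
  "birational R F \<longleftrightarrow>
    rat_map R F \<and>
    (\<exists>G. rat_map R G \<and>
         same_map R (comp_map R F G) (id_map R) \<and> same_map R (comp_map R G F) (id_map R))"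

definition iter_map :: "('a, 'b) ring_scheme \<Rightarrow> (3 \<Rightarrow> 'a poly3) \<Rightarrow> nat \<Rightarrow> 3 \<Rightarrow> 'a poly3" where
  "iter_map R F n = (comp_map R F ^^ n) (id_map R)"

definition no_common_factor :: "('a, 'b) ring_scheme \<Rightarrow> (3 \<Rightarrow> 'a poly3) \<Rightarrow> bool" where
  "no_common_factor R F \<longleftrightarrow>
    (\<forall>H\<in>carrier (poly3_ring R).
       (\<forall>i. H divides\<^bsub>poly3_ring R\<^esub> F i) \<longrightarrow> H \<in> Units (poly3_ring R))"

definition map_degree :: "('a, 'b) ring_scheme \<Rightarrow> (3 \<Rightarrow> 'a poly3) \<Rightarrow> nat" where
  "map_degree R F =
    (THE d. \<exists>G. rat_map_of_degree R d G \<and> no_common_factor R G \<and> same_map R F G)"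

definition dynamical_degree :: "('a, 'b) ring_scheme \<Rightarrow> (3 \<Rightarrow> 'a poly3) \<Rightarrow> real" where
  "dynamical_degree R F = lim (\<lambda>n. root n (real (map_degree R (iter_map R F n))))"

subsection \<open>Base change of maps defined over the integers\<close>

definition base_change :: "('a \<Rightarrow> 'b) \<Rightarrow> (3 \<Rightarrow> 'a poly3) \<Rightarrow> 3 \<Rightarrow> 'b poly3" where
  "base_change h F = (\<lambda>i m. h (F i m))"

abbreviation rat_ring :: "rat ring" where
  "rat_ring \<equiv> ring_of_type_algebra"

abbreviation Fp :: "nat \<Rightarrow> int ring" where
  "Fp p \<equiv> residue_ring (int p)"

text \<open>
  The embedding of a field \<open>K\<close> into \<open>field.alg_closure K\<close> is \<open>ring.indexed_const K\<close>.
\<close>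

definition to_closure ::
    "('a, 'b) ring_scheme \<Rightarrow> (3 \<Rightarrow> 'a poly3) \<Rightarrow> 3 \<Rightarrow> (('a list \<times> nat) multiset \<Rightarrow> 'a) poly3" where
  "to_closure K = base_change (ring.indexed_const K)"

definition generic_fibre :: "(3 \<Rightarrow> int poly3) \<Rightarrow> 3 \<Rightarrow> rat poly3" where
  "generic_fibre = base_change of_int"

definition reduce_mod :: "nat \<Rightarrow> (3 \<Rightarrow> int poly3) \<Rightarrow> 3 \<Rightarrow> int poly3" where
  "reduce_mod p = base_change (\<lambda>c. c mod int p)"

text \<open>The first dynamical degree of a map over a field, computed over the algebraic closure.\<close>

definition lambda1 :: "('a, 'b) ring_scheme \<Rightarrow> (3 \<Rightarrow> 'a poly3) \<Rightarrow> real" where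
  "lambda1 K F = dynamical_degree (field.alg_closure K) (to_closure K F)"

definition primes_at_top :: "nat filter" where
  "primes_at_top = inf at_top (principal {p. Factorial_Ring.prime p})"

end

theory Submission
  imports Defs
begin

text \<open>
  Write \<open>d\<^sub>n\<close> for the degree of the \<open>n\<close>-th iterate of a birational self-map of the plane. Degrees are
  submultiplicative, so \<open>\<lambda>\<^sub>1\<close> is the infimum of the \<open>n\<close>-th roots of \<open>d\<^sub>n\<close>. For each fixed \<open>n\<close>, the degree
  \<open>d\<^sub>n\<close> of \<open>f\<^sub>p\<close> equals that of \<open>f\<close> for all large \<open>p\<close>; this gives \<open>limsup \<lambda>\<^sub>1(f\<^sub>p) \<le> \<lambda>\<^sub>1(f)\<close> at once. The lower
  bound needs an estimate of \<open>\<lambda>\<^sub>1\<close> from below by finitely many degrees, with a constant that does not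
  depend on the field. The estimate used here is
  \<open>d\<^sub>2\<^sub>N \<le> 24 d\<^sub>N \<lambda>\<^sub>1\<^sup>N\<close>
  (\<open>degree_growth\<close>). It suffices, since the \<open>N\<close>-th root of \<open>d\<^sub>2\<^sub>N / (24 d\<^sub>N)\<close> tends to \<open>\<lambda>\<^sub>1(f)\<close>.

  The usual source of such an estimate is the action of birational maps on an infinite-dimensional
  hyperbolic space: \<open>log d\<^sub>n\<close> is the displacement of a point under the \<open>n\<close>-th power of an isometry, and
  four points of a hyperbolic space satisfy an approximate Ptolemy inequality. That inequality is
  proved here directly, by counting dimensions (\<open>four_point_inequality\<close>). Let \<open>f\<close> have degree \<open>a\<close>, let
  its inverse \<open>g\<close> have degree \<open>b\<close>, and suppose that \<open>d\<^sub>2 > a\<close>; then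
  \<open>d\<^sub>2 d\<^bsub>n+1\<^esub> \<le> 8 (a d\<^sub>n + b d\<^bsub>n+2\<^esub>)\<close>.
  Consider the forms \<open>S = \<Sum>\<^sub>j Q\<^sub>j(g) A(f)\<^sup>j B(f)\<^sup>N\<^sup>-\<^sup>j\<close> with linear forms \<open>A\<close>, \<open>B\<close> and with \<open>Q\<^sub>j\<close> of degree less than
  \<open>d\<^sub>2\<close>. Composing \<open>S\<close> with \<open>f\<close> turns \<open>g\<close> into the identity and \<open>f\<close> into its second iterate. If \<open>A\<close> and \<open>B\<close> of
  that iterate are coprime, then no nontrivial choice of the \<open>Q\<^sub>j\<close> gives \<open>S = 0\<close>, so these \<open>S\<close> form a large
  space. In coordinates that contain the linear form \<open>l\<close>, a form is divisible by \<open>l\<^sup>t\<close> as soon as few of its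
  coefficients vanish, so some \<open>S \<noteq> 0\<close> is divisible by \<open>l\<^sup>t\<close> with \<open>t\<close> large. Composing \<open>S\<close> with the iterate \<open>n+1\<close>, and removing
  common factors, which have no factor in common with the composite of a generic \<open>l\<close>, gives a form in the iterates \<open>n\<close> and \<open>n+2\<close> that is
  divisible by the \<open>t\<close>-th power of a form of degree \<open>d\<^bsub>n+1\<^esub>\<close>; comparing degrees proves the inequality. The
  same argument with \<open>t = 1\<close> shows \<open>b \<le> 2 a\<close> (\<open>inverse_degree_le\<close>). Applied to all iterates, the four-point
  inequality makes the sequence \<open>d\<^sub>n\<close> grow at least like a geometric one (\<open>growth_from_four_point\<close>).

  For the comparison of the degrees over \<open>\<rat>\<close> and modulo \<open>p\<close>, note that a map \<open>F\<close> has degree at most \<open>e\<close> iff some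
  nonzero triple \<open>A\<close> of forms of degree \<open>e\<close> satisfies \<open>A\<^sub>i F\<^sub>j = A\<^sub>j F\<^sub>i\<close>. This is a linear system with integer
  coefficients. Either it has a nonzero integer solution, or its matrix has a left inverse up to an
  integer \<open>N \<noteq> 0\<close> (\<open>integer_matrix_alternative\<close>); hence its solvability is the same over all fields in which
  one fixed integer is not zero. The same lemma produces an inverse of \<open>f\<close> with integer coefficients
  from one over an algebraic closure of \<open>\<rat>\<close> (\<open>inverse_over_int\<close>).

  All of this takes place in the factorial ring \<open>'k poly poly poly\<close> over a field type \<open>'k\<close>. The ring is
  isomorphic to the polynomial ring \<open>poly3_ring K\<close> over a record \<open>K\<close> once \<open>'k\<close> is in bijection with the
  carrier of \<open>K\<close>, and all notions are transported along this isomorphism (\<open>poly3_iso\<close>).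
\<close>

section \<open>Polynomials in three variables\<close>

lemma index3_cases: "i = 0 \<or> i = 1 \<or> i = (2::3)"
proof (induct i)
  case (of_int z)
  then have "0 \<le> z" "z < 3" by simp_all
  then have "z = 0 \<or> z = 1 \<or> z = 2" by arith
  then show ?case by auto
qed

lemma UNIV_index3: "(UNIV :: 3 set) = {0, 1, 2}"
  using index3_cases by auto

lemma all_index3: "(\<forall>i::3. P i) \<longleftrightarrow> P 0 \<and> P 1 \<and> P 2"
  by (metis index3_cases)

lemma distinct_index3: "(0::3) \<noteq> 1" "(0::3) \<noteq> 2" "(1::3) \<noteq> 2"
  by simp_all

lemma sum_index3: "(\<Sum>i\<in>UNIV. f i) = f 0 + f 1 + f (2::3)"
  unfolding UNIV_index3 by (simp add: distinct_index3 add.assoc)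

lemma prod_index3: "(\<Prod>i\<in>UNIV. f i) = f 0 * f 1 * f (2::3)"
  unfolding UNIV_index3 by (simp add: distinct_index3 mult.assoc)

lemma size_eq_sum_count: "size (m :: 3 multiset) = (\<Sum>i\<in>UNIV. count m i)"
  unfolding size_multiset_overloaded_eq by (rule sum.mono_neutral_left) (auto simp: not_in_iff)

lemma size_index3: "size (m :: 3 multiset) = count m 0 + count m 1 + count m 2"
  unfolding size_eq_sum_count sum_index3 ..

lemma multiset_index3_eq_iff:
  "m = (n :: 3 multiset) \<longleftrightarrow> count m 0 = count n 0 \<and> count m 1 = count n 1 \<and> count m 2 = count n 2"
  by (simp add: multiset_eq_iff all_index3)

definition mon3 :: "nat \<Rightarrow> nat \<Rightarrow> nat \<Rightarrow> 3 multiset" where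
  "mon3 a b c = replicate_mset a 0 + replicate_mset b 1 + replicate_mset c 2"

lemma count_mon3 [simp]: "count (mon3 a b c) 0 = a" "count (mon3 a b c) 1 = b" "count (mon3 a b c) 2 = c"
  by (auto simp: mon3_def)

lemma mon3_count [simp]: "mon3 (count m 0) (count m 1) (count m 2) = m"
  by (simp add: multiset_index3_eq_iff)

type_synonym 'k form3 = "'k poly poly poly"

text \<open>
  A polynomial in three variables is a polynomial in the variable \<open>0\<close> whose coefficients are polynomials
  in the variable \<open>1\<close>, and so on. This nesting is what makes the ring factorial by type-class
  instances; coefficients are nevertheless addressed by monomials, that is by multisets of variables.
\<close>

definition mcoeff :: "'k::zero form3 \<Rightarrow> 3 multiset \<Rightarrow> 'k" where
  "mcoeff P m = Polynomial.coeff (Polynomial.coeff (Polynomial.coeff P (count m 0)) (count m 1)) (count m 2)"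

definition mterm :: "'k::zero \<Rightarrow> 3 multiset \<Rightarrow> 'k form3" where
  "mterm c m = Polynomial.monom (Polynomial.monom (Polynomial.monom c (count m 2)) (count m 1)) (count m 0)"

lemma mcoeff_mterm: "mcoeff (mterm c m) m' = (if m = m' then c else 0)"
  by (auto simp: mcoeff_def mterm_def multiset_index3_eq_iff)

lemma mcoeff_eqI: "(\<And>m. mcoeff P m = mcoeff Q m) \<Longrightarrow> P = Q"
proof (intro poly_eqI)
  fix a b c assume "\<And>m. mcoeff P m = mcoeff Q m"
  from this[of "mon3 a b c"]
  show "Polynomial.coeff (Polynomial.coeff (Polynomial.coeff P a) b) c =
        Polynomial.coeff (Polynomial.coeff (Polynomial.coeff Q a) b) c"
    by (simp add: mcoeff_def)
qed

lemma finite_mcoeff [simp]: "finite {m. mcoeff P m \<noteq> 0}"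
proof -
  define g :: "3 multiset \<Rightarrow> _" where "g m = (count m 0, count m 1, count m 2)" for m
  have fin: "finite {n. Polynomial.coeff p n \<noteq> 0}" for p :: "'z::zero poly"
    using MOST_coeff_eq_0[of p] unfolding MOST_iff_cofinite by simp
  have "finite (SIGMA a:{a. Polynomial.coeff P a \<noteq> 0}. SIGMA b:{b. Polynomial.coeff (Polynomial.coeff P a) b \<noteq> 0}.
     {c. Polynomial.coeff (Polynomial.coeff (Polynomial.coeff P a) b) c \<noteq> 0})" (is "finite ?S")
    by (intro finite_SigmaI fin)
  moreover have "g ` {m. mcoeff P m \<noteq> 0} \<subseteq> ?S"
    by (auto simp: g_def mcoeff_def)
  moreover have "inj_on g {m. mcoeff P m \<noteq> 0}"
    by (auto simp: inj_on_def g_def multiset_index3_eq_iff)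
  ultimately show ?thesis by (meson finite_imageD finite_subset)
qed

lemma mcoeff_0 [simp]: "mcoeff 0 m = 0"
  by (simp add: mcoeff_def)

lemma mcoeff_add [simp]: "mcoeff (P + Q) m = mcoeff P m + mcoeff (Q :: 'k::comm_monoid_add form3) m"
  by (simp add: mcoeff_def)

lemma mcoeff_diff [simp]: "mcoeff (P - Q) m = mcoeff P m - mcoeff (Q :: 'k::ab_group_add form3) m"
  by (simp add: mcoeff_def)

lemma mcoeff_sum [simp]: "mcoeff (sum f A) m = (\<Sum>x\<in>A. mcoeff (f x :: 'k::comm_monoid_add form3) m)"
  by (induction A rule: infinite_finite_induct) auto

lemma mterm_0 [simp]: "mterm 0 m = 0"
  by (simp add: mterm_def)

lemma mterm_eq_0_iff [simp]: "mterm c m = 0 \<longleftrightarrow> c = 0"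
  by (simp add: mterm_def)

lemma mterm_add: "mterm (a + b) m = mterm a m + mterm (b :: 'k::comm_monoid_add) m"
  by (rule mcoeff_eqI) (simp add: mcoeff_mterm)

lemma mterm_mult: "mterm a m * mterm b n = mterm (a * b :: 'k::comm_semiring_1) (m + n)"
  by (simp add: mterm_def mult_monom)

lemma one_eq_mterm: "1 = mterm (1 :: 'k::comm_semiring_1) {#}"
  by (simp add: mterm_def monom_0 one_pCons)

lemma form3_expand:
  fixes P :: "'k::comm_monoid_add form3"
  assumes "finite A" "\<And>m. mcoeff P m \<noteq> 0 \<Longrightarrow> m \<in> A"
  shows "P = (\<Sum>m\<in>A. mterm (mcoeff P m) m)"
proof (rule mcoeff_eqI)
  fix n
  have "(\<Sum>m\<in>A. mcoeff (mterm (mcoeff P m) m) n) = (\<Sum>m\<in>A. if m = n then mcoeff P n else 0)"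
    by (intro sum.cong) (auto simp: mcoeff_mterm)
  also have "\<dots> = mcoeff P n" using assms by auto
  finally show "mcoeff P n = mcoeff (\<Sum>m\<in>A. mterm (mcoeff P m) m) n" by simp
qed

lemma subset_mon3_iff: "n \<subseteq># m \<longleftrightarrow> count n 0 \<le> count m 0 \<and> count n 1 \<le> count m 1 \<and> count n 2 \<le> count (m :: 3 multiset) 2"
  unfolding subseteq_mset_def all_index3 ..

lemma submultisets_index3:
  "{n. n \<subseteq># (m :: 3 multiset)} =
     (\<lambda>(a, b, c). mon3 a b c) ` ({..count m 0} \<times> {..count m 1} \<times> {..count m 2})" (is "?L = ?g ` ?R")
proof (intro equalityI subsetI)
  fix n assume "n \<in> ?L"
  then have "?g (count n 0, count n 1, count n 2) = n" "(count n 0, count n 1, count n 2) \<in> ?R"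
    by (auto simp: subset_mon3_iff)
  then show "n \<in> ?g ` ?R" by (metis image_eqI)
qed (auto simp: subset_mon3_iff)

lemma finite_submultisets [simp]: "finite {n. n \<subseteq># (m :: 3 multiset)}"
  unfolding submultisets_index3 by simp

lemma inj_mon3: "inj_on (\<lambda>(a, b, c). mon3 a b c) A"
  by (auto simp: inj_on_def multiset_index3_eq_iff)

text \<open>
  The exponents of the factors of a monomial \<open>m\<close> range over a box, so the threefold Cauchy product is a
  single convolution over the divisors of \<open>m\<close>.
\<close>

lemma mcoeff_mult:
  fixes P Q :: "'k::comm_semiring_1 form3"
  shows "mcoeff (P * Q) m = (\<Sum>n | n \<subseteq># m. mcoeff P n * mcoeff Q (m - n))"
proof -
  define p where "p a b c = Polynomial.coeff (Polynomial.coeff (Polynomial.coeff P a) b) c" for a b c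
  define q where "q a b c = Polynomial.coeff (Polynomial.coeff (Polynomial.coeff Q a) b) c" for a b c
  have "mcoeff (P * Q) m =
     (\<Sum>a\<le>count m 0. \<Sum>b\<le>count m 1. \<Sum>c\<le>count m 2.
        p a b c * q (count m 0 - a) (count m 1 - b) (count m 2 - c))"
    by (simp add: mcoeff_def coeff_mult coeff_sum p_def q_def)
  also have "\<dots> = (\<Sum>x\<in>{..count m 0} \<times> {..count m 1} \<times> {..count m 2}.
        (case x of (a, b, c) \<Rightarrow> p a b c * q (count m 0 - a) (count m 1 - b) (count m 2 - c)))"
    by (simp add: sum.cartesian_product)
  also have "\<dots> = (\<Sum>n | n \<subseteq># m. mcoeff P n * mcoeff Q (m - n))"
    unfolding submultisets_index3 sum.reindex[OF inj_mon3]
    by (intro sum.cong) (auto simp: mcoeff_def p_def q_def)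
  finally show ?thesis .
qed

section \<open>Substitution\<close>

definition const :: "'k::zero \<Rightarrow> 'k form3" where "const c = mterm c {#}"
definition xvar :: "3 \<Rightarrow> 'k::zero_neq_one form3" where "xvar i = mterm 1 {#i#}"

definition mono_at :: "(3 \<Rightarrow> 'k::comm_ring_1 form3) \<Rightarrow> 3 multiset \<Rightarrow> 'k form3" where
  "mono_at G m = (\<Prod>i\<in>UNIV. G i ^ count m i)"

definition subst :: "'k::comm_ring_1 form3 \<Rightarrow> (3 \<Rightarrow> 'k form3) \<Rightarrow> 'k form3" where
  "subst P G = (\<Sum>m | mcoeff P m \<noteq> 0. const (mcoeff P m) * mono_at G m)"

lemma const_simps [simp]: "const 0 = 0" "const c = 0 \<longleftrightarrow> c = 0"
  "const (1 :: 'a::comm_semiring_1) = 1"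
  "const (a + b :: 'c::comm_monoid_add) = const a + const b"
  "const (x * y :: 'd::comm_semiring_1) = const x * const y"
  by (simp_all add: const_def mterm_add mterm_mult one_eq_mterm)

lemma const_diff [simp]: "const (a - b :: 'a::comm_ring_1) = const a - const b"
  by (rule mcoeff_eqI) (simp add: const_def mcoeff_mterm)

lemma mcoeff_const_mult [simp]: "mcoeff (const c * P) m = c * mcoeff (P :: 'k::comm_ring_1 form3) m"
proof -
  have "(\<Sum>n | n \<subseteq># m. mcoeff (const c) n * mcoeff P (m - n)) = (\<Sum>n\<in>{{#}}. mcoeff (const c) n * mcoeff P (m - n))"
    by (rule sum.mono_neutral_right) (auto simp: const_def mcoeff_mterm)
  then show ?thesis by (simp add: mcoeff_mult) (simp add: const_def mcoeff_mterm)
qed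

lemma const_mult_mterm: "const c * mterm a m = mterm (c * a :: 'k::comm_ring_1) m"
  by (simp add: const_def mterm_mult)

lemma mono_at_add: "mono_at G (m + n) = mono_at G m * mono_at G n"
  by (simp add: mono_at_def power_add prod.distrib)

lemma mono_at_empty [simp]: "mono_at G {#} = 1"
  by (simp add: mono_at_def)

lemma mono_at_single [simp]: "mono_at G {#i#} = G i"
  by (simp add: mono_at_def prod.remove[of UNIV i])

lemma mono_at_xvar: "mono_at xvar m = mterm (1 :: 'k::comm_ring_1) m"
proof (induction m)
  case (add i m)
  have "mono_at xvar (add_mset i m) = mono_at xvar {#i#} * (mono_at xvar m :: 'k form3)"
    using mono_at_add[of xvar "{#i#}" m] by simp
  also have "\<dots> = xvar i * mterm 1 m" by (simp only: mono_at_single add)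
  also have "\<dots> = mterm 1 (add_mset i m)" by (simp add: xvar_def mterm_mult)
  finally show ?case .
qed (simp add: one_eq_mterm)

lemma subst_superset:
  assumes "finite A" "\<And>m. mcoeff P m \<noteq> 0 \<Longrightarrow> m \<in> A"
  shows "subst P G = (\<Sum>m\<in>A. const (mcoeff P m) * mono_at G m)"
  unfolding subst_def using assms by (intro sum.mono_neutral_left) auto

lemma subst_0 [simp]: "subst 0 G = 0"
  by (simp add: subst_def)

lemma subst_add: "subst (P + Q) G = subst P G + subst Q G"
proof -
  let ?A = "{m. mcoeff P m \<noteq> 0} \<union> {m. mcoeff Q m \<noteq> 0}"
  have "subst P G = (\<Sum>m\<in>?A. const (mcoeff P m) * mono_at G m)" "subst Q G = (\<Sum>m\<in>?A. const (mcoeff Q m) * mono_at G m)"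
    "subst (P + Q) G = (\<Sum>m\<in>?A. const (mcoeff (P + Q) m) * mono_at G m)"
    by (intro subst_superset; auto)+
  then show ?thesis by (simp add: sum.distrib distrib_right)
qed

lemma subst_sum: "subst (sum f A) G = (\<Sum>x\<in>A. subst (f x) G)"
  by (induction A rule: infinite_finite_induct) (auto simp: subst_add)

lemma subst_mterm: "subst (mterm c m) G = const c * mono_at G m"
  by (subst subst_superset[of "{m}"]) (auto simp: mcoeff_mterm split: if_splits)

lemma subst_const [simp]: "subst (const c) G = const c"
  by (simp add: const_def subst_mterm)

lemma subst_1 [simp]: "subst 1 G = 1"
  using subst_const[of 1 G] by simp

lemma subst_xvar [simp]: "subst (xvar i) G = G i"
  by (simp add: xvar_def subst_mterm)

text \<open>
  Both sides are bilinear, so it is enough to compare them on monomials.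
\<close>

lemma subst_mult: "subst (P * Q) G = subst P G * subst Q G"
proof -
  let ?p = "\<lambda>m. mterm (mcoeff P m) m" and ?q = "\<lambda>m. mterm (mcoeff Q m) m"
  let ?A = "{m. mcoeff P m \<noteq> 0}" and ?B = "{m. mcoeff Q m \<noteq> 0}"
  have P: "P = sum ?p ?A" and Q: "Q = sum ?q ?B"
    by (intro form3_expand; simp)+
  have "subst (P * Q) G = subst (sum ?p ?A * sum ?q ?B) G"
    using P Q by simp
  also have "\<dots> = (\<Sum>m\<in>?A. \<Sum>n\<in>?B. subst (?p m * ?q n) G)"
    by (simp add: sum_product subst_sum)
  also have "\<dots> = (\<Sum>m\<in>?A. \<Sum>n\<in>?B. subst (?p m) G * subst (?q n) G)"
    by (simp add: mterm_mult subst_mterm mono_at_add mult_ac)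
  also have "\<dots> = subst (sum ?p ?A) G * subst (sum ?q ?B) G"
    by (simp add: sum_product subst_sum)
  finally show ?thesis using P Q by simp
qed

lemma subst_diff: "subst (P - Q) G = subst P G - subst Q G"
  using subst_add[of "P - Q" Q G] by (simp add: algebra_simps)

lemma subst_power: "subst (P ^ n) G = subst P G ^ n"
  by (induction n) (auto simp: subst_mult)

lemma subst_prod: "subst (prod f A) G = (\<Prod>x\<in>A. subst (f x) G)"
  by (induction A rule: infinite_finite_induct) (auto simp: subst_mult)

lemma subst_mono_at: "subst (mono_at F m) G = mono_at (\<lambda>i. subst (F i) G) m"
  by (simp add: mono_at_def subst_prod subst_power)

lemma subst_subst: "subst (subst P F) G = subst P (\<lambda>i. subst (F i) G)"
  unfolding subst_def[of P] by (simp add: subst_sum subst_mult subst_mono_at)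

lemma subst_id [simp]: "subst P xvar = P"
  using form3_expand[of "{m. mcoeff P m \<noteq> 0}" P]
  by (simp add: subst_def mono_at_xvar const_mult_mterm)

section \<open>Homogeneity\<close>

definition form :: "nat \<Rightarrow> 'k::zero form3 \<Rightarrow> bool" where
  "form d P \<longleftrightarrow> (\<forall>m. mcoeff P m \<noteq> 0 \<longrightarrow> size m = d)"

lemma form_iff: "form d P \<longleftrightarrow> (\<forall>m. size m \<noteq> d \<longrightarrow> mcoeff P m = 0)"
  by (auto simp: form_def)

lemma form_0 [simp]: "form d 0"
  by (simp add: form_def)

lemma form_add: "form d P \<Longrightarrow> form d Q \<Longrightarrow> form d (P + Q :: 'k::comm_monoid_add form3)"
  by (auto simp: form_iff)

lemma form_diff: "form d P \<Longrightarrow> form d Q \<Longrightarrow> form d (P - Q :: 'k::ab_group_add form3)"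
  by (auto simp: form_iff)

lemma form_sum: "(\<And>x. x \<in> A \<Longrightarrow> form d (f x)) \<Longrightarrow> form d (sum f A :: 'k::comm_monoid_add form3)"
  by (induction A rule: infinite_finite_induct) (auto simp: form_add)

lemma form_mult:
  assumes "form d P" "form e Q" shows "form (d + e) (P * Q :: 'k::comm_semiring_1 form3)"
  unfolding form_def
proof (intro allI impI)
  fix m assume "mcoeff (P * Q) m \<noteq> 0"
  then obtain n where n: "n \<subseteq># m" "mcoeff P n * mcoeff Q (m - n) \<noteq> 0"
    unfolding mcoeff_mult by (auto elim!: sum.not_neutral_contains_not_neutral)
  then have "size n = d" "size (m - n) = e"
    using assms unfolding form_def by force+
  then show "size m = d + e" using n(1)
    by (metis size_union subset_mset.add_diff_inverse)
qed

lemma form_mterm: "form (size m) (mterm c m)"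
  by (auto simp: form_def mcoeff_mterm split: if_splits)

lemma form_const [simp]: "form 0 (const c)"
  using form_mterm[of "{#}" c] by (simp add: const_def)

lemma form_1 [simp]: "form 0 (1 :: 'k::comm_semiring_1 form3)"
  using form_const[of "1::'k"] by simp

lemma form_xvar [simp]: "form (Suc 0) (xvar i)"
  using form_mterm[of "{#i#}" 1] by (simp add: xvar_def)

lemma form_power: "form d P \<Longrightarrow> form (n * d) (P ^ n :: 'k::comm_semiring_1 form3)"
  by (induction n) (auto simp: form_mult)

lemma form_const_mult: "form d P \<Longrightarrow> form d (const c * P :: 'k::comm_semiring_1 form3)"
  using form_mult[of 0 "const c" d P] by simp

lemma mono_at_index3: "mono_at G m = G 0 ^ count m 0 * G 1 ^ count m 1 * G 2 ^ count m 2"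
  by (simp add: mono_at_def prod_index3)

lemma form_mono_at:
  assumes "\<And>i. form e (G i)" shows "form (size m * e) (mono_at G m)"
  unfolding mono_at_index3 size_index3 add_mult_distrib
  by (intro form_mult form_power assms)

lemma form_subst:
  assumes "form d P" "\<And>i. form e (G i)" shows "form (d * e) (subst P G)"
  unfolding subst_def
proof (rule form_sum)
  fix m assume "m \<in> {m. mcoeff P m \<noteq> 0}"
  then have "size m = d" using assms(1) by (simp add: form_def)
  then show "form (d * e) (const (mcoeff P m) * mono_at G m)"
    using form_mono_at[OF assms(2), of m] by (auto intro: form_const_mult)
qed

lemma mono_at_scale: "mono_at (\<lambda>i. h * G i) m = h ^ size m * mono_at G m"
proof -
  show ?thesis by (simp add: mono_at_def size_eq_sum_count power_mult_distrib prod.distrib power_sum)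
qed

text \<open>
  This is how common factors of a triple leave a composition: a form of degree \<open>d\<close> sees only the
  \<open>d\<close>-th power of the factor.
\<close>

lemma subst_scale:
  assumes "form d P" shows "subst P (\<lambda>i. h * G i) = h ^ d * subst P G"
proof -
  have "const (mcoeff P m) * mono_at (\<lambda>i. h * G i) m = h ^ d * (const (mcoeff P m) * mono_at G m)" if "mcoeff P m \<noteq> 0" for m
  proof -
    have "size m = d" using that assms unfolding form_def by blast
    then show ?thesis unfolding mono_at_scale by (simp only: mult.left_commute)
  qed
  then have "(\<Sum>m | mcoeff P m \<noteq> 0. const (mcoeff P m) * mono_at (\<lambda>i. h * G i) m) =
      (\<Sum>m | mcoeff P m \<noteq> 0. h ^ d * (const (mcoeff P m) * mono_at G m))"
    by (intro sum.cong) simp_all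
  then show ?thesis unfolding subst_def sum_distrib_left .
qed

lemma nonzero_cfE:
  assumes "P \<noteq> 0" obtains m where "mcoeff P m \<noteq> 0"
proof -
  have "\<exists>m. mcoeff P m \<noteq> 0"
  proof (rule ccontr)
    assume "\<nexists>m. mcoeff P m \<noteq> 0"
    then have "P = 0" by (intro mcoeff_eqI) simp
    with assms show False ..
  qed
  with that show ?thesis by blast
qed

lemma form_unique: "form d P \<Longrightarrow> form e P \<Longrightarrow> P \<noteq> 0 \<Longrightarrow> d = e"
  by (elim nonzero_cfE) (auto simp: form_def)

section \<open>Integer polynomials over other rings\<close>

definition int_form :: "int form3 \<Rightarrow> 'k::comm_ring_1 form3" where
  "int_form = map_poly (map_poly (map_poly of_int))"

lemma mcoeff_int_form [simp]: "mcoeff (int_form P) m = of_int (mcoeff P m)"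
  by (simp add: int_form_def mcoeff_def coeff_map_poly)

lemma int_form_0 [simp]: "int_form 0 = 0"
  by (rule mcoeff_eqI) simp

lemma int_form_add: "int_form (P + Q) = int_form P + int_form Q"
  by (rule mcoeff_eqI) simp

lemma int_form_diff: "int_form (P - Q) = int_form P - int_form Q"
  by (rule mcoeff_eqI) simp

lemma int_form_mult: "int_form (P * Q) = int_form P * int_form Q"
  by (rule mcoeff_eqI) (simp add: mcoeff_mult)

lemma int_form_mterm [simp]: "int_form (mterm c m) = mterm (of_int c) m"
  by (rule mcoeff_eqI) (simp add: mcoeff_mterm)

lemma int_form_const [simp]: "int_form (const c) = const (of_int c)"
  by (simp add: const_def)

lemma int_form_1 [simp]: "int_form 1 = 1"
  using int_form_const[of 1] by simp

lemma int_form_xvar [simp]: "int_form (xvar i) = xvar i"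
  by (simp add: xvar_def)

lemma int_form_sum: "int_form (sum f A) = (\<Sum>x\<in>A. int_form (f x))"
  by (induction A rule: infinite_finite_induct) (auto simp: int_form_add)

lemma int_form_power: "int_form (P ^ n) = int_form P ^ n"
  by (induction n) (auto simp: int_form_mult)

lemma int_form_mono_at: "int_form (mono_at G m) = mono_at (\<lambda>i. int_form (G i)) m"
  by (simp add: mono_at_index3 int_form_mult int_form_power)

lemma int_form_subst: "int_form (subst P G) = subst (int_form P :: 'k::comm_ring_1 form3) (\<lambda>i. int_form (G i))"
proof -
  have "subst (int_form P :: 'k form3) (\<lambda>i. int_form (G i)) =
      (\<Sum>m | mcoeff P m \<noteq> 0. const (mcoeff (int_form P) m) * mono_at (\<lambda>i. int_form (G i)) m)"
    by (rule subst_superset) auto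
  then show ?thesis
    by (simp add: subst_def[of P] int_form_sum int_form_mult int_form_mono_at)
qed

lemma form_int_form: "form d P \<Longrightarrow> form d (int_form P)"
  by (auto simp: form_iff)

lemma int_form_eq_0_iff [simp]: "int_form P = (0 :: 'k::{comm_ring_1,ring_char_0} form3) \<longleftrightarrow> P = 0"
proof
  assume "int_form P = (0 :: 'k form3)"
  then have "mcoeff (int_form P :: 'k form3) m = 0" for m by simp
  then show "P = 0" by (intro mcoeff_eqI) simp
qed simp

section \<open>Factors of forms\<close>

text \<open>
  The image of \<open>P(x, y, z)\<close> under \<open>P \<mapsto> P(tx, ty, tz)\<close>, as a polynomial in \<open>t\<close>. It is multiplicative, and \<open>P\<close> is
  homogeneous iff the image is a single power of \<open>t\<close>; this reduces the homogeneity of factors of forms to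
  the fact that factors of monomials in one variable are monomials.
\<close>

definition grade :: "'k::comm_ring_1 form3 \<Rightarrow> 'k form3 poly" where
  "grade P = (\<Sum>m | mcoeff P m \<noteq> 0. Polynomial.monom (mterm (mcoeff P m) m) (size m))"

lemma grade_superset:
  assumes "finite A" "\<And>m. mcoeff P m \<noteq> 0 \<Longrightarrow> m \<in> A"
  shows "grade P = (\<Sum>m\<in>A. Polynomial.monom (mterm (mcoeff P m) m) (size m))"
  unfolding grade_def using assms by (intro sum.mono_neutral_left) auto

lemma grade_add: "grade (P + Q) = grade P + grade Q"
proof -
  let ?A = "{m. mcoeff P m \<noteq> 0} \<union> {m. mcoeff Q m \<noteq> 0}"
  have "grade P = (\<Sum>m\<in>?A. Polynomial.monom (mterm (mcoeff P m) m) (size m))"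
    "grade Q = (\<Sum>m\<in>?A. Polynomial.monom (mterm (mcoeff Q m) m) (size m))"
    "grade (P + Q) = (\<Sum>m\<in>?A. Polynomial.monom (mterm (mcoeff (P + Q) m) m) (size m))"
    by (intro grade_superset; auto)+
  then show ?thesis by (simp add: sum.distrib mterm_add add_monom[symmetric])
qed

lemma grade_0 [simp]: "grade 0 = 0"
  by (simp add: grade_def)

lemma grade_sum: "grade (sum f A) = (\<Sum>x\<in>A. grade (f x))"
  by (induction A rule: infinite_finite_induct) (auto simp: grade_add)

lemma grade_mterm: "grade (mterm c m) = Polynomial.monom (mterm c m) (size m)"
  by (subst grade_superset[of "{m}"]) (auto simp: mcoeff_mterm split: if_splits)

lemma grade_mult: "grade (P * Q) = grade P * grade Q"
proof -
  let ?p = "\<lambda>m. mterm (mcoeff P m) m" and ?q = "\<lambda>m. mterm (mcoeff Q m) m"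
  let ?A = "{m. mcoeff P m \<noteq> 0}" and ?B = "{m. mcoeff Q m \<noteq> 0}"
  have P: "P = sum ?p ?A" and Q: "Q = sum ?q ?B"
    by (intro form3_expand; simp)+
  have "grade (P * Q) = grade (sum ?p ?A * sum ?q ?B)"
    using P Q by simp
  also have "\<dots> = (\<Sum>m\<in>?A. \<Sum>n\<in>?B. grade (?p m * ?q n))"
    by (simp add: sum_product grade_sum)
  also have "\<dots> = (\<Sum>m\<in>?A. \<Sum>n\<in>?B. grade (?p m) * grade (?q n))"
    by (simp add: mterm_mult grade_mterm mult_monom)
  also have "\<dots> = grade (sum ?p ?A) * grade (sum ?q ?B)"
    by (simp add: sum_product grade_sum)
  finally show ?thesis using P Q by simp
qed

lemma mcoeff_coeff_grade: "mcoeff (Polynomial.coeff (grade P) n) m = (if size m = n then mcoeff P m else 0)"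
proof -
  have "mcoeff (Polynomial.coeff (grade P) n) m =
    (\<Sum>l | mcoeff P l \<noteq> 0. if l = m then (if size m = n then mcoeff P m else 0) else 0)"
    unfolding grade_def coeff_sum mcoeff_sum by (intro sum.cong) (auto simp: mcoeff_mterm)
  then show ?thesis by simp
qed

lemma form_iff_grade: "form d P \<longleftrightarrow> grade P = Polynomial.monom P d"
proof
  assume *: "form d P"
  show "grade P = Polynomial.monom P d"
  proof (rule poly_eqI, rule mcoeff_eqI)
    fix n and m :: "3 multiset"
    show "mcoeff (Polynomial.coeff (grade P) n) m = mcoeff (Polynomial.coeff (Polynomial.monom P d) n) m"
      using * by (auto simp: mcoeff_coeff_grade form_iff)
  qed
next
  assume *: "grade P = Polynomial.monom P d"
  show "form d P" unfolding form_iff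
  proof (intro allI impI)
    fix m :: "3 multiset" assume m: "size m \<noteq> d"
    have "mcoeff P m = mcoeff (Polynomial.coeff (grade P) (size m)) m" by (simp add: mcoeff_coeff_grade)
    also have "\<dots> = 0" using * m by simp
    finally show "mcoeff P m = 0" .
  qed
qed

lemma monom_factor:
  fixes p q :: "'a::idom poly"
  assumes "p * q = Polynomial.monom c d" "c \<noteq> 0"
  shows "\<exists>a n. p = Polynomial.monom a n"
  using assms(1)
proof (induction d arbitrary: p q)
  case 0
  then have "p * q \<noteq> 0" "Polynomial.degree (p * q) = 0"
    using assms(2) by (auto simp: degree_monom_eq)
  then have "Polynomial.degree p = 0" by (auto simp: degree_mult_eq)
  then obtain a where "p = [:a:]" by (metis degree_0_id)
  then show ?case by (metis monom_0)
next
  case (Suc d)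
  have "Polynomial.coeff p 0 * Polynomial.coeff q 0 = 0"
    using arg_cong[OF Suc.prems, of "\<lambda>r. Polynomial.coeff r 0"] by (simp add: coeff_mult)
  then consider "Polynomial.coeff p 0 = 0" | "Polynomial.coeff q 0 = 0" by auto
  then show ?case
  proof cases
    case 1
    then obtain p' where p': "p = pCons 0 p'" by (metis coeff_pCons_0 pCons_cases)
    then have "pCons 0 (p' * q) = pCons 0 (Polynomial.monom c d)"
      using Suc.prems by (simp add: monom_Suc)
    then have "p' * q = Polynomial.monom c d" by simp
    from Suc.IH[OF this] show ?thesis unfolding p' by (metis monom_Suc)
  next
    case 2
    then obtain q' where q': "q = pCons 0 q'" by (metis coeff_pCons_0 pCons_cases)
    then have "pCons 0 (p * q') = pCons 0 (Polynomial.monom c d)"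
      using Suc.prems by (simp add: monom_Suc)
    then have "p * q' = Polynomial.monom c d" by simp
    from Suc.IH[OF this] show ?thesis .
  qed
qed

lemma form_left_factor:
  fixes P Q :: "'k::idom form3"
  assumes "form d (P * Q)" "P * Q \<noteq> 0"
  shows "\<exists>e. form e P"
proof -
  have "grade P * grade Q = Polynomial.monom (P * Q) d"
    using assms(1) by (simp add: form_iff_grade flip: grade_mult)
  from monom_factor[OF this assms(2)] obtain a n where a: "grade P = Polynomial.monom a n" by auto
  have "form n P" unfolding form_iff
  proof (intro allI impI)
    fix m :: "3 multiset" assume m: "size m \<noteq> n"
    have "mcoeff P m = mcoeff (Polynomial.coeff (grade P) (size m)) m" by (simp add: mcoeff_coeff_grade)
    also have "\<dots> = 0" using a m by simp
    finally show "mcoeff P m = 0" .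
  qed
  then show ?thesis ..
qed

lemma form_factor:
  fixes P Q :: "'k::idom form3"
  assumes "form d (P * Q)" "P * Q \<noteq> 0"
  obtains e e' where "form e P" "form e' Q" "d = e + e'"
proof -
  obtain e where e: "form e P" using form_left_factor[OF assms] by auto
  obtain e' where e': "form e' Q" using form_left_factor[of d Q P] assms by (auto simp: mult.commute)
  show thesis using that[OF e e'] form_unique[OF assms(1) form_mult[OF e e'] assms(2)] by simp
qed

lemma form_dvd_degree_le:
  fixes P Q :: "'k::idom form3"
  assumes "P dvd Q" "form d P" "form e Q" "Q \<noteq> 0"
  shows "d \<le> e"
proof -
  obtain R where R: "Q = P * R" using assms(1) by auto
  obtain a b where "form a P" "form b R" "e = a + b"
    using form_factor[of e P R] assms R by metis
  moreover have "P \<noteq> 0" using assms R by auto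
  ultimately show ?thesis using form_unique[OF assms(2)] by auto
qed

section \<open>Reduced triples\<close>

text \<open>
  A triple represents a map by forms of the smallest degree iff it is reduced; \<open>same\<close> says that two
  triples are proportional over the field of rational functions.
\<close>

definition reduced :: "(3 \<Rightarrow> 'k::comm_ring_1 form3) \<Rightarrow> bool" where
  "reduced G \<longleftrightarrow> (\<forall>H. (\<forall>i. H dvd G i) \<longrightarrow> H dvd 1)"

definition same :: "(3 \<Rightarrow> 'k::comm_ring_1 form3) \<Rightarrow> (3 \<Rightarrow> 'k form3) \<Rightarrow> bool" where
  "same F G \<longleftrightarrow> (\<forall>i j. F i * G j = F j * G i)"

lemma reduced_gcd:
  fixes G :: "3 \<Rightarrow> 'k::field_gcd form3"
  assumes "reduced G" shows "gcd (gcd (G 0) (G 1)) (G 2) = 1"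
proof -
  have "\<forall>i. gcd (gcd (G 0) (G 1)) (G 2) dvd G i"
    unfolding all_index3 by (meson dvd_trans gcd_dvd1 gcd_dvd2)
  then have "is_unit (gcd (gcd (G 0) (G 1)) (G 2))" using assms unfolding reduced_def by blast
  then show ?thesis by (metis is_unit_gcd_iff)
qed

lemma exists_reduced:
  fixes F :: "3 \<Rightarrow> 'k::field_gcd form3"
  assumes "F i0 \<noteq> 0"
  obtains h G where "reduced G" "h \<noteq> 0" "\<And>i. F i = h * G i"
proof -
  define h where "h = gcd (gcd (F 0) (F 1)) (F 2)"
  have dvd: "h dvd F i" for i
    using index3_cases[of i] unfolding h_def by (meson dvd_trans gcd_dvd1 gcd_dvd2)
  have greatest: "H dvd h" if "\<And>i. H dvd F i" for H
    using that unfolding h_def by simp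
  have "h \<noteq> 0" using dvd[of i0] assms by auto
  define G where "G i = F i div h" for i
  have F: "F i = h * G i" for i using dvd by (simp add: G_def)
  have "reduced G" unfolding reduced_def
  proof (intro allI impI)
    fix H assume "\<forall>i. H dvd G i"
    then have "h * H dvd h" by (intro greatest) (simp add: F)
    then have "h * H dvd h * 1" by simp
    then show "H dvd 1" using \<open>h \<noteq> 0\<close> by (subst (asm) dvd_mult_cancel_left) auto
  qed
  with that F \<open>h \<noteq> 0\<close> show thesis by blast
qed

text \<open>
  If \<open>p\<close> divides all \<open>a G\<^sub>j\<close>, then it divides their greatest common divisor, which is \<open>a\<close> for a reduced \<open>G\<close>.
\<close>

lemma reduced_dvd:
  fixes G :: "3 \<Rightarrow> 'k::field_gcd form3"
  assumes "reduced G" "\<And>j. p dvd a * G j"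
  shows "p dvd a"
proof -
  have "p dvd gcd (a * G 0) (a * G 1)" using assms(2) by simp
  also have "gcd (a * G 0) (a * G 1) = normalize (a * gcd (G 0) (G 1))"
    by (simp add: gcd_mult_left normalize_mult)
  finally have "p dvd gcd (a * gcd (G 0) (G 1)) (a * G 2)" using assms(2) by simp
  also have "\<dots> = normalize (a * gcd (gcd (G 0) (G 1)) (G 2))"
    by (simp add: gcd_mult_left normalize_mult)
  also have "\<dots> = normalize a" using reduced_gcd[OF assms(1)] by simp
  finally show ?thesis by simp
qed

lemma reduced_nonzero:
  fixes G :: "3 \<Rightarrow> 'k::idom form3"
  assumes "reduced G" shows "\<exists>i. G i \<noteq> 0"
proof (rule ccontr)
  assume "\<nexists>i. G i \<noteq> 0"
  then have "\<forall>i. 0 dvd G i" by simp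
  then have "(0 :: 'k form3) dvd 1" using assms unfolding reduced_def by blast
  then show False by simp
qed

text \<open>
  Since \<open>G\<^sub>i\<close> divides \<open>F\<^sub>i G\<^sub>j = F\<^sub>j G\<^sub>i\<close> for all \<open>j\<close>, it divides \<open>F\<^sub>i\<close>; the quotients agree because the triples are
  proportional.
\<close>

lemma same_reduced:
  fixes F G :: "3 \<Rightarrow> 'k::field_gcd form3"
  assumes "same F G" "reduced G"
  obtains h where "\<And>i. F i = h * G i"
proof -
  have "G i dvd F i" for i
    by (rule reduced_dvd[OF assms(2)]) (use assms(1) in \<open>metis dvd_triv_right same_def\<close>)
  obtain i where i: "G i \<noteq> 0" using reduced_nonzero[OF assms(2)] by auto
  obtain h where h: "F i = G i * h" using \<open>G i dvd F i\<close> by auto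
  have "F j = h * G j" for j
  proof -
    have "F j * G i = F i * G j" using assms(1) unfolding same_def by blast
    also have "\<dots> = (h * G j) * G i" using h by (simp add: mult_ac)
    finally show ?thesis using i by simp
  qed
  with that show thesis by blast
qed

text \<open>
  The members of the net spanned by \<open>G\<close> along a conic. Three different points of a conic are linearly
  independent, so that a common divisor of three of these members divides the whole triple.
\<close>

definition net :: "'k::comm_ring_1 \<Rightarrow> (3 \<Rightarrow> 'k form3) \<Rightarrow> 'k form3" where
  "net s G = G 0 + const s * G 1 + const (s ^ 2) * G 2"

lemma const_unit: "c \<noteq> 0 \<Longrightarrow> const (c :: 'k::field) dvd 1"
proof -
  assume "c \<noteq> 0"
  then have "1 = const c * const (inverse c)" by (simp flip: const_simps(5))
  then show ?thesis by (rule dvdI)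
qed

text \<open>
  The Vandermonde matrix of \<open>a\<close>, \<open>b\<close>, \<open>c\<close> is invertible; divided differences solve for the \<open>G\<^sub>i\<close>.
\<close>

lemma net_common_divisor:
  fixes G :: "3 \<Rightarrow> 'k::field form3"
  assumes "p dvd net a G" "p dvd net b G" "p dvd net c G" "a \<noteq> b" "a \<noteq> c" "b \<noteq> c"
  shows "p dvd G i"
proof -
  have unit: "p dvd const c * x \<Longrightarrow> c \<noteq> 0 \<Longrightarrow> p dvd x" for c :: 'k and x
    using const_unit[of c] by (metis dvd_mult_unit_iff' )
  have 1: "p dvd G 1 + const (a + t) * G 2" if "p dvd net t G" "a \<noteq> t" for t
  proof (rule unit)
    have "const (a - t) * (G 1 + const (a + t) * G 2) = net a G - net t G"
      by (simp add: net_def algebra_simps power2_eq_square)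
    then show "p dvd const (a - t) * (G 1 + const (a + t) * G 2)"
      using dvd_diff[OF assms(1) that(1)] by simp
  qed (use that in simp)
  have 2: "p dvd G 2"
  proof (rule unit)
    have "const (b - c) * G 2 = (G 1 + const (a + b) * G 2) - (G 1 + const (a + c) * G 2)"
      by (simp add: algebra_simps)
    then show "p dvd const (b - c) * G 2"
      using dvd_diff[OF 1[OF assms(2,4)] 1[OF assms(3,5)]] by simp
  qed (use assms in simp)
  have 3: "p dvd G 1"
    using dvd_diff[OF 1[OF assms(2,4)] dvd_mult[OF 2, of "const (a + b)"]] by simp
  have "G 0 = net a G - const a * G 1 - const (a ^ 2) * G 2" by (simp add: net_def)
  then have "p dvd G 0" using assms(1) 2 3 by (metis dvd_diff dvd_mult)
  with 2 3 show ?thesis using index3_cases[of i] by auto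
qed

text \<open>
  Only finitely many primes divide \<open>u\<close>, and each of them divides at most two of the members
  \<open>net s G\<close>. An infinite field therefore has a parameter \<open>s\<close> that avoids them all.
\<close>

lemma generic_coprime:
  fixes G :: "3 \<Rightarrow> 'k::field_gcd form3"
  assumes inf: "infinite (UNIV :: 'k set)" and "reduced G" "u \<noteq> 0"
  obtains s where "coprime (net s G) u"
proof (rule ccontr)
  assume "\<not> thesis"
  with that have nc: "\<not> coprime (net s G) u" for s by blast
  have "\<exists>\<pi>\<in>prime_factors u. \<pi> dvd net s G" for s
  proof -
    let ?h = "gcd (net s G) u"
    have "\<not> is_unit ?h" using nc[of s] by (simp add: coprime_iff_gcd_eq_1)
    moreover have "?h \<noteq> 0" using \<open>u \<noteq> 0\<close> by simp
    ultimately obtain \<pi> where "\<pi> dvd ?h" "Factorial_Ring.prime \<pi>"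
      using prime_divisor_exists by blast
    then show ?thesis using \<open>u \<noteq> 0\<close> by (auto simp: in_prime_factors_iff)
  qed
  then obtain \<pi> where \<pi>: "\<And>s. \<pi> s \<in> prime_factors u" "\<And>s. \<pi> s dvd net s G" by metis
  have "finite (range \<pi>)" by (rule finite_subset[of _ "prime_factors u"]) (use \<pi>(1) in auto)
  \<comment> \<open>By the pigeonhole principle, one prime would divide infinitely many members of the net.\<close>
  with inf obtain s0 where s0: "infinite {s. \<pi> s = \<pi> s0}"
    using pigeonhole_infinite[of UNIV \<pi>] by auto
  then obtain S where S: "S \<subseteq> {s. \<pi> s = \<pi> s0}" "card S = 3"
    using infinite_arbitrarily_large by blast
  then obtain a b c where abc: "a \<noteq> b" "a \<noteq> c" "b \<noteq> c" "a \<in> S" "b \<in> S" "c \<in> S"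
    by (auto simp: card_3_iff)
  then have "\<pi> s0 dvd net a G" "\<pi> s0 dvd net b G" "\<pi> s0 dvd net c G"
    using S(1) \<pi>(2) by (metis (mono_tags, lifting) mem_Collect_eq subsetD)+
  then have "\<forall>i. \<pi> s0 dvd G i" using net_common_divisor abc by blast
  then have "is_unit (\<pi> s0)" using \<open>reduced G\<close> unfolding reduced_def by blast
  moreover have "Factorial_Ring.prime (\<pi> s0)" using \<pi>(1)[of s0] by auto
  ultimately show False using not_prime_unit by blast
qed

section \<open>Systems of linear equations\<close>

lemma underdetermined_system:
  fixes a :: "'j \<Rightarrow> 'i \<Rightarrow> 'k::field"
  assumes "finite J" "finite I" "card J < card I"
  shows "\<exists>x. (\<exists>i\<in>I. x i \<noteq> 0) \<and> (\<forall>j\<in>J. (\<Sum>i\<in>I. a j i * x i) = 0)"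
  using assms
proof (induction J arbitrary: I a rule: finite_induct)
  case empty
  then have "I \<noteq> {}" by auto
  then show ?case by (intro exI[of _ "\<lambda>_. 1"]) auto
next
  case (insert j J)
  show ?case
  proof (cases "\<forall>i\<in>I. a j i = 0")
    case True
    have "card J < card I" using insert by simp
    from insert.IH[OF insert.prems(1) this, of a] True show ?thesis by auto
  next
    case False
    then obtain i0 where i0: "i0 \<in> I" "a j i0 \<noteq> 0" by auto
    define I' where "I' = I - {i0}"
    have I': "finite I'" "i0 \<notin> I'" "I = insert i0 I'" using i0 insert by (auto simp: I'_def)
    have "card J < card I'" using insert I' by simp
    from insert.IH[OF I'(1) this, of "\<lambda>j' i. a j' i - a j' i0 * a j i / a j i0"]
    obtain x where x: "\<exists>i\<in>I'. x i \<noteq> 0"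
      "\<And>j'. j' \<in> J \<Longrightarrow> (\<Sum>i\<in>I'. (a j' i - a j' i0 * a j i / a j i0) * x i) = 0" by blast
    define s where "s = (\<Sum>i\<in>I'. a j i * x i)"
    define y where "y i = (if i = i0 then - s / a j i0 else x i)" for i
    have y: "(\<Sum>i\<in>I. a j' i * y i) = (\<Sum>i\<in>I'. a j' i * x i) - a j' i0 * s / a j i0" for j'
    proof -
      have "(\<Sum>i\<in>I'. a j' i * y i) = (\<Sum>i\<in>I'. a j' i * x i)"
        using I' by (intro sum.cong) (auto simp: y_def)
      then show ?thesis using I' by (simp add: y_def)
    qed
    have "(\<Sum>i\<in>I. a j' i * y i) = 0" if "j' \<in> J" for j'
    proof -
      have "(\<Sum>i\<in>I'. (a j' i - a j' i0 * a j i / a j i0) * x i) =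
          (\<Sum>i\<in>I'. a j' i * x i) - a j' i0 * s / a j i0"
        by (simp add: s_def algebra_simps sum_subtractf sum_distrib_left sum_divide_distrib)
      then show ?thesis using x(2)[OF that] y by simp
    qed
    moreover have "(\<Sum>i\<in>I. a j i * y i) = 0" using y[of j] i0 by (simp add: s_def)
    moreover have "\<exists>i\<in>I. y i \<noteq> 0" using x(1) I' by (auto simp: y_def)
    ultimately show ?thesis by (intro exI[of _ y]) auto
  qed
qed

text \<open>
  Gaussian elimination without division, on the columns of the matrix. A left inverse up to the factor
  \<open>N\<close> keeps the columns independent over every field in which \<open>N\<close> is not zero.
\<close>

lemma integer_matrix_alternative:
  fixes a :: "'j \<Rightarrow> 'i \<Rightarrow> int"
  assumes "finite I" "finite J"
  shows "(\<exists>x. (\<exists>i\<in>I. x i \<noteq> 0) \<and> (\<forall>j\<in>J. (\<Sum>i\<in>I. a j i * x i) = 0)) \<or>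
         (\<exists>N b. N \<noteq> 0 \<and> (\<forall>i\<in>I. \<forall>i'\<in>I. (\<Sum>j\<in>J. b i j * a j i') = (if i = i' then N else 0)))"
  using assms(1)
proof (induction I rule: finite_induct)
  case empty
  show ?case by (intro disjI2 exI[of _ 1]) auto
next
  case (insert i0 I)
  show ?case
  proof (cases "\<exists>x. (\<exists>i\<in>insert i0 I. x i \<noteq> 0) \<and> (\<forall>j\<in>J. (\<Sum>i\<in>insert i0 I. a j i * x i) = 0)")
    case False
    have "\<nexists>x. (\<exists>i\<in>I. x i \<noteq> 0) \<and> (\<forall>j\<in>J. (\<Sum>i\<in>I. a j i * x i) = 0)"
    proof
      assume "\<exists>x. (\<exists>i\<in>I. x i \<noteq> 0) \<and> (\<forall>j\<in>J. (\<Sum>i\<in>I. a j i * x i) = 0)"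
      then obtain x where x: "\<exists>i\<in>I. x i \<noteq> 0" "\<forall>j\<in>J. (\<Sum>i\<in>I. a j i * x i) = 0" by auto
      define y where "y i = (if i = i0 then 0 else x i)" for i
      have "(\<Sum>i\<in>insert i0 I. a j i * y i) = (\<Sum>i\<in>I. a j i * x i)" for j
      proof -
        have "(\<Sum>i\<in>I. a j i * y i) = (\<Sum>i\<in>I. a j i * x i)"
          using insert by (intro sum.cong) (auto simp: y_def)
        then show ?thesis using insert by (simp add: y_def)
      qed
      moreover have "\<exists>i\<in>insert i0 I. y i \<noteq> 0" using x(1) insert by (auto simp: y_def)
      ultimately have "(\<exists>i\<in>insert i0 I. y i \<noteq> 0) \<and> (\<forall>j\<in>J. (\<Sum>i\<in>insert i0 I. a j i * y i) = 0)"
        using x(2) by simp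
      then show False using False by blast
    qed
    with insert.IH obtain N b where N: "N \<noteq> 0"
      and b: "\<And>i i'. i \<in> I \<Longrightarrow> i' \<in> I \<Longrightarrow> (\<Sum>j\<in>J. b i j * a j i') = (if i = i' then N else 0)"
      by blast
    \<comment> \<open>\<open>r\<close> is \<open>N\<close> times column \<open>i0\<close>, with the components along the other columns removed.\<close>
    define c where "c i = (\<Sum>j\<in>J. b i j * a j i0)" for i
    define r where "r j = N * a j i0 - (\<Sum>i\<in>I. a j i * c i)" for j
    have "\<exists>j0\<in>J. r j0 \<noteq> 0"
    proof (rule ccontr)
      assume r: "\<not> (\<exists>j0\<in>J. r j0 \<noteq> 0)"
      define y where "y i = (if i = i0 then N else - c i)" for i
      have "(\<Sum>i\<in>insert i0 I. a j i * y i) = r j" for j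
      proof -
        have "(\<Sum>i\<in>I. a j i * y i) = (\<Sum>i\<in>I. - (a j i * c i))"
          using insert by (intro sum.cong) (auto simp: y_def)
        then show ?thesis using insert by (simp add: y_def r_def sum_negf mult.commute)
      qed
      moreover have "\<exists>i\<in>insert i0 I. y i \<noteq> 0" using N by (auto simp: y_def)
      ultimately have "(\<exists>i\<in>insert i0 I. y i \<noteq> 0) \<and> (\<forall>j\<in>J. (\<Sum>i\<in>insert i0 I. a j i * y i) = 0)"
        using r by simp
      then show False using False by blast
    qed
    then obtain j0 where j0: "j0 \<in> J" "r j0 \<noteq> 0" by auto
    \<comment> \<open>the functional that kills the columns in \<open>I\<close> and sends column \<open>i0\<close> to \<open>r j0\<close>\<close>
    define \<rho> where "\<rho> j = (if j = j0 then N else 0) - (\<Sum>i\<in>I. a j0 i * b i j)" for j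
    have \<rho>: "(\<Sum>j\<in>J. \<rho> j * w j) = N * w j0 - (\<Sum>i\<in>I. a j0 i * (\<Sum>j\<in>J. b i j * w j))" for w
    proof -
      have "(\<Sum>i\<in>I. a j0 i * b i j) * w j = (\<Sum>i\<in>I. a j0 i * (b i j * w j))" for j
        by (simp only: sum_distrib_right mult.assoc)
      then have "\<rho> j * w j = (if j = j0 then N * w j0 else 0) - (\<Sum>i\<in>I. a j0 i * (b i j * w j))" for j
        by (cases "j = j0") (simp_all add: \<rho>_def left_diff_distrib)
      then have "(\<Sum>j\<in>J. \<rho> j * w j) =
          (\<Sum>j\<in>J. (if j = j0 then N * w j0 else 0)) - (\<Sum>j\<in>J. \<Sum>i\<in>I. a j0 i * (b i j * w j))"
        by (simp only: sum_subtractf)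
      also have "(\<Sum>j\<in>J. \<Sum>i\<in>I. a j0 i * (b i j * w j)) = (\<Sum>i\<in>I. a j0 i * (\<Sum>j\<in>J. b i j * w j))"
        by (subst sum.swap) (simp add: sum_distrib_left)
      also have "(\<Sum>j\<in>J. (if j = j0 then N * w j0 else 0)) = N * w j0"
        using j0 assms(2) by simp
      finally show ?thesis .
    qed
    have \<rho>1: "(\<Sum>j\<in>J. \<rho> j * a j i') = 0" if "i' \<in> I" for i'
    proof -
      have "(\<Sum>i\<in>I. a j0 i * (\<Sum>j\<in>J. b i j * a j i')) = (\<Sum>i\<in>I. if i = i' then a j0 i' * N else 0)"
        by (intro sum.cong) (simp_all add: b that)
      also have "\<dots> = a j0 i' * N" using that insert(1) by simp
      finally show ?thesis by (simp add: \<rho>)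
    qed
    have \<rho>2: "(\<Sum>j\<in>J. \<rho> j * a j i0) = r j0"
      by (simp add: \<rho> r_def c_def)
    \<comment> \<open>The old rows are corrected by \<open>\<rho>\<close> so that they kill column \<open>i0\<close> as well.\<close>
    define b' where "b' i j = (if i = i0 then N * \<rho> j else r j0 * b i j - c i * \<rho> j)" for i j
    have "(\<Sum>j\<in>J. b' i j * a j i') = (if i = i' then N * r j0 else 0)"
      if ii: "i \<in> insert i0 I" "i' \<in> insert i0 I" for i i'
    proof (cases "i = i0")
      case True
      then have "(\<Sum>j\<in>J. b' i j * a j i') = N * (\<Sum>j\<in>J. \<rho> j * a j i')"
        by (simp add: b'_def sum_distrib_left mult.assoc)
      with True \<rho>1[of i'] \<rho>2 ii show ?thesis by (cases "i' = i0") simp_all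
    next
      case False
      then have "(\<Sum>j\<in>J. b' i j * a j i') =
          r j0 * (\<Sum>j\<in>J. b i j * a j i') - c i * (\<Sum>j\<in>J. \<rho> j * a j i')"
        by (simp add: b'_def sum_distrib_left mult.assoc left_diff_distrib sum_subtractf)
      moreover have "i \<in> I" using ii False by simp
      ultimately show ?thesis using False \<rho>1[of i'] \<rho>2 ii b[of i i']
        by (cases "i' = i0") (simp_all add: c_def mult.commute)
    qed
    moreover have "N * r j0 \<noteq> 0" using N j0 by simp
    ultimately show ?thesis by blast
  qed simp
qed

section \<open>Counting monomials\<close>

definition mons :: "nat \<Rightarrow> 3 multiset set" where "mons d = {m. size m = d}"

lemma size_mon3 [simp]: "size (mon3 a b c) = a + b + c"
  by (simp add: mon3_def)

lemma mons_eq: "mons d = (\<lambda>(a, b). mon3 a b (d - a - b)) ` (SIGMA a:{..d}. {..d - a})"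
proof (intro equalityI subsetI)
  fix m assume "m \<in> mons d"
  then have d: "d = count m 0 + count m 1 + count m 2" by (simp add: mons_def size_index3)
  have "m = (\<lambda>(a, b). mon3 a b (d - a - b)) (count m 0, count m 1)" by (simp add: d)
  moreover have "(count m 0, count m 1) \<in> (SIGMA a:{..d}. {..d - a})" by (simp add: d)
  ultimately show "m \<in> (\<lambda>(a, b). mon3 a b (d - a - b)) ` (SIGMA a:{..d}. {..d - a})"
    by (rule image_eqI)
qed (auto simp: mons_def)

lemma finite_mons [simp]: "finite (mons d)"
  unfolding mons_eq by auto

lemma card_mons: "2 * card (mons d) = (d + 1) * (d + 2)"
proof -
  have "card (mons d) = card (SIGMA a:{..d}. {..d - a})"
    unfolding mons_eq by (rule card_image) (auto simp: inj_on_def dest: arg_cong[of _ _ "\<lambda>m. count m 0"] arg_cong[of _ _ "\<lambda>m. count m 1"])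
  also have "\<dots> = (\<Sum>a\<le>d. d - a + 1)" by simp
  also have "\<dots> = (\<Sum>a\<le>d. a + 1)"
    by (rule sum.reindex_bij_witness[of _ "\<lambda>a. d - a" "\<lambda>a. d - a"]) auto
  also have "2 * \<dots> = (d + 1) * (d + 2)" by (induction d) auto
  finally show ?thesis .
qed

text \<open>
  A form of degree \<open>d\<close> is divisible by the \<open>t\<close>-th power of the variable \<open>0\<close> iff its coefficients at these
  monomials vanish. There are at most \<open>t (d + 1)\<close> of them, which is linear in \<open>d\<close> for fixed \<open>t\<close>, whereas the
  number of all monomials is quadratic.
\<close>

definition low_mons :: "nat \<Rightarrow> nat \<Rightarrow> 3 multiset set" where
  "low_mons t d = {m \<in> mons d. count m 0 < t}"

lemma finite_low_mons [simp]: "finite (low_mons t d)"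
  by (simp add: low_mons_def)

lemma card_low_mons: "card (low_mons t d) \<le> t * (d + 1)"
proof -
  let ?g = "\<lambda>m :: 3 multiset. (count m 0, count m 1)"
  have "card (low_mons t d) = card (?g ` low_mons t d)"
  proof (rule card_image[symmetric], rule inj_onI)
    fix m n assume mn: "m \<in> low_mons t d" "n \<in> low_mons t d" "?g m = ?g n"
    then have "size m = size n" by (simp add: low_mons_def mons_def)
    with mn(3) show "m = n" by (simp add: size_index3 multiset_index3_eq_iff)
  qed
  also have "\<dots> \<le> card ({..<t} \<times> {..d})"
    by (rule card_mono) (auto simp: low_mons_def mons_def size_index3)
  finally show ?thesis by simp
qed

section \<open>Divisibility by a power of a linear form\<close>

lemma xvar_power: "xvar i ^ n = mterm (1 :: 'k::comm_ring_1) (replicate_mset n i)"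
  by (induction n) (auto simp: one_eq_mterm xvar_def mterm_mult)

lemma xvar_power_dvd:
  fixes P :: "'k::comm_ring_1 form3"
  assumes "\<And>m. mcoeff P m \<noteq> 0 \<Longrightarrow> t \<le> count m 0"
  shows "xvar 0 ^ t dvd P"
proof -
  have P: "P = (\<Sum>m | mcoeff P m \<noteq> 0. mterm (mcoeff P m) m)" by (rule form3_expand) auto
  have "xvar 0 ^ t dvd (\<Sum>m | mcoeff P m \<noteq> 0. mterm (mcoeff P m) m)"
  proof (rule dvd_sum)
    fix m assume "m \<in> {m. mcoeff P m \<noteq> 0}"
    then have "replicate_mset t 0 \<subseteq># m" using assms by (simp flip: count_le_replicate_mset_subset_eq)
    then have "mterm (mcoeff P m) m = xvar 0 ^ t * mterm (mcoeff P m) (m - replicate_mset t 0)"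
      by (simp add: xvar_power mterm_mult)
    then show "xvar 0 ^ t dvd mterm (mcoeff P m) m" by (rule dvdI)
  qed
  with P show ?thesis by simp
qed

text \<open>
  The linear change of coordinates that makes \<open>net s xvar\<close> the variable \<open>0\<close>.
\<close>

definition shear :: "'k::comm_ring_1 \<Rightarrow> 3 \<Rightarrow> 'k form3" where
  "shear s i = (if i = 0 then xvar 0 - const s * xvar 1 - const (s ^ 2) * xvar 2 else xvar i)"

definition unshear :: "'k::comm_ring_1 \<Rightarrow> 3 \<Rightarrow> 'k form3" where
  "unshear s i = (if i = 0 then net s xvar else xvar i)"

lemma subst_net: "subst (net s F) G = net s (\<lambda>i. subst (F i) G)"
  by (simp add: net_def subst_add subst_mult)

lemma shear_unshear: "subst (subst P (shear s)) (unshear s) = P"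
proof -
  have "subst (shear s i) (unshear s) = xvar i" for i
  proof (cases "i = 0")
    case True
    have "unshear s 0 = net s xvar" "unshear s 1 = xvar 1" "unshear s 2 = xvar 2"
      by (simp_all add: unshear_def)
    with True show ?thesis by (simp add: shear_def subst_diff subst_mult) (simp add: net_def)
  qed (simp add: shear_def unshear_def)
  then show ?thesis by (simp only: subst_subst subst_id)
qed

lemma form_net: "(\<And>i. form d (G i)) \<Longrightarrow> form d (net s G)"
  by (simp add: net_def form_add form_const_mult)

lemma form_shear: "form (Suc 0) (shear s i)"
  by (simp add: shear_def form_diff form_const_mult)

lemma net_power_dvd:
  assumes "form d P" "\<And>m. m \<in> low_mons t d \<Longrightarrow> mcoeff (subst P (shear s)) m = 0"
  shows "net s xvar ^ t dvd P"
proof -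
  have "form d (subst P (shear s))" using form_subst[OF assms(1) form_shear[of s]] by simp
  have "xvar 0 ^ t dvd subst P (shear s)"
  proof (rule xvar_power_dvd)
    fix m assume m: "mcoeff (subst P (shear s)) m \<noteq> 0"
    with \<open>form d (subst P (shear s))\<close> have "m \<in> mons d" by (simp add: form_def mons_def)
    with m assms(2)[of m] show "t \<le> count m 0" by (simp add: low_mons_def) (meson not_le)
  qed
  then obtain Q where "subst P (shear s) = xvar 0 ^ t * Q" by auto
  then have "P = net s xvar ^ t * subst Q (unshear s)"
    using shear_unshear[of P s] by (simp add: subst_mult subst_power unshear_def)
  then show ?thesis by (rule dvdI)
qed

text \<open>
  Divisibility by \<open>l\<^sup>t\<close> imposes at most \<open>t (d + 1)\<close> linear conditions on the coefficients \<open>c\<close>.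
\<close>

lemma exists_divisible_combination:
  fixes v :: "'i \<Rightarrow> 'k::field form3"
  assumes "finite I" "\<And>i. i \<in> I \<Longrightarrow> form d (v i)" "t * (d + 1) < card I"
  obtains c where "\<exists>i\<in>I. c i \<noteq> 0" "net s xvar ^ t dvd (\<Sum>i\<in>I. const (c i) * v i)"
proof -
  have "card (low_mons t d) < card I" using card_low_mons assms(3) by (rule le_less_trans)
  from underdetermined_system[OF finite_low_mons assms(1) this, of "\<lambda>m i. mcoeff (subst (v i) (shear s)) m"]
  obtain c where c: "\<exists>i\<in>I. c i \<noteq> 0"
    "\<And>m. m \<in> low_mons t d \<Longrightarrow> (\<Sum>i\<in>I. mcoeff (subst (v i) (shear s)) m * c i) = 0" by blast
  have "net s xvar ^ t dvd (\<Sum>i\<in>I. const (c i) * v i)"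
  proof (rule net_power_dvd)
    show "form d (\<Sum>i\<in>I. const (c i) * v i)" by (intro form_sum form_const_mult assms(2))
    show "mcoeff (subst (\<Sum>i\<in>I. const (c i) * v i) (shear s)) m = 0" if "m \<in> low_mons t d" for m
      using c(2)[OF that] by (simp add: subst_sum subst_mult mult.commute)
  qed
  with c(1) that show thesis by blast
qed

section \<open>The four-point inequality\<close>

text \<open>
  The image of \<open>F\<close> is contained in no curve.
\<close>

definition dominant :: "(3 \<Rightarrow> 'k::comm_ring_1 form3) \<Rightarrow> bool" where
  "dominant F \<longleftrightarrow> (\<forall>d P. form d P \<longrightarrow> subst P F = 0 \<longrightarrow> P = 0)"

lemma dominantD: "dominant F \<Longrightarrow> form d P \<Longrightarrow> subst P F = 0 \<Longrightarrow> P = 0"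
  by (auto simp: dominant_def)

lemma xvar_nonzero [simp]: "xvar i \<noteq> (0 :: 'k::zero_neq_one form3)"
  by (simp add: xvar_def)

lemma dominant_nonzero:
  assumes "dominant F" shows "F i \<noteq> 0"
proof
  assume "F i = 0"
  then have "subst (xvar i) F = 0" by simp
  then show False using dominantD[OF assms form_xvar] by (metis xvar_nonzero)
qed

lemma form_0_const: "form 0 P \<Longrightarrow> P = const (mcoeff P {#})"
  by (rule mcoeff_eqI) (auto simp: form_iff const_def mcoeff_mterm)

lemma dominant_degree_pos:
  fixes F :: "3 \<Rightarrow> 'k::idom form3"
  assumes "dominant F" "\<And>i. form d (F i)" shows "0 < d"
proof (rule ccontr)
  assume "\<not> 0 < d"
  define c where "c i = mcoeff (F i) {#}" for i
  have c: "F i = const (c i)" for i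
    unfolding c_def using \<open>\<not> 0 < d\<close> assms(2)[of i] by (intro form_0_const) simp
  define P where "P = const (c 1) * xvar 0 - const (c 0) * xvar 1"
  have "form (Suc 0) P" unfolding P_def by (intro form_diff form_const_mult form_xvar)
  moreover have "subst P F = 0" by (simp add: P_def subst_diff subst_mult c mult.commute)
  ultimately have "P = 0" using dominantD[OF assms(1)] by blast
  then have "mcoeff P {#0#} = 0" by simp
  then have "c 1 = 0" by (simp add: P_def) (simp add: xvar_def mcoeff_mterm)
  then show False using dominant_nonzero[OF assms(1), of 1] c by simp
qed

lemma form_0_unit: "form 0 P \<Longrightarrow> P \<noteq> 0 \<Longrightarrow> P dvd (1 :: 'k::field form3)"
  by (metis form_0_const const_unit const_simps(1))

lemma reduced_xvar: "reduced (xvar :: 3 \<Rightarrow> 'k::field form3)"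
  unfolding reduced_def
proof (intro allI impI)
  fix H :: "'k form3" assume H: "\<forall>i. H dvd xvar i"
  then obtain Q Q' where Q: "xvar 0 = H * Q" "xvar 1 = H * Q'" by (metis dvdE)
  have nz: "H * Q \<noteq> 0" using Q(1) by (metis xvar_nonzero)
  have "form (Suc 0) (H * Q)" using Q(1) by (metis form_xvar)
  then obtain e e' where e: "form e H" "form e' Q" "Suc 0 = e + e'" using nz by (rule form_factor)
  define G :: "3 \<Rightarrow> 'k form3" where "G i = (if i = 0 then 0 else xvar i)" for i
  have "subst (xvar 0) G = subst H G * subst Q G" "subst (xvar 1) G = subst H G * subst Q' G"
    unfolding Q subst_mult by (rule refl)+
  then have *: "0 = subst H G * subst Q G" "xvar 1 = subst H G * subst Q' G" by (simp_all add: G_def)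
  show "H dvd 1"
  proof (cases e)
    case 0
    then show ?thesis using e nz by (intro form_0_unit) auto
  next
    case (Suc n)
    then have "form 0 Q" using e by simp
    then have "subst Q G = Q" by (metis form_0_const subst_const)
    then have "subst H G = 0" using *(1) nz by auto
    then show ?thesis using *(2) by (metis mult_zero_left xvar_nonzero)
  qed
qed

lemma coprime_dvd_power_mult:
  fixes p :: "'k::field_gcd form3"
  assumes "coprime p u" "p ^ t dvd u ^ a * T" shows "p ^ t dvd T"
  using assms by (meson coprime_dvd_mult_right_iff coprime_power_left_iff coprime_power_right_iff)

lemma form_mterm_mons: "m \<in> mons d \<Longrightarrow> form d (mterm c m)"
  using form_mterm[of m c] by (simp add: mons_def)

text \<open>
  A birational map \<open>f\<close> with inverse \<open>g\<close>, both given by reduced triples, and reduced triples \<open>R n\<close> for the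
  iterates of \<open>f\<close>, of degrees \<open>d n\<close>. The factors \<open>u n\<close> and \<open>v\<close> are the common factors that appear when the
  reduced triples are composed.
\<close>

locale reduced_orbit =
  fixes f g :: "3 \<Rightarrow> 'k::field_gcd form3" and R :: "nat \<Rightarrow> 3 \<Rightarrow> 'k form3"
    and u :: "nat \<Rightarrow> 'k form3" and v :: "'k form3"
    and d :: "nat \<Rightarrow> nat" and \<alpha> \<beta> :: nat
  assumes infinite_field: "infinite (UNIV :: 'k set)"
    and form_g: "\<And>i. form \<beta> (g i)" and reduced_g: "reduced g"
    and g_f: "\<And>i. subst (g i) f = v * xvar i" and v_nonzero: "v \<noteq> 0"
    and R_0: "R 0 = xvar" and R_1: "R (Suc 0) = f"
    and form_R: "\<And>n i. form (d n) (R n i)" and reduced_R: "\<And>n. reduced (R n)"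
    and dominant_R: "\<And>n. dominant (R n)"
    and f_R: "\<And>n i. subst (f i) (R n) = u n * R (Suc n) i"
    and d_1: "d (Suc 0) = \<alpha>"
begin

lemma form_f: "form \<alpha> (f i)" using form_R[of "Suc 0" i] by (simp add: R_1 d_1)
lemma dominant_f: "dominant f" using dominant_R[of "Suc 0"] by (simp add: R_1)

lemma d_pos: "0 < d n"
  using dominant_degree_pos[OF dominant_R form_R] .

lemma alpha_pos: "0 < \<alpha>"
  using d_pos[of "Suc 0"] by (simp add: d_1)

lemma u_nonzero: "u n \<noteq> 0"
  using f_R[of 0 n] dominantD[OF dominant_R[of n] form_f[of 0]] dominant_nonzero[OF dominant_f, of 0] by auto

lemma form_v: "\<exists>e. form e v"
proof -
  have "form (\<beta> * \<alpha>) (v * xvar 0)" using form_subst[where G = f, OF form_g[of 0] form_f] unfolding g_f .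
  moreover have "v * xvar 0 \<noteq> 0" using v_nonzero by simp
  ultimately show ?thesis by (rule form_left_factor)
qed

lemma f_g:
  obtains w where "w \<noteq> 0" "\<And>i. subst (f i) g = w * xvar i"
proof -
  have undo: "subst (subst (f i) g) f = v ^ \<alpha> * f i" for i
    unfolding subst_subst g_f using subst_scale[OF form_f, of i v xvar] by simp
  have "same (\<lambda>i. subst (f i) g) xvar" unfolding same_def
  proof (intro allI)
    fix i j
    let ?P = "subst (f i) g * xvar j - subst (f j) g * xvar i"
    have "form (\<alpha> * \<beta> + Suc 0) ?P"
      by (intro form_diff form_mult form_subst form_f form_g form_xvar)
    moreover have "subst ?P f = 0" by (simp add: subst_diff subst_mult undo mult_ac)
    ultimately have "?P = 0" using dominantD[OF dominant_f] by blast
    then show "subst (f i) g * xvar j = subst (f j) g * xvar i" by simp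
  qed
  then obtain w where w: "\<And>i. subst (f i) g = w * xvar i" using same_reduced[OF _ reduced_xvar] by blast
  moreover have "w \<noteq> 0"
  proof
    assume "w = 0"
    then have "v ^ \<alpha> * f 0 = 0" using w[of 0] undo[of 0] by simp
    then show False using v_nonzero dominant_nonzero[OF dominant_f] by simp
  qed
  ultimately show thesis using that by blast
qed

text \<open>
  The image under \<open>f\<close> of a line \<open>l = 0\<close> is contained in a curve \<open>P = 0\<close> of degree \<open>2\<alpha>\<close>, because there are more
  monomials of degree \<open>2\<alpha>\<close> than coefficients of a form of degree \<open>2\<alpha>\<^sup>2\<close> in two variables. The form \<open>l(g)\<close>
  of degree \<open>\<beta>\<close> vanishes on the same image; for a generic \<open>l\<close> it divides \<open>P\<close>.
\<close>

lemma inverse_degree_le: "\<beta> \<le> 2 * \<alpha>"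
proof -
  obtain w where w: "w \<noteq> 0" "\<And>i. subst (f i) g = w * xvar i" using f_g by blast
  obtain s where s: "coprime (net s g) w"
    using generic_coprime[OF infinite_field reduced_g w(1)] by blast
  have "2 * (2 * \<alpha> * \<alpha> + 1) < 2 * card (mons (2 * \<alpha>))"
    unfolding card_mons using alpha_pos by (simp add: algebra_simps)
  then have many: "1 * (2 * \<alpha> * \<alpha> + 1) < card (mons (2 * \<alpha>))" by simp
  have forms: "form (2 * \<alpha> * \<alpha>) (mono_at f m)" if "m \<in> mons (2 * \<alpha>)" for m
    using form_mono_at[of \<alpha> f m] form_f that by (simp add: mons_def)
  obtain c where c: "\<exists>m\<in>mons (2 * \<alpha>). c m \<noteq> 0"
    "net s xvar ^ 1 dvd (\<Sum>m\<in>mons (2 * \<alpha>). const (c m) * mono_at f m)"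
    by (rule exists_divisible_combination[where v = "mono_at f" and s = s, OF finite_mons forms many])
  define P where "P = (\<Sum>m\<in>mons (2 * \<alpha>). mterm (c m) m)"
  have "mcoeff P m = c m" if "m \<in> mons (2 * \<alpha>)" for m
    using that by (simp add: P_def mcoeff_mterm)
  then have "P \<noteq> 0" using c(1) mcoeff_0 by metis
  have form_P: "form (2 * \<alpha>) P"
    unfolding P_def by (intro form_sum form_mterm_mons)
  have "net s xvar dvd subst P f" using c(2) by (simp add: P_def subst_sum subst_mterm)
  then obtain Q where "subst P f = net s xvar * Q" by auto
  then have "net s g dvd subst (subst P f) g" by (simp add: subst_mult subst_net)
  also have "subst (subst P f) g = w ^ (2 * \<alpha>) * P"
    unfolding subst_subst w using subst_scale[OF form_P, of w xvar] by simp
  finally have "net s g dvd P"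
    using coprime_dvd_power_mult[OF s, of 1 "2 * \<alpha>" P] by simp
  then show ?thesis
    using form_dvd_degree_le[OF _ form_net[where G = g, OF form_g] form_P \<open>P \<noteq> 0\<close>] by blast
qed

lemma g_R:
  obtains w where "w \<noteq> 0" "\<And>i. subst (g i) (R (Suc n)) = w * R n i"
proof -
  let ?v = "subst v (R n)"
  have eq: "u n ^ \<beta> * subst (g i) (R (Suc n)) = ?v * R n i" for i
  proof -
    have "u n ^ \<beta> * subst (g i) (R (Suc n)) = subst (g i) (\<lambda>j. subst (f j) (R n))"
      unfolding f_R by (rule subst_scale[OF form_g, symmetric])
    also have "\<dots> = ?v * R n i" by (simp add: g_f subst_mult flip: subst_subst)
    finally show ?thesis .
  qed
  have "same (\<lambda>i. subst (g i) (R (Suc n))) (R n)" unfolding same_def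
  proof (intro allI)
    fix i j
    have "u n ^ \<beta> * (subst (g i) (R (Suc n)) * R n j) = u n ^ \<beta> * (subst (g j) (R (Suc n)) * R n i)"
      unfolding mult.assoc[symmetric] eq by (simp add: mult_ac)
    then show "subst (g i) (R (Suc n)) * R n j = subst (g j) (R (Suc n)) * R n i"
      using u_nonzero by simp
  qed
  then obtain w where w: "\<And>i. subst (g i) (R (Suc n)) = w * R n i"
    using same_reduced[OF _ reduced_R] by blast
  moreover have "w \<noteq> 0"
  proof
    assume "w = 0"
    then have "?v * R n 0 = 0" using eq[of 0] w[of 0] by simp
    then have "?v = 0" using dominant_nonzero[OF dominant_R] by simp
    then show False using form_v dominantD[OF dominant_R] v_nonzero by blast
  qed
  ultimately show thesis using that by blast
qed

text \<open>
  Modulo \<open>B\<close> only the last summand survives, so \<open>B\<close> divides the last coefficient, which is too small to be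
  divisible. The rest is \<open>B\<close> times a sum of the same kind.
\<close>

lemma binary_form_independence:
  fixes A B :: "'k form3"
  assumes "coprime B A" "B \<noteq> 0" "form e B" "m < e" "\<And>j. form m (Q j)"
    "(\<Sum>j\<le>N. Q j * A ^ j * B ^ (N - j)) = 0" "j \<le> N"
  shows "Q j = 0"
proof -
  have small: "Q j = 0" if "B dvd Q j" for j
  proof (rule ccontr)
    assume "Q j \<noteq> 0"
    with form_dvd_degree_le[OF that assms(3,5)] assms(4) show False by simp
  qed
  show ?thesis using assms(6,7)
  proof (induction N arbitrary: j)
    case (Suc N)
    have "(\<Sum>j\<le>N. Q j * A ^ j * B ^ (Suc N - j)) = B * (\<Sum>j\<le>N. Q j * A ^ j * B ^ (N - j))"
      unfolding sum_distrib_left by (intro sum.cong) (auto simp: Suc_diff_le mult_ac)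
    with Suc.prems(1)
    have split: "B * (\<Sum>j\<le>N. Q j * A ^ j * B ^ (N - j)) + A ^ Suc N * Q (Suc N) = 0"
      by (simp add: mult.commute)
    then have "A ^ Suc N * Q (Suc N) = B * (- (\<Sum>j\<le>N. Q j * A ^ j * B ^ (N - j)))"
      by (simp add: add_eq_0_iff)
    then have "B dvd A ^ Suc N * Q (Suc N)" by (rule dvdI)
    moreover have "coprime B (A ^ Suc N)" using assms(1) coprime_power_right_iff by blast
    ultimately have "B dvd Q (Suc N)" using coprime_dvd_mult_right_iff by blast
    then have top: "Q (Suc N) = 0" by (rule small)
    then have "(\<Sum>j\<le>N. Q j * A ^ j * B ^ (N - j)) = 0"
      using split assms(2) by simp
    with Suc.IH Suc.prems(2) top show ?case by (cases "j = Suc N") auto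
  qed simp
qed

lemma net_f_R: "net s (\<lambda>i. subst (f i) (R n)) = u n * net s (R (Suc n))"
  unfolding f_R by (simp add: net_def algebra_simps)

lemma exists_nonzero_net:
  obtains s where "net s (R n) \<noteq> 0"
proof -
  obtain s where "coprime (net s (R n)) (xvar 0)"
    using generic_coprime[OF infinite_field reduced_R xvar_nonzero] by blast
  moreover have "\<not> xvar 0 dvd (1 :: 'k form3)"
    using form_dvd_degree_le[of "xvar 0" "1 :: 'k form3" "Suc 0" 0] by auto
  ultimately have "net s (R n) \<noteq> 0" by auto
  with that show thesis .
qed

text \<open>
  The dimension count, for parameters \<open>k\<close> and \<open>t\<close> that are optimized afterwards. The forms \<open>V (j, \<mu>)\<close> below are the
  products \<open>\<mu>(g) A(f)\<^sup>j B(f)\<^sup>N\<^sup>-\<^sup>j\<close>, where \<open>\<mu>\<close> is a monomial of degree \<open>m = k \<alpha>\<close> and \<open>N = k \<beta>\<close>. With these values the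
  two kinds of factors contribute the same degree \<open>k \<alpha> \<beta>\<close>.
\<close>

lemma four_point_count:
  assumes k: "k * \<alpha> < d 2" and t: "4 * \<alpha> * t < (k * \<alpha> + 1) * (k * \<alpha> + 2)"
  shows "t * d (Suc n) \<le> k * (\<alpha> * d n + \<beta> * d (Suc (Suc n)))"
proof -
  define m N where "m = k * \<alpha>" and "N = k * \<beta>"
  have two: "2 = Suc (Suc 0)" by simp
  \<comment> \<open>\<open>a\<close> and \<open>b\<close> select two linear forms whose values on the second iterate are coprime.\<close>
  obtain b where b: "net b (R 2) \<noteq> 0" using exists_nonzero_net by blast
  obtain a where a: "coprime (net a (R 2)) (net b (R 2))"
    using generic_coprime[OF infinite_field reduced_R b] by blast
  obtain w where w: "w \<noteq> 0" "\<And>i. subst (g i) (R (Suc n)) = w * R n i" using g_R[of n] by blast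
  have "u (Suc n) * w \<noteq> 0" using w(1) u_nonzero by simp
  \<comment> \<open>\<open>l\<close> is the linear form with parameter \<open>s\<close>; its value on \<open>R (Suc n)\<close> avoids the factors that appear in the composition with \<open>R (Suc n)\<close>.\<close>
  then obtain s where s: "coprime (net s (R (Suc n))) (u (Suc n) * w)"
    using generic_coprime[OF infinite_field reduced_R] by blast
  define V where "V = (\<lambda>(j, \<mu>). mono_at g \<mu> * net a f ^ j * net b f ^ (N - j))"
  define I where "I = {..N} \<times> mons m"
  have forms: "form (2 * k * \<alpha> * \<beta>) (V i)" if "i \<in> I" for i
  proof -
    obtain j \<mu> where i1: "i = (j, \<mu>)" by (rule prod.exhaust)
    then have i: "i = (j, \<mu>)" "j \<le> N" "size \<mu> = m"
      using that by (simp_all add: I_def mons_def)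
    have "size \<mu> * \<beta> + j * \<alpha> + (N - j) * \<alpha> = m * \<beta> + N * \<alpha>"
      using i(2,3) by (metis add.assoc add_mult_distrib le_add_diff_inverse)
    also have "\<dots> = 2 * k * \<alpha> * \<beta>" by (simp add: m_def N_def)
    finally have eq: "size \<mu> * \<beta> + j * \<alpha> + (N - j) * \<alpha> = 2 * k * \<alpha> * \<beta>" .
    have "form (size \<mu> * \<beta> + j * \<alpha> + (N - j) * \<alpha>) (mono_at g \<mu> * net a f ^ j * net b f ^ (N - j))"
      by (intro form_mult form_power form_net form_mono_at form_f form_g)
    then show ?thesis unfolding eq by (simp add: V_def i(1))
  qed
  have many: "t * (2 * k * \<alpha> * \<beta> + 1) < card I"
  proof -
    have "2 * (t * (2 * k * \<alpha> * \<beta> + 1)) \<le> (N + 1) * (4 * \<alpha> * t)"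
      using alpha_pos by (simp add: N_def algebra_simps)
    also have "\<dots> < (N + 1) * ((m + 1) * (m + 2))"
      using t unfolding m_def by (intro mult_less_mono2) simp_all
    also have "\<dots> = (N + 1) * (2 * card (mons m))" unfolding card_mons ..
    also have "\<dots> = 2 * card I"
      by (simp add: I_def card_cartesian_product)
    finally show ?thesis by simp
  qed
  have "finite I" by (simp add: I_def)
  then obtain c where c: "\<exists>i\<in>I. c i \<noteq> 0" "net s xvar ^ t dvd (\<Sum>i\<in>I. const (c i) * V i)"
    by (rule exists_divisible_combination[where v = V and s = s, OF _ forms many])
  define Q where "Q j = (\<Sum>\<mu>\<in>mons m. mterm (c (j, \<mu>)) \<mu>)" for j
  have form_Q: "form m (Q j)" for j
    unfolding Q_def by (intro form_sum form_mterm_mons)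
  \<comment> \<open>\<open>T g f\<close> is the form \<open>S\<close>; composing it with an iterate replaces \<open>g\<close> and \<open>f\<close> by the preceding and the following iterate.\<close>
  define T where "T G F = (\<Sum>j\<le>N. subst (Q j) G * net a F ^ j * net b F ^ (N - j))" for G F :: "3 \<Rightarrow> 'k form3"
  have form_T_summand: "form (m * e + N * e') (subst (Q j) G * net a F ^ j * net b F ^ (N - j))"
    if "j \<le> N" "\<And>i. form e (G i)" "\<And>i. form e' (F i)" for j e e' G F
  proof -
    have "form (m * e + j * e' + (N - j) * e') (subst (Q j) G * net a F ^ j * net b F ^ (N - j))"
      using that by (intro form_mult form_power form_net form_subst form_Q)
    moreover have "m * e + j * e' + (N - j) * e' = m * e + N * e'"
      using that(1) by (metis add.assoc add_mult_distrib le_add_diff_inverse)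
    ultimately show ?thesis by simp
  qed
  have "(\<Sum>i\<in>I. const (c i) * V i) = (\<Sum>j\<le>N. \<Sum>\<mu>\<in>mons m. const (c (j, \<mu>)) * V (j, \<mu>))"
    by (simp add: I_def sum.cartesian_product case_prod_beta')
  also have "\<dots> = T g f"
    by (simp add: T_def V_def Q_def subst_sum subst_mterm sum_distrib_right mult.assoc)
  finally have S: "(\<Sum>i\<in>I. const (c i) * V i) = T g f" .
  have subst_T: "subst (T g f) (R n') = x ^ m * u n' ^ N * T G (R (Suc n'))"
    if x: "\<And>i. subst (g i) (R n') = x * G i" for x G n'
  proof -
    have "subst (subst (Q j) g * net a f ^ j * net b f ^ (N - j)) (R n') =
        x ^ m * u n' ^ N * (subst (Q j) G * net a (R (Suc n')) ^ j * net b (R (Suc n')) ^ (N - j))"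
      if "j \<le> N" for j
    proof -
      have "u n' ^ N = u n' ^ j * u n' ^ (N - j)" using that by (simp flip: power_add)
      moreover have "subst (subst (Q j) g) (R n') = x ^ m * subst (Q j) G"
        unfolding subst_subst x by (rule subst_scale[OF form_Q])
      ultimately show ?thesis
        by (simp add: subst_mult subst_power subst_net net_f_R power_mult_distrib mult_ac)
    qed
    then show ?thesis unfolding T_def subst_sum sum_distrib_left by (intro sum.cong) auto
  qed
  \<comment> \<open>Composition with \<open>f\<close> itself: the preceding iterate is the identity, the following one is \<open>R 2\<close>.\<close>
  have T_gf: "T g f \<noteq> 0"
  proof
    assume "T g f = 0"
    then have "v ^ m * u 1 ^ N * T xvar (R 2) = 0"
      using subst_T[of "Suc 0" v xvar] g_f by (simp add: R_1 two)
    then have "(\<Sum>j\<le>N. Q j * net a (R 2) ^ j * net b (R 2) ^ (N - j)) = 0"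
      using v_nonzero u_nonzero by (simp add: T_def)
    then have "Q j = 0" if "j \<le> N" for j
      using binary_form_independence[OF _ b form_net[where G = "R 2", OF form_R] _ form_Q _ that] a k
      by (simp add: m_def coprime_commute)
    moreover have "mcoeff (Q j) \<mu> = c (j, \<mu>)" if "\<mu> \<in> mons m" for j \<mu>
      using that by (simp add: Q_def mcoeff_mterm)
    moreover obtain j \<mu> where "j \<le> N" "\<mu> \<in> mons m" "c (j, \<mu>) \<noteq> 0"
      using c(1) by (auto simp: I_def)
    ultimately show False by (metis mcoeff_0)
  qed
  have form_S: "form (m * \<beta> + N * \<alpha>) (T g f)"
  proof -
    show ?thesis unfolding T_def
      by (rule form_sum, rule form_T_summand) (simp_all add: form_f form_g)
  qed
  from T_gf have "subst (T g f) (R (Suc n)) \<noteq> 0" by (metis dominantD[OF dominant_R[of "Suc n"] form_S])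
  then have T_nz: "T (R n) (R (Suc (Suc n))) \<noteq> 0"
    unfolding subst_T[of "Suc n" w "R n", OF w(2)] by (metis mult_zero_right)
  have form_T: "form (m * d n + N * d (Suc (Suc n))) (T (R n) (R (Suc (Suc n))))"
  proof -
    show ?thesis unfolding T_def
      by (rule form_sum, rule form_T_summand) (simp_all add: form_R)
  qed
  have "net s xvar ^ t dvd T g f" using c(2) unfolding S .
  then obtain S' where "T g f = net s xvar ^ t * S'" by (rule dvdE)
  then have "net s (R (Suc n)) ^ t dvd subst (T g f) (R (Suc n))"
    by (simp add: subst_mult subst_power subst_net)
  also have "\<dots> = w ^ m * (u (Suc n) ^ N * T (R n) (R (Suc (Suc n))))"
    unfolding subst_T[of "Suc n" w "R n", OF w(2)] by (rule mult.assoc)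
  finally have dvd: "net s (R (Suc n)) ^ t dvd w ^ m * (u (Suc n) ^ N * T (R n) (R (Suc (Suc n))))" .
  have s': "coprime (net s (R (Suc n))) (u (Suc n))" "coprime (net s (R (Suc n))) w"
    using s by simp_all
  have "net s (R (Suc n)) ^ t dvd T (R n) (R (Suc (Suc n)))"
    by (rule coprime_dvd_power_mult[OF s'(1) coprime_dvd_power_mult[OF s'(2) dvd]])
  then have "t * d (Suc n) \<le> m * d n + N * d (Suc (Suc n))"
    by (rule form_dvd_degree_le[OF _ form_power[OF form_net[where G = "R (Suc n)", OF form_R]] form_T T_nz])
  then show ?thesis by (simp add: m_def N_def algebra_simps)
qed

text \<open>
  The largest \<open>k\<close> with \<open>k \<alpha> < d\<^sub>2\<close> loses at most a factor \<open>2\<close> in \<open>k \<alpha>\<close>; the best \<open>t\<close> is about \<open>k\<^sup>2 \<alpha> / 4\<close>.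
\<close>

theorem four_point_inequality:
  assumes "\<alpha> < d 2"
  shows "d 2 * d (Suc n) \<le> 8 * (\<alpha> * d n + \<beta> * d (Suc (Suc n)))"
proof -
  define k where "k = (d 2 - 1) div \<alpha>"
  have "k * \<alpha> \<le> d 2 - 1" by (simp add: k_def)
  then have k1: "k * \<alpha> < d 2" using assms by linarith
  have "1 \<le> k" using assms alpha_pos by (simp add: k_def div_greater_zero_iff Suc_leI)
  then have "\<alpha> \<le> k * \<alpha>" by simp
  moreover have "d 2 - 1 < k * \<alpha> + \<alpha>"
    using alpha_pos unfolding k_def by (metis add.commute div_mult_mod_eq mod_less_divisor nat_add_left_cancel_less mult.commute)
  ultimately have k2: "d 2 \<le> 2 * (k * \<alpha>)" by linarith
  define t where "t = (k * k * \<alpha> + 3) div 4"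
  have t: "k * k * \<alpha> \<le> 4 * t" "4 * t \<le> k * k * \<alpha> + 3" unfolding t_def by linarith+
  have "4 * \<alpha> * t \<le> \<alpha> * (k * k * \<alpha> + 3)" using mult_le_mono2[OF t(2), of \<alpha>] by (simp add: mult_ac)
  also have "\<dots> = (k * \<alpha>) * (k * \<alpha>) + 3 * \<alpha>" by (simp add: algebra_simps)
  also have "\<dots> < (k * \<alpha>) * (k * \<alpha>) + 3 * (k * \<alpha>) + 2" using \<open>\<alpha> \<le> k * \<alpha>\<close> by linarith
  also have "\<dots> = (k * \<alpha> + 1) * (k * \<alpha> + 2)" by (simp add: algebra_simps)
  finally have main: "t * d (Suc n) \<le> k * (\<alpha> * d n + \<beta> * d (Suc (Suc n)))" (is "_ \<le> k * ?X")
    by (rule four_point_count[OF k1])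
  have "k * (k * \<alpha> * d (Suc n)) = k * k * \<alpha> * d (Suc n)" by (simp only: mult.assoc)
  also have "\<dots> \<le> 4 * t * d (Suc n)" by (rule mult_le_mono1[OF t(1)])
  also have "\<dots> = 4 * (t * d (Suc n))" by (simp only: mult.assoc)
  also have "\<dots> \<le> 4 * (k * ?X)" by (rule mult_le_mono2[OF main])
  also have "\<dots> = k * (4 * ?X)" by (rule mult.left_commute)
  finally have le: "k * \<alpha> * d (Suc n) \<le> 4 * ?X" using \<open>1 \<le> k\<close> by (metis mult_le_cancel1 not_one_le_zero gr0I)
  have "d 2 * d (Suc n) \<le> 2 * (k * \<alpha>) * d (Suc n)" by (rule mult_le_mono1[OF k2])
  also have "\<dots> = 2 * (k * \<alpha> * d (Suc n))" by (simp only: mult.assoc)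
  also have "\<dots> \<le> 2 * (4 * ?X)" by (rule mult_le_mono2[OF le])
  finally show ?thesis by simp
qed

end

section \<open>Growth of degree sequences\<close>

text \<open>
  Fekete's lemma in multiplicative form.
\<close>

lemma submultiplicative_root_limit:
  fixes D :: "nat \<Rightarrow> real"
  assumes ge1: "\<And>n. 1 \<le> D n" and submult: "\<And>m n. D (m + n) \<le> D m * D n"
  shows "\<exists>l. (\<lambda>n. root n (D n)) \<longlonglongrightarrow> l \<and> 1 \<le> l \<and> (\<forall>n\<ge>1. l \<le> root n (D n))"
proof -
  define l where "l = (INF n\<in>{1..}. root n (D n))"
  have root_ge: "1 \<le> root n (D n)" if "1 \<le> n" for n using ge1 that by simp
  have bdd: "bdd_below ((\<lambda>n. root n (D n)) ` {1..})" using root_ge by (intro bdd_belowI[of _ 1]) auto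
  have l_le: "l \<le> root n (D n)" if "1 \<le> n" for n
    unfolding l_def using bdd that by (intro cINF_lower) auto
  have l_ge: "1 \<le> l" unfolding l_def using root_ge by (intro cINF_greatest) auto
  have pow: "D (q * m) \<le> D m ^ q" if "1 \<le> q" for q m
    using that
  proof (induction q rule: dec_induct)
    case (step q)
    have "D (Suc q * m) \<le> D m * D (q * m)" using submult[of m "q * m"] by simp
    also have "\<dots> \<le> D m * D m ^ q" using step.IH ge1[of m] by (intro mult_left_mono) auto
    finally show ?case by simp
  qed simp
  have "(\<lambda>n. root n (D n)) \<longlonglongrightarrow> l"
  proof (rule LIMSEQ_I)
    fix r :: real assume r: "0 < r"
    have "\<exists>x\<in>(\<lambda>n. root n (D n)) ` {1..}. x < l + r / 2"
      using r bdd unfolding l_def by (intro cInf_lessD) auto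
    then obtain m where m: "1 \<le> m" "root m (D m) < l + r / 2" by auto
    define c where "c = root m (D m)"
    have c1: "1 \<le> c" unfolding c_def using root_ge m by simp
    have Dm: "D m = c ^ m" unfolding c_def using m ge1[of m] by simp
    \<comment> \<open>Division of \<open>n\<close> by \<open>m\<close> with remainder bounds \<open>D n\<close> by \<open>M c\<^sup>n\<close>, where \<open>M\<close> bounds the values at the remainders.\<close>
    define M where "M = (MAX k\<in>{..<m}. D k)"
    have M: "D k \<le> M" if "k < m" for k unfolding M_def using that by (intro Max_ge) auto
    have M1: "1 \<le> M" using M[of 0] m ge1[of 0] by simp
    have bound: "root n (D n) \<le> root n M * c" if "1 \<le> n" for n
    proof -
      have "D n \<le> M * c ^ n"
      proof (cases "n < m")
        case True
        then have "D n \<le> M * 1" using M by simp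
        also have "\<dots> \<le> M * c ^ n" using M1 c1 by (intro mult_left_mono) auto
        finally show ?thesis .
      next
        case False
        then have q: "1 \<le> n div m" using m by (simp add: Suc_le_eq div_greater_zero_iff)
        have "D n = D (n mod m + n div m * m)" by simp
        also have "\<dots> \<le> D (n mod m) * D (n div m * m)" by (rule submult)
        also have "\<dots> \<le> M * D m ^ (n div m)"
          using M[of "n mod m"] pow[OF q, of m] ge1 m M1
          by (intro mult_mono) (auto intro: order_trans[of 0 1] order_trans[OF zero_le_one ge1])
        also have "\<dots> = M * c ^ (m * (n div m))" by (simp add: Dm power_mult)
        also have "\<dots> \<le> M * c ^ n"
          using M1 c1 by (intro mult_left_mono power_increasing) auto
        finally show ?thesis .
      qed
      then have "root n (D n) \<le> root n (M * c ^ n)" using that by simp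
      also have "\<dots> = root n M * c" using that c1 by (simp add: real_root_mult real_root_power_cancel)
      finally show ?thesis .
    qed
    have "(\<lambda>n. root n M * c) \<longlonglongrightarrow> 1 * c"
      using M1 by (intro tendsto_mult_right LIMSEQ_root_const) auto
    moreover have "1 * c < l + r" using m(2) r by (simp add: c_def)
    ultimately have "\<forall>\<^sub>F n in sequentially. root n M * c < l + r" by (rule order_tendstoD(2))
    then obtain n0 where n0: "\<And>n. n \<ge> n0 \<Longrightarrow> root n M * c < l + r" by (auto simp: eventually_sequentially)
    show "\<exists>n0. \<forall>n\<ge>n0. norm (root n (D n) - l) < r"
    proof (intro exI[of _ "max n0 1"] allI impI)
      fix n assume n: "max n0 1 \<le> n"
      then have "root n (D n) < l + r" using bound[of n] n0[of n] by simp
      then show "norm (root n (D n) - l) < r" using l_le[of n] n r by simp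
    qed
  qed
  with l_ge l_le show ?thesis by blast
qed

text \<open>
  Put \<open>K = d\<^sub>2 / (24 d\<^sub>1)\<close>. If \<open>d\<^sub>n \<le> d\<^bsub>n+1\<^esub> / K\<close> with \<open>K \<ge> 1\<close>, then the first term on the right of the four-point
  inequality takes at most a third of the left-hand side; what remains bounds \<open>d\<^bsub>n+2\<^esub>\<close> from below by
  \<open>K d\<^bsub>n+1\<^esub>\<close>. So each degree is at least \<open>K\<close> times the preceding one.
\<close>

lemma growth_from_four_point:
  fixes d :: "nat \<Rightarrow> nat"
  assumes pos: "\<And>n. 0 < d n" and d0: "d 0 = 1" and d2: "d 2 \<le> d 1 * d 1" and b: "b \<le> 2 * d 1"
    and four: "\<And>n. d 1 < d 2 \<Longrightarrow> d 2 * d (Suc n) \<le> 8 * (d 1 * d n + b * d (Suc (Suc n)))"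
    and big: "24 * d 1 \<le> d 2"
  shows "(real (d 2) / (24 * real (d 1))) ^ n \<le> real (d n)"
proof -
  define K where "K = real (d 2) / (24 * real (d 1))"
  have a: "0 < real (d 1)" using pos by simp
  have d2K: "real (d 2) = 24 * real (d 1) * K" using a by (simp add: K_def)
  have K1: "1 \<le> K" using big a by (simp add: K_def)
  have "d 1 < d 2" using big pos[of 1] by simp
  have step: "K * real (d n) \<le> real (d (Suc n))" for n
  proof (induction n)
    case 0
    have "real (d 2) \<le> real (d 1) * real (d 1)" using d2 by (metis of_nat_le_iff of_nat_mult)
    also have "\<dots> \<le> 24 * real (d 1) * real (d 1)" using a by simp
    \<comment> \<open>The induction starts because \<open>d\<^sub>2 \<le> d\<^sub>1\<^sup>2\<close>.\<close>
    finally have "K \<le> real (d 1)" unfolding d2K using a by simp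
    then show ?case by (simp add: d0)
  next
    case (Suc n)
    have "real (d 2 * d (Suc n)) \<le> real (8 * (d 1 * d n + b * d (Suc (Suc n))))"
      using four[OF \<open>d 1 < d 2\<close>, of n] by (simp only: of_nat_le_iff)
    then have "24 * real (d 1) * K * real (d (Suc n)) \<le>
        8 * (real (d 1) * real (d n) + real b * real (d (Suc (Suc n))))"
      by (simp add: d2K)
    also have "\<dots> \<le> 8 * (real (d 1) * (K * real (d (Suc n))) + (2 * real (d 1)) * real (d (Suc (Suc n))))"
    proof -
      have "real (d n) \<le> K * real (d n)" using mult_right_mono[OF K1, of "real (d n)"] by simp
      also have "\<dots> \<le> real (d (Suc n))" by (rule Suc.IH)
      also have "\<dots> \<le> K * real (d (Suc n))" using mult_right_mono[OF K1, of "real (d (Suc n))"] by simp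
      finally have "real (d 1) * real (d n) \<le> real (d 1) * (K * real (d (Suc n)))"
        by (intro mult_left_mono) auto
      moreover have "real b * real (d (Suc (Suc n))) \<le> (2 * real (d 1)) * real (d (Suc (Suc n)))"
        using b by (intro mult_right_mono) linarith+
      ultimately show ?thesis by simp
    qed
    finally have "(16 * real (d 1)) * (K * real (d (Suc n))) \<le> (16 * real (d 1)) * real (d (Suc (Suc n)))"
      by (simp add: algebra_simps)
    then show ?case using a by simp
  qed
  have "K ^ n \<le> real (d n)"
  proof (induction n)
    case (Suc n)
    have "K * K ^ n \<le> K * real (d n)" using Suc K1 by (intro mult_left_mono) auto
    with step[of n] show ?case by simp
  qed (simp add: d0)
  then show ?thesis by (simp add: K_def)
qed

text \<open>
  If \<open>d\<^sub>2 < 24 d\<^sub>1\<close>, the bound is trivial because \<open>l \<ge> 1\<close>; otherwise the degrees grow geometrically.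
\<close>

lemma second_degree_bound:
  fixes d :: "nat \<Rightarrow> nat"
  assumes pos: "\<And>n. 0 < d n" and d0: "d 0 = 1" and d2: "d 2 \<le> d 1 * d 1" and b: "b \<le> 2 * d 1"
    and four: "\<And>n. d 1 < d 2 \<Longrightarrow> d 2 * d (Suc n) \<le> 8 * (d 1 * d n + b * d (Suc (Suc n)))"
    and lim: "(\<lambda>n. root n (real (d n))) \<longlonglongrightarrow> l"
  shows "real (d 2) \<le> 24 * real (d 1) * l"
proof -
  have a: "0 < real (d 1)" using pos by simp
  have l1: "1 \<le> l"
  proof (rule LIMSEQ_le_const[OF lim])
    show "\<exists>N. \<forall>n\<ge>N. 1 \<le> root n (real (d n))"
      using pos by (intro exI[of _ 1]) (auto simp: Suc_le_eq)
  qed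
  show ?thesis
  proof (cases "24 * d 1 \<le> d 2")
    case True
    have "real (d 2) / (24 * real (d 1)) \<le> l"
    proof (rule LIMSEQ_le_const[OF lim], intro exI[of _ 1] allI impI)
      fix n :: nat assume n: "1 \<le> n"
      have "root n ((real (d 2) / (24 * real (d 1))) ^ n) \<le> root n (real (d n))"
        using growth_from_four_point[OF pos d0 d2 b four True, of n] n by simp
      then show "real (d 2) / (24 * real (d 1)) \<le> root n (real (d n))"
        using n a by (simp add: real_root_power_cancel)
    qed
    then show ?thesis using a by (simp add: field_simps)
  next
    case False
    then have "real (d 2) \<le> 24 * real (d 1) * 1" by linarith
    also have "\<dots> \<le> 24 * real (d 1) * l" using l1 by (intro mult_left_mono) auto
    finally show ?thesis .
  qed
qed

section \<open>Iterates of a birational map\<close>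

definition compose :: "(3 \<Rightarrow> 'k::comm_ring_1 form3) \<Rightarrow> (3 \<Rightarrow> 'k form3) \<Rightarrow> 3 \<Rightarrow> 'k form3" where
  "compose F G = (\<lambda>i. subst (F i) G)"

definition iterate :: "(3 \<Rightarrow> 'k::comm_ring_1 form3) \<Rightarrow> nat \<Rightarrow> 3 \<Rightarrow> 'k form3" where
  "iterate F n = (compose F ^^ n) xvar"

lemma iterate_0 [simp]: "iterate F 0 = xvar"
  by (simp add: iterate_def)

lemma iterate_Suc: "iterate F (Suc n) i = subst (F i) (iterate F n)"
  by (simp add: iterate_def compose_def)

lemma iterate_add: "iterate F (m + n) i = subst (iterate F m i) (iterate F n)"
proof (induction m arbitrary: i)
  case (Suc m)
  have "(\<lambda>j. iterate F (m + n) j) = (\<lambda>j. subst (iterate F m j) (iterate F n))" using Suc by auto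
  then show ?case by (simp add: iterate_Suc subst_subst)
qed simp

lemma iterate_Suc': "iterate F (Suc n) i = subst (iterate F n i) F"
  using iterate_add[of F n 1 i] iterate_Suc[of F 0] by (simp add: iterate_def compose_def)

lemma form_iterate: "(\<And>i. form D (F i)) \<Longrightarrow> form (D ^ n) (iterate F n i)"
proof (induction n arbitrary: i)
  case (Suc n)
  show ?case unfolding iterate_Suc using form_subst[where G = "iterate F n", OF Suc.prems Suc.IH[OF Suc.prems]] by simp
qed simp

definition red_degree :: "(3 \<Rightarrow> 'k::comm_ring_1 form3) \<Rightarrow> nat" where
  "red_degree F = (THE d. \<exists>G. (\<forall>i. form d (G i)) \<and> (\<exists>i. G i \<noteq> 0) \<and> reduced G \<and> same F G)"

lemma same_factor: "(\<And>i. F i = h * G i) \<Longrightarrow> same F G"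
  by (simp add: same_def mult_ac)

lemma same_sym: "same F G \<Longrightarrow> same G F"
  unfolding same_def by (metis mult.commute)

lemma same_cancel:
  fixes F :: "3 \<Rightarrow> 'k::idom form3"
  assumes "same F G" "\<And>i. F i = h * F' i" "h \<noteq> 0" shows "same F' G"
  using assms unfolding same_def by (simp add: mult.assoc)

lemma same_degree_le:
  fixes F G :: "3 \<Rightarrow> 'k::field_gcd form3"
  assumes "same F G" "reduced G" "\<And>i. form d (G i)" "\<And>i. form e (F i)" "F j \<noteq> 0"
  shows "d \<le> e"
proof -
  obtain h where h: "\<And>i. F i = h * G i" using same_reduced[OF assms(1,2)] by blast
  then have "G j dvd F j" by simp
  then show ?thesis using form_dvd_degree_le assms(3-5) by blast
qed

lemma red_degree_eq:
  fixes F G :: "3 \<Rightarrow> 'k::field_gcd form3"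
  assumes "reduced G" "\<And>i. form d (G i)" "\<And>i. F i = h * G i" "h \<noteq> 0"
  shows "red_degree F = d"
  unfolding red_degree_def
proof (rule the_equality)
  show "\<exists>G. (\<forall>i. form d (G i)) \<and> (\<exists>i. G i \<noteq> 0) \<and> reduced G \<and> same F G"
    using assms reduced_nonzero same_factor by blast
next
  fix e assume "\<exists>G. (\<forall>i. form e (G i)) \<and> (\<exists>i. G i \<noteq> 0) \<and> reduced G \<and> same F G"
  then obtain G' where G': "\<And>i. form e (G' i)" "\<exists>i. G' i \<noteq> 0" "reduced G'" "same F G'" by blast
  have "same G G'" by (rule same_cancel[OF G'(4) assms(3,4)])
  obtain i where i: "G i \<noteq> 0" using reduced_nonzero[OF assms(1)] by blast
  obtain j where j: "G' j \<noteq> 0" using G'(2) by blast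
  have "e \<le> d" by (rule same_degree_le[where F = G and j = i, OF \<open>same G G'\<close> G'(3,1) assms(2) i])
  moreover have "d \<le> e" by (rule same_degree_le[where F = G' and j = j, OF same_sym[OF \<open>same G G'\<close>] assms(1,2) G'(1) j])
  ultimately show "e = d" by simp
qed

lemma exists_reduced_form:
  fixes F :: "3 \<Rightarrow> 'k::field_gcd form3"
  assumes "\<And>i. form D (F i)" "F i0 \<noteq> 0"
  obtains G h d e where "reduced G" "h \<noteq> 0" "\<And>i. F i = h * G i" "\<And>i. form d (G i)" "form e h"
proof -
  obtain h G where hG: "reduced G" "h \<noteq> 0" "\<And>i. F i = h * G i" using exists_reduced[where F = F and ?i0.0 = i0, OF assms(2)] by metis
  have "F i0 = h * G i0" by (rule hG(3))
  with assms(1)[of i0] assms(2) have "h * G i0 \<noteq> 0" "form D (h * G i0)" by metis+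
  then obtain e d where e: "form e h" "form d (G i0)" "D = e + d" using form_factor by metis
  have "form d (G i)" for i
  proof (cases "G i = 0")
    case False
    then have "h * G i \<noteq> 0" "form D (h * G i)"
      using assms(1)[of i] hG(2) unfolding hG(3)[of i] by simp_all
    then obtain e' d' where e': "form e' h" "form d' (G i)" "D = e' + d'" using form_factor by metis
    then have "e' = e" using form_unique[OF e(1) _ hG(2)] by blast
    then show ?thesis using e e' by simp
  qed simp
  with that hG e show thesis by blast
qed

text \<open>
  Every triple proportional to \<open>F\<close> is a multiple of the reduced one, and the reduced one can be multiplied
  by powers of a variable. The right-hand side is a linear condition on \<open>A\<close>.
\<close>

lemma red_degree_le_iff:
  fixes F :: "3 \<Rightarrow> 'k::field_gcd form3"
  assumes "\<And>i. form D (F i)" "F i0 \<noteq> 0"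
  shows "red_degree F \<le> n \<longleftrightarrow> (\<exists>A. (\<forall>i. form n (A i)) \<and> (\<exists>i. A i \<noteq> 0) \<and> same A F)"
proof -
  obtain h G d e where hG: "reduced G" "h \<noteq> 0" "\<And>i. F i = h * G i" "\<And>i. form d (G i)" "form e h"
    using exists_reduced_form[of D F i0] assms by metis
  have r: "red_degree F = d" by (rule red_degree_eq[OF hG(1,4,3,2)])
  show ?thesis
  proof
    assume "red_degree F \<le> n"
    define A where "A i = xvar 0 ^ (n - d) * G i" for i
    have "form n (A i)" for i
      unfolding A_def using form_mult[OF form_power[OF form_xvar, of "n - d"] hG(4)[of i]] r \<open>red_degree F \<le> n\<close> by simp
    moreover have "\<exists>i. A i \<noteq> 0" using reduced_nonzero[OF hG(1)] by (simp add: A_def)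
    moreover have "same A F" unfolding same_def A_def hG(3) by (simp add: mult_ac)
    ultimately show "\<exists>A. (\<forall>i. form n (A i)) \<and> (\<exists>i. A i \<noteq> 0) \<and> same A F" by blast
  next
    assume "\<exists>A. (\<forall>i. form n (A i)) \<and> (\<exists>i. A i \<noteq> 0) \<and> same A F"
    then obtain A i where A: "\<And>i. form n (A i)" "A i \<noteq> 0" "same A F" by blast
    have "same A G" by (rule same_sym[OF same_cancel[OF same_sym[OF A(3)] hG(3,2)]])
    then show "red_degree F \<le> n" unfolding r by (rule same_degree_le[where F = A and j = i, OF _ hG(1,4) A(1,2)])
  qed
qed

text \<open>
  Two mutually inverse birational maps, given by triples that may have common factors.
\<close>

locale cremona =
  fixes F G :: "3 \<Rightarrow> 'k::field_gcd form3" and v w :: "'k form3" and D E :: nat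
  assumes infinite_field: "infinite (UNIV :: 'k set)"
    and form_F: "\<And>i. form D (F i)" and form_G: "\<And>i. form E (G i)"
    and G_F: "\<And>i. subst (G i) F = v * xvar i" and F_G: "\<And>i. subst (F i) G = w * xvar i"
    and v_nonzero: "v \<noteq> 0" and w_nonzero: "w \<noteq> 0"
begin

lemma dominant_F: "dominant F"
  unfolding dominant_def
proof (intro allI impI)
  fix d P assume P: "form d P" "subst P F = 0"
  have "subst (subst P F) G = w ^ d * P"
    unfolding subst_subst F_G using subst_scale[OF P(1), of w xvar] by simp
  with P(2) w_nonzero show "P = 0" by simp
qed

lemma dominant_iterate: "dominant (iterate F n)"
proof (induction n)
  case 0
  show ?case by (simp add: dominant_def)
next
  case (Suc n)
  show ?case unfolding dominant_def
  proof (intro allI impI)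
    fix d P assume P: "form d P" "subst P (iterate F (Suc n)) = 0"
    from P(2) have "subst (subst P F) (iterate F n) = 0" unfolding subst_subst iterate_Suc[symmetric] .
    then have "subst P F = 0" by (rule dominantD[OF Suc form_subst[where G = F, OF P(1) form_F]])
    then show "P = 0" by (rule dominantD[OF dominant_F P(1)])
  qed
qed

text \<open>
  The inner composition of \<open>G\<^sup>n\<^sup>+\<^sup>1\<close> with \<open>F\<^sup>n\<^sup>+\<^sup>1\<close> cancels up to a common factor, which remains nonzero because the
  iterates are dominant.
\<close>

lemma iterate_inverse: "\<exists>v. v \<noteq> 0 \<and> (\<forall>i. subst (iterate G n i) (iterate F n) = v * xvar i)"
proof (induction n)
  case 0
  show ?case by (intro exI[of _ 1]) simp
next
  case (Suc n)
  then obtain v' where v': "v' \<noteq> 0" "\<And>i. subst (iterate G n i) (iterate F n) = v' * xvar i" by blast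
  let ?s = "subst v (iterate F n)"
  have "form (E * D) (v * xvar 0)" unfolding G_F[symmetric] by (rule form_subst[where G = F, OF form_G form_F])
  moreover have "v * xvar 0 \<noteq> 0" using v_nonzero by simp
  ultimately obtain e where "form e v" using form_left_factor by blast
  then have s: "?s \<noteq> 0" using dominantD[OF dominant_iterate] v_nonzero by blast
  have "subst (iterate G (Suc n) i) (iterate F (Suc n)) = (?s ^ (E ^ n) * v') * xvar i" for i
  proof -
    have "subst (G j) (iterate F (Suc n)) = ?s * iterate F n j" for j
    proof -
      have "subst (G j) (iterate F (Suc n)) = subst (subst (G j) F) (iterate F n)" unfolding subst_subst iterate_Suc[symmetric] ..
      also have "\<dots> = ?s * iterate F n j" unfolding G_F by (simp add: subst_mult)
      finally show ?thesis .
    qed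
    then have "subst (iterate G (Suc n) i) (iterate F (Suc n)) = subst (iterate G n i) (\<lambda>j. ?s * iterate F n j)"
      unfolding iterate_Suc'[of G] subst_subst by simp
    also have "\<dots> = ?s ^ (E ^ n) * subst (iterate G n i) (iterate F n)"
      by (rule subst_scale[OF form_iterate[where F = G, OF form_G]])
    finally show ?thesis by (simp add: v' mult.assoc)
  qed
  moreover have "?s ^ (E ^ n) * v' \<noteq> 0" using s v' by simp
  ultimately show ?case by blast
qed

lemma reduced_iterates:
  "\<exists>h R d e. R 0 = xvar \<and> (\<forall>n. reduced (R n) \<and> h n \<noteq> 0 \<and> (\<forall>i. iterate F n i = h n * R n i) \<and>
    (\<forall>i. form (d n) (R n i)) \<and> form (e n) (h n))"
proof -
  have "\<exists>h R d e. (n = 0 \<longrightarrow> R = xvar) \<and> reduced R \<and> h \<noteq> 0 \<and> (\<forall>i. iterate F n i = h * R i) \<and>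
      (\<forall>i. form d (R i)) \<and> form e h" for n
  proof (cases n)
    case 0
    show ?thesis
      by (intro exI[of _ 1] exI[of _ xvar] exI[of _ "Suc 0"] exI[of _ 0]) (simp add: 0 reduced_xvar)
  next
    case (Suc m)
    obtain R h d e where "reduced R" "h \<noteq> 0" "\<And>i. iterate F n i = h * R i" "\<And>i. form d (R i)" "form e h"
      using exists_reduced_form[where F = "iterate F n",
          OF form_iterate[where F = F, OF form_F] dominant_nonzero[OF dominant_iterate, of n 0]] by blast
    then show ?thesis
      by (intro exI[of _ h] exI[of _ R] exI[of _ d] exI[of _ e]) (simp add: Suc)
  qed
  then obtain h R d e where "\<And>n. (n = 0 \<longrightarrow> R n = xvar) \<and> reduced (R n) \<and> h n \<noteq> 0 \<and> (\<forall>i. iterate F n i = h n * R n i) \<and>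
      (\<forall>i. form (d n) (R n i)) \<and> form (e n) (h n)" by metis
  then show ?thesis by (intro exI[of _ h] exI[of _ R] exI[of _ d] exI[of _ e]) simp
qed

text \<open>
  The growth estimate is the case of the second iterate, \<open>second_degree_bound\<close>, applied to the map \<open>R N\<close>,
  whose iterates are represented by the \<open>R (N * n)\<close>.
\<close>

theorem degrees_of_iterates:
  defines "d \<equiv> \<lambda>n. red_degree (iterate F n)"
  shows degree_pos: "\<And>n. 0 < d n"
    and degree_submult: "\<And>m n. d (m + n) \<le> d m * d n"
    and degree_growth: "\<And>N l. 1 \<le> N \<Longrightarrow> (\<lambda>n. root n (real (d n))) \<longlonglongrightarrow> l \<Longrightarrow>
        real (d (2 * N)) \<le> 24 * real (d N) * l ^ N"
proof -
  obtain h R d' e where R0: "R 0 = xvar" and R: "\<forall>n. reduced (R n) \<and> h n \<noteq> 0 \<and>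
      (\<forall>i. iterate F n i = h n * R n i) \<and> (\<forall>i. form (d' n) (R n i)) \<and> form (e n) (h n)"
    using reduced_iterates by (elim exE conjE)
  have red: "reduced (R n)" and h: "h n \<noteq> 0" and iterate: "iterate F n i = h n * R n i"
    and form_R: "form (d' n) (R n i)" and form_h: "form (e n) (h n)" for n i
    using R by blast+
  have d: "d n = d' n" for n unfolding d_def by (rule red_degree_eq[OF red form_R iterate h])
  have form_R: "form (d n) (R n i)" for n i using form_R by (simp add: d)
  have dom: "dominant (R n)" for n
    unfolding dominant_def
  proof (intro allI impI)
    fix m P assume P: "form m P" "subst P (R n) = 0"
    have "subst P (iterate F n) = h n ^ m * subst P (R n)" unfolding iterate by (rule subst_scale[OF P(1)])
    then have "subst P (iterate F n) = 0" using P(2) by simp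
    then show "P = 0" by (rule dominantD[OF dominant_iterate P(1)])
  qed
  show pos: "0 < d n" for n by (rule dominant_degree_pos[OF dom form_R])
  have R_nz: "R n i \<noteq> 0" for n i by (rule dominant_nonzero[OF dom])
  have comp: "\<exists>c. \<forall>i. subst (R m i) (R n) = c * R (m + n) i" for m n
  proof -
    let ?c = "subst (h m) (iterate F n) * h n ^ d m"
    have c: "?c \<noteq> 0"
      using h[of m] h[of n] dominantD[OF dominant_iterate[of n] form_h[of m]] by auto
    have "h (m + n) * R (m + n) i = ?c * subst (R m i) (R n)" for i
    proof -
      have "h (m + n) * R (m + n) i = subst (h m) (iterate F n) * subst (R m i) (iterate F n)"
        unfolding iterate[symmetric] iterate_add by (simp add: iterate subst_mult)
      also have "subst (R m i) (iterate F n) = h n ^ d m * subst (R m i) (R n)"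
        unfolding iterate by (rule subst_scale[OF form_R])
      finally show ?thesis by (simp add: mult.assoc)
    qed
    then have "same (\<lambda>i. h (m + n) * R (m + n) i) (\<lambda>i. subst (R m i) (R n))"
      by (rule same_factor)
    from same_cancel[OF this refl h] have "same (R (m + n)) (\<lambda>i. subst (R m i) (R n))" .
    then have "same (\<lambda>i. subst (R m i) (R n)) (R (m + n))" by (rule same_sym)
    from same_reduced[OF this red] show ?thesis by blast
  qed
  show sm: "d (m + n) \<le> d m * d n" for m n
  proof -
    obtain c where c: "\<And>i. subst (R m i) (R n) = c * R (m + n) i" using comp by blast
    have "R (m + n) 0 dvd subst (R m 0) (R n)" by (simp add: c)
    moreover have "form (d m * d n) (subst (R m 0) (R n))" by (rule form_subst[where G = "R n", OF form_R form_R])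
    moreover have "subst (R m 0) (R n) \<noteq> 0" using dominantD[OF dom[of n] form_R[of m 0]] R_nz[of m 0] by blast
    ultimately show ?thesis using form_dvd_degree_le[OF _ form_R[of "m + n" 0]] by blast
  qed
  fix N :: nat and l :: real assume N: "1 \<le> N" and lim: "(\<lambda>n. root n (real (d n))) \<longlonglongrightarrow> l"
  obtain v' where v': "v' \<noteq> 0" "\<And>i. subst (iterate G N i) (iterate F N) = v' * xvar i" using iterate_inverse by blast
  have "iterate G N 0 \<noteq> 0"
  proof
    assume "iterate G N 0 = 0"
    then have "v' * xvar 0 = 0" using v'(2)[of 0] by simp
    with v'(1) show False by simp
  qed
  obtain g k \<beta> e' where g: "reduced g" "k \<noteq> 0" "\<And>i. iterate G N i = k * g i" "\<And>i. form \<beta> (g i)" "form e' k"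
    using exists_reduced_form[where F = "iterate G N",
        OF form_iterate[where F = G, OF form_G] \<open>iterate G N 0 \<noteq> 0\<close>] by blast
  define c where "c = subst k (iterate F N) * h N ^ \<beta>"
  have c: "c \<noteq> 0" unfolding c_def using h[of N] dominantD[OF dominant_iterate[of N] g(5)] g(2) by auto
  have eq: "v' * xvar i = c * subst (g i) (R N)" for i
  proof -
    have "v' * xvar i = subst k (iterate F N) * subst (g i) (iterate F N)"
      unfolding v'(2)[symmetric] g(3) by (rule subst_mult)
    also have "subst (g i) (iterate F N) = h N ^ \<beta> * subst (g i) (R N)"
      unfolding iterate by (rule subst_scale[OF g(4)])
    finally show ?thesis by (simp add: c_def mult.assoc)
  qed
  then have "same (\<lambda>i. v' * xvar i) (\<lambda>i. subst (g i) (R N))" by (rule same_factor)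
  from same_sym[OF same_cancel[OF this refl v'(1)]]
  have "same (\<lambda>i. subst (g i) (R N)) xvar" .
  then obtain v'' where v'': "\<And>i. subst (g i) (R N) = v'' * xvar i"
    using same_reduced[OF _ reduced_xvar] by blast
  have v''_nz: "v'' \<noteq> 0"
  proof
    assume "v'' = 0"
    then have "v' * xvar 0 = 0" using eq[of 0] v''[of 0] by simp
    with v'(1) show False by simp
  qed
  have "\<exists>u. \<forall>i. subst (R N i) (R (N * n)) = u * R (N * Suc n) i" for n
    using comp[of N "N * n"] by simp
  then have "\<forall>n. \<exists>u. \<forall>i. subst (R N i) (R (N * n)) = u * R (N * Suc n) i" by blast
  from choice[OF this] obtain u where u: "\<And>n i. subst (R N i) (R (N * n)) = u n * R (N * Suc n) i" by blast
  interpret orbit: reduced_orbit "R N" g "\<lambda>n. R (N * n)" u v'' "\<lambda>n. d (N * n)" "d N" \<beta>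
    by unfold_locales (simp_all add: infinite_field g v'' v''_nz R0 form_R red dom u)
  let ?d = "\<lambda>n. d (N * n)"
  have "real (?d 2) \<le> 24 * real (?d 1) * l ^ N"
  proof (rule second_degree_bound)
    show "0 < ?d n" for n by (rule pos)
    have "form (Suc 0) (R 0 0)" by (simp add: R0)
    then show "?d 0 = 1" using form_unique[OF form_R[of 0 0] _ R_nz] by simp
    show "?d 2 \<le> ?d 1 * ?d 1" using sm[of N N] by (simp add: mult_2_right)
    show "\<beta> \<le> 2 * ?d 1" using orbit.inverse_degree_le by simp
    show "?d 2 * ?d (Suc n) \<le> 8 * (?d 1 * ?d n + \<beta> * ?d (Suc (Suc n)))" if "?d 1 < ?d 2" for n
      using orbit.four_point_inequality[of n] that by simp
    have "(\<lambda>n. root (N * n) (real (d (N * n)))) \<longlonglongrightarrow> l"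
      using LIMSEQ_subseq_LIMSEQ[OF lim, of "\<lambda>n. N * n"] N by (simp add: strict_mono_def o_def)
    then have "(\<lambda>n. root (N * n) (real (d (N * n))) ^ N) \<longlonglongrightarrow> l ^ N" by (rule tendsto_power)
    then show "(\<lambda>n. root n (real (?d n))) \<longlonglongrightarrow> l ^ N"
    proof (rule Lim_transform_eventually, intro eventually_sequentiallyI[of 1])
      fix n :: nat assume "1 \<le> n"
      then show "root (N * n) (real (d (N * n))) ^ N = root n (real (d (N * n)))"
        using N by (simp add: real_root_mult_exp)
    qed
  qed
  then show "real (d (2 * N)) \<le> 24 * real (d N) * l ^ N" by (simp add: mult.commute)
qed

end

section \<open>Degrees and inverses by linear algebra over the integers\<close>

text \<open>
  The integer \<open>N\<close> witnesses which alternative holds for the homogeneous linear system with the coefficient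
  vectors \<open>v q\<close>: either it occurs in an integer solution, so that this solution stays nonzero wherever
  \<open>N\<close> does, or the coefficient matrix has a left inverse up to the factor \<open>N\<close>.
\<close>

definition decides :: "'q set \<Rightarrow> 'x set \<Rightarrow> ('q \<Rightarrow> 'x \<Rightarrow> int form3) \<Rightarrow> int \<Rightarrow> bool" where
  "decides I Y v N \<longleftrightarrow> N \<noteq> 0 \<and>
    ((\<exists>c. (\<exists>q\<in>I. c q = N) \<and> (\<forall>x\<in>Y. (\<Sum>q\<in>I. const (c q) * v q x) = 0)) \<or>
     (\<exists>M b. finite M \<and> (\<forall>q\<in>I. \<forall>q'\<in>I. (\<Sum>(x, m)\<in>Y \<times> M. b q (x, m) * mcoeff (v q' x) m) = (if q = q' then N else 0))))"

lemma exists_decides: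
  assumes "finite I" "finite Y"
  shows "\<exists>N. decides I Y v N"
proof -
  define M where "M = (\<Union>q\<in>I. \<Union>x\<in>Y. {m. mcoeff (v q x) m \<noteq> 0})"
  have M: "finite M" using assms by (simp add: M_def)
  have "finite (Y \<times> M)" using assms M by simp
  from integer_matrix_alternative[OF assms(1) this, of "\<lambda>(x, m) q. mcoeff (v q x) m"]
  show ?thesis
  proof
    assume "\<exists>c. (\<exists>q\<in>I. c q \<noteq> 0) \<and> (\<forall>j\<in>Y \<times> M. (\<Sum>q\<in>I. (case j of (x, m) \<Rightarrow> \<lambda>q. mcoeff (v q x) m) q * c q) = 0)"
    then obtain c q where c: "q \<in> I" "c q \<noteq> 0"
      "\<And>x m. x \<in> Y \<Longrightarrow> m \<in> M \<Longrightarrow> (\<Sum>q\<in>I. mcoeff (v q x) m * c q) = 0" by auto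
    have "(\<Sum>q\<in>I. const (c q) * v q x) = 0" if "x \<in> Y" for x
    proof (rule mcoeff_eqI)
      fix m
      show "mcoeff (\<Sum>q\<in>I. const (c q) * v q x) m = mcoeff 0 m"
      proof (cases "m \<in> M")
        case True
        then show ?thesis using c(3)[OF that True] by (simp add: mult.commute)
      next
        case False
        then have "mcoeff (v q x) m = 0" if "q \<in> I" for q using that \<open>x \<in> Y\<close> by (auto simp: M_def)
        then show ?thesis by simp
      qed
    qed
    then have "decides I Y v (c q)" using c(1,2) unfolding decides_def by blast
    then show ?thesis ..
  next
    assume "\<exists>N b. N \<noteq> 0 \<and> (\<forall>q\<in>I. \<forall>q'\<in>I. (\<Sum>j\<in>Y \<times> M. b q j * (case j of (x, m) \<Rightarrow> \<lambda>q. mcoeff (v q x) m) q') = (if q = q' then N else 0))"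
    then obtain N b where b: "N \<noteq> 0"
      "\<And>q q'. q \<in> I \<Longrightarrow> q' \<in> I \<Longrightarrow> (\<Sum>j\<in>Y \<times> M. b q j * (case j of (x, m) \<Rightarrow> \<lambda>q. mcoeff (v q x) m) q') = (if q = q' then N else 0)"
      by blast
    have "(\<Sum>(x, m)\<in>Y \<times> M. b q (x, m) * mcoeff (v q' x) m) = (if q = q' then N else 0)" if "q \<in> I" "q' \<in> I" for q q'
      using b(2)[OF that] by (simp add: case_prod_unfold)
    then have "decides I Y v N" using b(1) M unfolding decides_def by blast
    then show ?thesis ..
  qed
qed

text \<open>
  If the left inverse exists, then \<open>N c\<^sub>q = 0\<close> for every solution \<open>c\<close>, over the field and over the integers.
\<close>

lemma decides_solvable_iff:
  fixes v :: "'q \<Rightarrow> 'x \<Rightarrow> int form3"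
  assumes "decides I Y v N" "of_int N \<noteq> (0 :: 'k::field)" "finite I"
  shows "(\<exists>c. (\<exists>q\<in>I. c q \<noteq> 0) \<and> (\<forall>x\<in>Y. (\<Sum>q\<in>I. const (c q :: 'k) * int_form (v q x)) = 0)) \<longleftrightarrow>
         (\<exists>c. (\<exists>q\<in>I. c q \<noteq> 0) \<and> (\<forall>x\<in>Y. (\<Sum>q\<in>I. const (c q) * v q x) = 0))" (is "?K \<longleftrightarrow> ?Z")
proof -
  have N: "N \<noteq> 0" using assms(1) by (simp add: decides_def)
  from assms(1) have "(\<exists>c. (\<exists>q\<in>I. c q = N) \<and> (\<forall>x\<in>Y. (\<Sum>q\<in>I. const (c q) * v q x) = 0)) \<or>
     (\<exists>M b. finite M \<and> (\<forall>q\<in>I. \<forall>q'\<in>I. (\<Sum>(x, m)\<in>Y \<times> M. b q (x, m) * mcoeff (v q' x) m) = (if q = q' then N else 0)))"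
    unfolding decides_def by (rule conjunct2)
  then show ?thesis
  proof (elim disjE exE conjE bexE)
    fix c q assume 1: "q \<in> I" "c q = N" "\<forall>x\<in>Y. (\<Sum>q\<in>I. const (c q) * v q x) = 0"
    then have ?Z using N by blast
    moreover have ?K
    proof (intro exI[of _ "\<lambda>q. of_int (c q)"] conjI ballI)
      show "\<exists>q\<in>I. of_int (c q) \<noteq> (0 :: 'k)" using 1 assms(2) by auto
      fix x assume "x \<in> Y"
      then have "int_form (\<Sum>q\<in>I. const (c q) * v q x) = (0 :: 'k form3)" using 1(3) by simp
      then show "(\<Sum>q\<in>I. const (of_int (c q) :: 'k) * int_form (v q x)) = 0" by (simp add: int_form_sum int_form_mult)
    qed
    ultimately show ?thesis by blast
  next
    fix M b assume 2: "finite M"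
      "\<forall>q\<in>I. \<forall>q'\<in>I. (\<Sum>(x, m)\<in>Y \<times> M. b q (x, m) * mcoeff (v q' x) m) = (if q = q' then N else 0)"
    have zero: "of_int N * c q = 0"
      if c: "\<And>x m. x \<in> Y \<Longrightarrow> (\<Sum>q\<in>I. c q * of_int (mcoeff (v q x) m)) = 0" and q: "q \<in> I"
      for c :: "'q \<Rightarrow> 'z::comm_ring_1" and q
    proof -
      have "of_int N * c q = (\<Sum>q'\<in>I. if q = q' then of_int N * c q else 0)"
        using q assms(3) by simp
      also have "\<dots> = (\<Sum>q'\<in>I. of_int (if q = q' then N else 0) * c q')"
        by (intro sum.cong) auto
      also have "\<dots> = (\<Sum>q'\<in>I. of_int (\<Sum>(x, m)\<in>Y \<times> M. b q (x, m) * mcoeff (v q' x) m) * c q')"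
        using 2(2) q by (intro sum.cong) auto
      also have "\<dots> = (\<Sum>q'\<in>I. \<Sum>(x, m)\<in>Y \<times> M. of_int (b q (x, m)) * (c q' * of_int (mcoeff (v q' x) m)))"
        by (simp add: sum_distrib_left sum_distrib_right case_prod_unfold mult_ac)
      also have "\<dots> = (\<Sum>(x, m)\<in>Y \<times> M. of_int (b q (x, m)) * (\<Sum>q'\<in>I. c q' * of_int (mcoeff (v q' x) m)))"
        by (subst sum.swap) (simp add: sum_distrib_left case_prod_unfold)
      also have "\<dots> = 0" using c by (intro sum.neutral) auto
      finally show ?thesis .
    qed
    have "\<not> ?K"
    proof
      assume ?K
      then obtain c q where c: "q \<in> I" "c q \<noteq> (0::'k)" "\<And>x. x \<in> Y \<Longrightarrow> (\<Sum>q\<in>I. const (c q) * int_form (v q x)) = 0" by blast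
      have "(\<Sum>q\<in>I. c q * of_int (mcoeff (v q x) m)) = 0" if "x \<in> Y" for x m
        using arg_cong[OF c(3)[OF that], of "\<lambda>P. mcoeff P m"] by simp
      from zero[OF this c(1)] c(2) assms(2) show False by simp
    qed
    moreover have "\<not> ?Z"
    proof
      assume ?Z
      then obtain c q where c: "q \<in> I" "c q \<noteq> (0::int)" "\<And>x. x \<in> Y \<Longrightarrow> (\<Sum>q\<in>I. const (c q) * v q x) = 0" by blast
      have "(\<Sum>q\<in>I. c q * of_int (mcoeff (v q x) m)) = 0" if "x \<in> Y" for x m
        using arg_cong[OF c(3)[OF that], of "\<lambda>P. mcoeff P m"] by simp
      from zero[OF this c(1)] c(2) N show False by simp
    qed
    ultimately show ?thesis by blast
  qed
qed

definition unit_triple :: "3 \<times> 3 multiset \<Rightarrow> 3 \<Rightarrow> 'k::zero_neq_one form3" where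
  "unit_triple q i = (if i = fst q then mterm 1 (snd q) else 0)"

definition linear_op :: "((3 \<Rightarrow> 'k::comm_ring_1 form3) \<Rightarrow> 'k form3) \<Rightarrow> bool" where
  "linear_op L \<longleftrightarrow> (\<forall>Q c B. finite (Q :: (3 \<times> 3 multiset) set) \<longrightarrow>
     L (\<lambda>i. \<Sum>q\<in>Q. const (c q) * B q i) = (\<Sum>q\<in>Q. const (c q) * L (B q)))"

lemma mcoeff_unit_triples:
  "mcoeff (\<Sum>q\<in>UNIV \<times> mons d. const (c q) * unit_triple q i) m = (if m \<in> mons d then c (i, m) else (0::'k::comm_ring_1))"
proof -
  have "mcoeff (\<Sum>q\<in>UNIV \<times> mons d. const (c q) * unit_triple q i) m =
      (\<Sum>q\<in>UNIV \<times> mons d. if q = (i, m) then c (i, m) else 0)"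
    unfolding mcoeff_sum by (intro sum.cong) (auto simp: unit_triple_def mcoeff_mterm)
  then show ?thesis by simp
qed

lemma form_triple_expand:
  fixes A :: "3 \<Rightarrow> 'k::comm_ring_1 form3"
  assumes "\<And>i. form d (A i)"
  shows "A = (\<lambda>i. \<Sum>q\<in>UNIV \<times> mons d. const (mcoeff (A (fst q)) (snd q)) * unit_triple q i)"
proof (rule ext, rule mcoeff_eqI)
  fix i m
  show "mcoeff (A i) m = mcoeff (\<Sum>q\<in>UNIV \<times> mons d. const (mcoeff (A (fst q)) (snd q)) * unit_triple q i) m"
    unfolding mcoeff_unit_triples using assms[of i] by (auto simp: mons_def form_def)
qed

lemma linear_op_solvable_iff:
  fixes L :: "'x \<Rightarrow> (3 \<Rightarrow> 'k::comm_ring_1 form3) \<Rightarrow> 'k form3"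
  assumes "\<And>x. linear_op (L x)"
  shows "(\<exists>A. (\<forall>i. form d (A i)) \<and> (\<exists>i. A i \<noteq> 0) \<and> (\<forall>x\<in>Y. L x A = 0)) \<longleftrightarrow>
     (\<exists>c. (\<exists>q\<in>UNIV \<times> mons d. c q \<noteq> 0) \<and> (\<forall>x\<in>Y. (\<Sum>q\<in>UNIV \<times> mons d. const (c q) * L x (unit_triple q)) = 0))"
    (is "?A \<longleftrightarrow> ?C")
proof
  assume ?A
  then obtain A i where A: "\<And>i. form d (A i)" "A i \<noteq> 0" "\<And>x. x \<in> Y \<Longrightarrow> L x A = 0" by blast
  define c where "c q = mcoeff (A (fst q)) (snd q)" for q
  have eq: "L x A = (\<Sum>q\<in>UNIV \<times> mons d. const (c q) * L x (unit_triple q))" for x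
  proof -
    have "L x A = L x (\<lambda>i. \<Sum>q\<in>UNIV \<times> mons d. const (c q) * unit_triple q i)"
      using form_triple_expand[of d A] A(1) unfolding c_def by simp
    then show ?thesis using assms[of x] by (simp add: linear_op_def)
  qed
  obtain m where m: "mcoeff (A i) m \<noteq> 0" using A(2) by (rule nonzero_cfE)
  then have "(i, m) \<in> UNIV \<times> mons d" "c (i, m) \<noteq> 0" using A(1)[of i] by (auto simp: form_def mons_def c_def)
  then show ?C using A(3) eq by (intro exI[of _ c]) metis
next
  assume ?C
  then obtain c q where c: "q \<in> UNIV \<times> mons d" "c q \<noteq> 0"
    "\<And>x. x \<in> Y \<Longrightarrow> (\<Sum>q\<in>UNIV \<times> mons d. const (c q) * L x (unit_triple q)) = 0" by blast
  define A where "A i = (\<Sum>q\<in>UNIV \<times> mons d. const (c q) * unit_triple q i)" for i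
  have "form d (A i)" for i unfolding form_def A_def mcoeff_unit_triples by (auto simp: mons_def)
  moreover have "A (fst q) \<noteq> 0"
  proof
    assume "A (fst q) = 0"
    then have "mcoeff (A (fst q)) (snd q) = 0" by simp
    then show False using c(1,2) unfolding A_def mcoeff_unit_triples by auto
  qed
  moreover have "L x A = 0" if "x \<in> Y" for x
    using assms[of x] c(3)[OF that] unfolding A_def by (simp add: linear_op_def)
  ultimately show ?A by blast
qed

lemma int_form_unit_triple [simp]: "int_form (unit_triple q i) = unit_triple q i"
  by (simp add: unit_triple_def)

text \<open>
  The form in which the alternative is used: the unknown is a triple of forms of degree \<open>d\<close>, and the
  equations are linear operators that are compatible with the map from the integers to \<open>'k\<close>.
\<close>

theorem integer_system_transfer:
  fixes L :: "3 \<times> 3 \<Rightarrow> (3 \<Rightarrow> int form3) \<Rightarrow> int form3"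
    and L' :: "3 \<times> 3 \<Rightarrow> (3 \<Rightarrow> 'k::field form3) \<Rightarrow> 'k form3"
  assumes "\<And>x. linear_op (L x)" "\<And>x. linear_op (L' x)"
    "\<And>x A. int_form (L x A) = L' x (\<lambda>i. int_form (A i))"
    "decides (UNIV \<times> mons d) UNIV (\<lambda>q x. L x (unit_triple q)) N" "of_int N \<noteq> (0 :: 'k)"
  shows "(\<exists>A. (\<forall>i. form d (A i)) \<and> (\<exists>i. A i \<noteq> 0) \<and> (\<forall>x. L' x A = 0)) \<longleftrightarrow>
         (\<exists>A. (\<forall>i. form d (A i)) \<and> (\<exists>i. A i \<noteq> 0) \<and> (\<forall>x. L x A = 0))"
proof -
  have "finite (UNIV \<times> mons d :: (3 \<times> 3 multiset) set)" by simp
  from decides_solvable_iff[OF assms(4,5) this]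
  show ?thesis
    using linear_op_solvable_iff[where L = L and Y = UNIV and d = d, OF assms(1)]
      linear_op_solvable_iff[where L = L' and Y = UNIV and d = d, OF assms(2)]
    by (simp add: assms(3))
qed

definition same_op :: "(3 \<Rightarrow> 'k::comm_ring_1 form3) \<Rightarrow> 3 \<times> 3 \<Rightarrow> (3 \<Rightarrow> 'k form3) \<Rightarrow> 'k form3" where
  "same_op F x A = A (fst x) * F (snd x) - A (snd x) * F (fst x)"

definition inverse_op :: "(3 \<Rightarrow> 'k::comm_ring_1 form3) \<Rightarrow> 3 \<times> 3 \<Rightarrow> (3 \<Rightarrow> 'k form3) \<Rightarrow> 'k form3" where
  "inverse_op F x A = subst (A (fst x)) F * xvar (snd x) - subst (A (snd x)) F * xvar (fst x)"

lemma linear_same_op: "linear_op (same_op F x)"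
  unfolding linear_op_def same_op_def
  by (simp add: sum_distrib_right sum_subtractf right_diff_distrib mult.assoc)

lemma linear_inverse_op: "linear_op (inverse_op F x)"
  unfolding linear_op_def inverse_op_def
  by (simp add: subst_sum subst_mult sum_distrib_right sum_subtractf right_diff_distrib mult.assoc)

lemma same_op_iff: "(\<forall>x. same_op F x A = 0) \<longleftrightarrow> same A F"
  by (simp add: same_op_def same_def)

lemma inverse_op_iff: "(\<forall>x. inverse_op F x A = 0) \<longleftrightarrow> same (\<lambda>i. subst (A i) F) xvar"
  by (simp add: inverse_op_def same_def)

definition int_degree_le :: "(3 \<Rightarrow> int form3) \<Rightarrow> nat \<Rightarrow> bool" where
  "int_degree_le F d \<longleftrightarrow> (\<exists>A. (\<forall>i. form d (A i)) \<and> (\<exists>i. A i \<noteq> 0) \<and> same A F)"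

text \<open>
  The comparison of degrees over \<open>\<rat>\<close> and over \<open>'k\<close> is valid as soon as this integer is not zero in \<open>'k\<close>.
\<close>

definition degree_modulus :: "(3 \<Rightarrow> int form3) \<Rightarrow> nat \<Rightarrow> int" where
  "degree_modulus F d = (SOME N. decides (UNIV \<times> mons d) UNIV (\<lambda>q x. same_op F x (unit_triple q)) N)"

lemma degree_modulus: "decides (UNIV \<times> mons d) UNIV (\<lambda>q x. same_op F x (unit_triple q)) (degree_modulus F d)"
  unfolding degree_modulus_def by (rule someI_ex, rule exists_decides) simp_all

lemma degree_modulus_nonzero: "degree_modulus F d \<noteq> 0"
  using degree_modulus[of d F] by (simp add: decides_def)

lemma red_degree_le_iff_int:
  fixes F :: "3 \<Rightarrow> int form3"
  assumes "\<And>i. form D (F i)" "int_form (F i0) \<noteq> (0 :: 'k::field_gcd form3)" "of_int (degree_modulus F d) \<noteq> (0 :: 'k)"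
  shows "red_degree (\<lambda>i. int_form (F i) :: 'k form3) \<le> d \<longleftrightarrow> int_degree_le F d"
proof -
  have "red_degree (\<lambda>i. int_form (F i) :: 'k form3) \<le> d \<longleftrightarrow>
      (\<exists>A. (\<forall>i. form d (A i)) \<and> (\<exists>i. A i \<noteq> 0) \<and> same A (\<lambda>i. int_form (F i) :: 'k form3))"
    by (rule red_degree_le_iff[where F = "\<lambda>i. int_form (F i)", OF form_int_form[OF assms(1)] assms(2)])
  also have "\<dots> \<longleftrightarrow> int_degree_le F d"
    unfolding int_degree_le_def same_op_iff[symmetric]
    by (rule integer_system_transfer[OF linear_same_op linear_same_op _ degree_modulus assms(3)])
      (simp add: same_op_def int_form_diff int_form_mult)
  finally show ?thesis .
qed

lemma integer_inverse:
  fixes F :: "3 \<Rightarrow> int form3" and G :: "3 \<Rightarrow> 'k::field_char_0 form3"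
  assumes "\<And>i. form E (G i)" "\<exists>i. G i \<noteq> 0" "same (\<lambda>i. subst (G i) (\<lambda>i. int_form (F i))) xvar"
  shows "\<exists>A. (\<forall>i. form E (A i)) \<and> (\<exists>i. A i \<noteq> 0) \<and> same (\<lambda>i. subst (A i) F) xvar"
proof -
  obtain N where N: "decides (UNIV \<times> mons E) UNIV (\<lambda>q x. inverse_op F x (unit_triple q)) N"
    using exists_decides[of "UNIV \<times> mons E" UNIV "\<lambda>q x. inverse_op F x (unit_triple q)"] by auto
  then have "of_int N \<noteq> (0 :: 'k)" by (simp add: decides_def)
  have "(\<exists>A. (\<forall>i. form E (A i)) \<and> (\<exists>i. A i \<noteq> 0) \<and> (\<forall>x. inverse_op (\<lambda>i. int_form (F i) :: 'k form3) x A = 0)) \<longleftrightarrow>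
      (\<exists>A. (\<forall>i. form E (A i)) \<and> (\<exists>i. A i \<noteq> 0) \<and> (\<forall>x. inverse_op F x A = 0))"
    by (rule integer_system_transfer[OF linear_inverse_op linear_inverse_op _ N \<open>of_int N \<noteq> (0 :: 'k)\<close>])
      (simp add: inverse_op_def int_form_diff int_form_mult int_form_subst)
  then show ?thesis using assms unfolding inverse_op_iff by blast
qed

lemma int_form_iterate: "int_form (iterate F n i) = iterate (\<lambda>i. int_form (F i)) n i"
  by (induction n arbitrary: i) (simp_all add: iterate_Suc int_form_subst)

text \<open>
  The equations of an inverse pair over the integers. They survive in every field; that the composed
  triples are not zero there is a separate condition on the field.
\<close>

definition int_cremona :: "(3 \<Rightarrow> int form3) \<Rightarrow> (3 \<Rightarrow> int form3) \<Rightarrow> nat \<Rightarrow> nat \<Rightarrow> bool" where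
  "int_cremona F G D E \<longleftrightarrow> (\<forall>i. form D (F i)) \<and> (\<forall>i. form E (G i)) \<and>
     same (\<lambda>i. subst (G i) F) xvar \<and> same (\<lambda>i. subst (F i) G) xvar"

lemma cremona_from_int:
  assumes "int_cremona F G D E" "infinite (UNIV :: 'k::field_gcd set)"
    "int_form (subst (G i) F) \<noteq> (0 :: 'k form3)" "int_form (subst (F j) G) \<noteq> (0 :: 'k form3)"
  shows "\<exists>v w. cremona (\<lambda>i. int_form (F i) :: 'k form3) (\<lambda>i. int_form (G i)) v w D E"
proof -
  let ?F = "\<lambda>i. int_form (F i) :: 'k form3" and ?G = "\<lambda>i. int_form (G i) :: 'k form3"
  have same_int_form: "same (\<lambda>i. int_form (A i) :: 'k form3) xvar" if "same A xvar" for A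
    unfolding same_def
  proof (intro allI)
    fix i j
    have "A i * xvar j = A j * xvar i" using that by (simp add: same_def)
    then have "int_form (A i * xvar j) = (int_form (A j * xvar i) :: 'k form3)" by simp
    then show "int_form (A i) * xvar j = (int_form (A j) * xvar i :: 'k form3)" by (simp add: int_form_mult)
  qed
  have "same (\<lambda>i. subst (?G i) ?F) xvar" "same (\<lambda>i. subst (?F i) ?G) xvar"
    using same_int_form[of "\<lambda>i. subst (G i) F"] same_int_form[of "\<lambda>i. subst (F i) G"] assms(1)
    by (simp_all add: int_cremona_def int_form_subst)
  then obtain v w where v: "\<And>i. subst (?G i) ?F = v * xvar i" and w: "\<And>i. subst (?F i) ?G = w * xvar i"
    using same_reduced[OF _ reduced_xvar] by metis
  have "v \<noteq> 0" "w \<noteq> 0" using assms(3,4) v w by (auto simp: int_form_subst)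
  then have "cremona ?F ?G v w D E"
    using assms(1,2) v w by unfold_locales (auto simp: int_cremona_def form_int_form)
  then show ?thesis by blast
qed

text \<open>
  The inverse solves the linear system \<open>A\<^sub>i(F) x\<^sub>k = A\<^sub>k(F) x\<^sub>i\<close>, which therefore also has an integer
  solution \<open>H\<close>. That \<open>H\<close> is inverse to \<open>F\<close> on the other side as well follows by composing with the dominant
  map \<open>F\<close>, over the field.
\<close>

lemma inverse_over_int:
  fixes F :: "3 \<Rightarrow> int form3" and G :: "3 \<Rightarrow> 'k::{field_gcd,field_char_0} form3"
  assumes "cremona (\<lambda>i. int_form (F i)) G v w D E" "\<And>i. form D (F i)"
  shows "\<exists>H. int_cremona F H D E \<and> (\<exists>i. subst (H i) F \<noteq> 0) \<and> (\<exists>i. subst (F i) H \<noteq> 0)"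
proof -
  interpret cremona "\<lambda>i. int_form (F i)" G v w D E by (rule assms(1))
  let ?F = "\<lambda>i. int_form (F i) :: 'k form3"
  have "\<exists>i. G i \<noteq> 0"
  proof (rule ccontr)
    assume "\<nexists>i. G i \<noteq> 0"
    then have "v * xvar 0 = 0" using G_F[of 0] by simp
    with v_nonzero show False by simp
  qed
  then obtain H where H: "\<And>i. form E (H i)" "\<exists>i. H i \<noteq> 0" "same (\<lambda>i. subst (H i) F) xvar"
    using integer_inverse[of E G F] form_G same_factor[of "\<lambda>i. subst (G i) ?F" v xvar] G_F by blast
  let ?H = "\<lambda>i. int_form (H i) :: 'k form3"
  obtain j where j: "H j \<noteq> 0" using H(2) by blast
  have HF: "subst (?H j) ?F \<noteq> 0"
    using dominantD[OF dominant_F form_int_form[OF H(1)[of j]]] j by auto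
  have "same (\<lambda>i. subst (?H i) ?F) xvar" unfolding same_def
  proof (intro allI)
    fix i k
    have "subst (H i) F * xvar k = subst (H k) F * xvar i" using H(3) by (simp add: same_def)
    from arg_cong[OF this, of "int_form :: _ \<Rightarrow> 'k form3"]
    show "subst (?H i) ?F * xvar k = subst (?H k) ?F * xvar i" by (simp add: int_form_mult int_form_subst)
  qed
  then obtain v' where v': "\<And>i. subst (?H i) ?F = v' * xvar i" using same_reduced[OF _ reduced_xvar] by blast
  have v'_nz: "v' \<noteq> 0" using HF v' by auto
  have undo: "subst (subst (?F i) ?H) ?F = v' ^ D * ?F i" for i
    unfolding subst_subst v' using subst_scale[OF form_F, of i v' xvar] by simp
  have "same (\<lambda>i. subst (F i) H) xvar" unfolding same_def
  proof (intro allI)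
    fix i k
    let ?P = "subst (F i) H * xvar k - subst (F k) H * xvar i"
    have "form (D * E + Suc 0) ?P"
      by (intro form_diff form_mult form_subst assms(2) H(1) form_xvar)
    then have "form (D * E + Suc 0) (int_form ?P :: 'k form3)" by (rule form_int_form)
    moreover have "subst (int_form ?P :: 'k form3) ?F = 0"
      by (simp add: int_form_diff int_form_mult int_form_subst subst_diff subst_mult undo mult_ac)
    ultimately have "int_form ?P = (0 :: 'k form3)" using dominantD[OF dominant_F] by blast
    then have "?P = 0" by (simp only: int_form_eq_0_iff)
    then show "subst (F i) H * xvar k = subst (F k) H * xvar i" by simp
  qed
  then have cr: "int_cremona F H D E" using assms(2) H unfolding int_cremona_def by blast
  have "subst (F 0) H \<noteq> 0"
  proof
    assume "subst (F 0) H = 0"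
    then have "subst (?F 0) ?H = 0" unfolding int_form_subst[symmetric] by simp
    then have "v' ^ D * ?F 0 = 0" using undo[of 0] by simp
    then show False using v'_nz dominant_nonzero[OF dominant_F, of 0] by simp
  qed
  moreover have "subst (H j) F \<noteq> 0" using HF unfolding int_form_subst[symmetric] by auto
  ultimately show ?thesis using cr by blast
qed

section \<open>From types to records\<close>

definition rec_form :: "('k::zero \<Rightarrow> 'a) \<Rightarrow> 'k form3 \<Rightarrow> 'a poly3" where
  "rec_form \<epsilon> P = (\<lambda>m. \<epsilon> (mcoeff P m))"

lemma mcoeff_mult_xvar: "mcoeff (P * xvar i) m = (if i \<in># m then mcoeff (P :: 'k::comm_ring_1 form3) (m - {#i#}) else 0)"
proof -
  have "mcoeff (xvar i * P) m = (\<Sum>n | n \<subseteq># m. if n = {#i#} then mcoeff P (m - {#i#}) else 0)"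
    unfolding mcoeff_mult by (intro sum.cong) (auto simp: xvar_def mcoeff_mterm)
  then show ?thesis by (simp add: mult.commute)
qed

text \<open>
  A surjective ring homomorphism \<open>\<epsilon>\<close> from a type onto a record \<open>K\<close> induces one from the polynomials over the
  type onto \<open>poly3_ring K\<close>. It respects composition, so identities between integer forms can be read
  in \<open>K\<close>. For \<open>\<int>\<close> and \<open>F\<^sub>p\<close> this is reduction modulo \<open>p\<close>.
\<close>

locale poly3_hom = cring K for K :: "('a, 'b) ring_scheme" (structure) +
  fixes \<epsilon> :: "'k::comm_ring_1 \<Rightarrow> 'a"
  assumes \<epsilon>_closed: "\<epsilon> c \<in> carrier K" and \<epsilon>_surj: "x \<in> carrier K \<Longrightarrow> \<exists>c. x = \<epsilon> c"
    and \<epsilon>_0: "\<epsilon> 0 = \<zero>" and \<epsilon>_1: "\<epsilon> 1 = \<one>"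
    and \<epsilon>_add: "\<epsilon> (a + b) = \<epsilon> a \<oplus> \<epsilon> b" and \<epsilon>_mult: "\<epsilon> (a * b) = \<epsilon> a \<otimes> \<epsilon> b"
begin

abbreviation "RR \<equiv> poly3_ring K"
abbreviation "r \<equiv> rec_form \<epsilon>"

lemma \<epsilon>_sum: "finite A \<Longrightarrow> (\<Oplus>n\<in>A. \<epsilon> (g n)) = \<epsilon> (sum g A)"
  by (induction A rule: finite_induct) (simp_all add: \<epsilon>_0 \<epsilon>_add \<epsilon>_closed finsum_insert Pi_def)

lemma r_add: "r (P + Q) = r P \<oplus>\<^bsub>RR\<^esub> r Q"
  by (simp add: poly3_ring_def indexed_padd_def rec_form_def \<epsilon>_add)

lemma r_mult: "r (P * Q) = r P \<otimes>\<^bsub>RR\<^esub> r Q"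
  by (simp add: poly3_ring_def rec_form_def mcoeff_mult \<epsilon>_sum flip: \<epsilon>_mult)

lemma r_const: "r (const c) = indexed_const (\<epsilon> c)"
  by (auto simp: rec_form_def indexed_const_def const_def mcoeff_mterm \<epsilon>_0)

lemma r_0: "r 0 = \<zero>\<^bsub>RR\<^esub>"
  using r_const[of 0] by (simp add: poly3_ring_def \<epsilon>_0)

lemma r_1: "r 1 = \<one>\<^bsub>RR\<^esub>"
  using r_const[of 1] by (simp add: poly3_ring_def \<epsilon>_1)

lemma r_mult_xvar: "r (P * xvar i) = indexed_pmult (r P) i"
  by (auto simp: rec_form_def indexed_pmult_def mcoeff_mult_xvar \<epsilon>_0)

lemma r_xvar: "r (xvar i) = indexed_var i"
  using r_mult_xvar[of 1 i] by (simp add: indexed_var_def r_1) (simp add: poly3_ring_def)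

lemma r_closed: "r P \<in> carrier RR"
proof -
  let ?C = "indexed_pset UNIV (carrier K) :: (3 multiset \<Rightarrow> 'a) set"
  have mterm: "r (mterm c m) \<in> ?C" for c m
  proof (induction m)
    case empty
    show ?case using r_const[of c] indexed_pset.indexed_const[OF \<epsilon>_closed[of c]] by (simp add: const_def)
  next
    case (add i m)
    have "mterm c (add_mset i m) = mterm c m * xvar i" by (simp add: xvar_def mterm_mult)
    then show ?case using indexed_pset.indexed_pmult[OF add, of i] by (simp add: r_mult_xvar)
  qed
  have "r (\<Sum>m\<in>A. mterm (c m) m) \<in> ?C" if "finite A" for A c using that
  proof (induction A rule: finite_induct)
    case empty
    have "r 0 = indexed_const \<zero>" by (simp add: r_0) (simp add: poly3_ring_def)
    then show ?case using indexed_pset.indexed_const[OF zero_closed] by simp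
  next
    case (insert m A)
    have "r (mterm (c m) m + (\<Sum>m\<in>A. mterm (c m) m)) =
        indexed_padd (r (mterm (c m) m)) (r (\<Sum>m\<in>A. mterm (c m) m))"
      by (simp add: r_add) (simp add: poly3_ring_def)
    then show ?case using indexed_pset.indexed_padd[OF mterm insert.IH] insert.hyps by simp
  qed
  from this[of "{m. mcoeff P m \<noteq> 0}" "mcoeff P"] form3_expand[of "{m. mcoeff P m \<noteq> 0}" P]
  show ?thesis by (simp add: poly3_ring_def)
qed

lemma r_surj: "p \<in> carrier RR \<Longrightarrow> \<exists>P. p = r P"
proof -
  assume "p \<in> carrier RR"
  then have "p \<in> indexed_pset UNIV (carrier K)" by (simp add: poly3_ring_def)
  then show ?thesis
  proof induction
    case (indexed_const k)
    then show ?case using \<epsilon>_surj[of k] r_const by metis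
  next
    case (indexed_padd p q)
    then obtain P Q where "p = r P" "q = r Q" by blast
    then have "indexed_padd p q = r (P + Q)" by (simp add: r_add) (simp add: poly3_ring_def)
    then show ?case by blast
  next
    case (indexed_pmult p i)
    then show ?case using r_mult_xvar by metis
  qed
qed

lemma cring_RR: "cring RR"
proof (intro cringI abelian_groupI comm_monoidI)
  fix x y z assume "x \<in> carrier RR" "y \<in> carrier RR" "z \<in> carrier RR"
  then obtain P Q S where x: "x = r P" "y = r Q" "z = r S" using r_surj by metis
  show "x \<oplus>\<^bsub>RR\<^esub> y \<oplus>\<^bsub>RR\<^esub> z = x \<oplus>\<^bsub>RR\<^esub> (y \<oplus>\<^bsub>RR\<^esub> z)" unfolding x by (simp add: add.assoc flip: r_add)
  show "x \<otimes>\<^bsub>RR\<^esub> y \<otimes>\<^bsub>RR\<^esub> z = x \<otimes>\<^bsub>RR\<^esub> (y \<otimes>\<^bsub>RR\<^esub> z)" unfolding x by (simp add: mult.assoc flip: r_mult)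
  show "(x \<oplus>\<^bsub>RR\<^esub> y) \<otimes>\<^bsub>RR\<^esub> z = x \<otimes>\<^bsub>RR\<^esub> z \<oplus>\<^bsub>RR\<^esub> y \<otimes>\<^bsub>RR\<^esub> z"
    unfolding x by (simp add: distrib_right flip: r_mult r_add)
next
  fix x y assume "x \<in> carrier RR" "y \<in> carrier RR"
  then obtain P Q where x: "x = r P" "y = r Q" using r_surj by metis
  show "x \<oplus>\<^bsub>RR\<^esub> y \<in> carrier RR" unfolding x by (simp add: r_closed flip: r_add)
  show "x \<otimes>\<^bsub>RR\<^esub> y \<in> carrier RR" unfolding x by (simp add: r_closed flip: r_mult)
  show "x \<oplus>\<^bsub>RR\<^esub> y = y \<oplus>\<^bsub>RR\<^esub> x" unfolding x by (simp add: add.commute flip: r_add)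
  show "x \<otimes>\<^bsub>RR\<^esub> y = y \<otimes>\<^bsub>RR\<^esub> x" unfolding x by (simp add: mult.commute flip: r_mult)
next
  fix x assume "x \<in> carrier RR"
  then obtain P where x: "x = r P" using r_surj by metis
  show "\<zero>\<^bsub>RR\<^esub> \<oplus>\<^bsub>RR\<^esub> x = x" unfolding x by (simp flip: r_0 r_add)
  show "\<one>\<^bsub>RR\<^esub> \<otimes>\<^bsub>RR\<^esub> x = x" unfolding x by (simp flip: r_1 r_mult)
  show "\<exists>y\<in>carrier RR. y \<oplus>\<^bsub>RR\<^esub> x = \<zero>\<^bsub>RR\<^esub>"
    unfolding x by (rule bexI[of _ "r (- P)"]) (simp_all add: r_closed flip: r_0 r_add)
qed (simp_all add: r_closed flip: r_0 r_1)

sublocale RR: cring RR by (rule cring_RR)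

lemma r_sum: "finite A \<Longrightarrow> (\<Oplus>\<^bsub>RR\<^esub>n\<in>A. r (g n)) = r (sum g A)"
  by (induction A rule: finite_induct) (simp_all add: r_0 r_add r_closed RR.finsum_insert Pi_def)

lemma r_prod: "finite A \<Longrightarrow> (\<Otimes>\<^bsub>RR\<^esub>n\<in>A. r (g n)) = r (prod g A)"
  by (induction A rule: finite_induct) (simp_all add: r_1 r_mult r_closed RR.finprod_insert Pi_def)

lemma r_power: "r P [^]\<^bsub>RR\<^esub> (n::nat) = r (P ^ n)"
  by (induction n) (simp_all add: r_1 r_mult RR.m_comm r_closed)

lemma subst3_r: "subst3 K (r P) (\<lambda>i. r (G i)) = r (subst P G)"
proof -
  define S where "S = {m. \<epsilon> (mcoeff P m) \<noteq> \<zero>}"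
  have S: "S \<subseteq> {m. mcoeff P m \<noteq> 0}" using \<epsilon>_0 by (auto simp: S_def)
  then have fin: "finite S" by (rule finite_subset) simp
  let ?t = "\<lambda>m. const (mcoeff P m) * mono_at G m"
  have "subst3 K (r P) (\<lambda>i. r (G i)) = (\<Oplus>\<^bsub>RR\<^esub>m\<in>S. r (?t m))"
    by (simp add: subst3_def S_def rec_form_def[of _ P] r_mult r_const mono_at_def r_power r_prod)
  also have "\<dots> = r (sum ?t S)" using fin by (rule r_sum)
  also have "\<dots> = r (subst P G)"
  proof
    fix m
    \<comment> \<open>Monomials of \<open>P\<close> may disappear under \<open>\<epsilon>\<close>; their contributions vanish.\<close>
    have zero: "\<epsilon> (mcoeff (?t n) m) = \<zero>" if "n \<in> {m. mcoeff P m \<noteq> 0} - S" for n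
      using that by (simp add: \<epsilon>_mult S_def \<epsilon>_closed)
    have "subst P G = sum ?t S + sum ?t ({m. mcoeff P m \<noteq> 0} - S)"
      unfolding subst_def using S by (simp add: sum.subset_diff add.commute)
    moreover have "\<epsilon> (mcoeff (sum ?t ({m. mcoeff P m \<noteq> 0} - S)) m) = \<zero>"
    proof -
      have "\<epsilon> (mcoeff (sum ?t ({m. mcoeff P m \<noteq> 0} - S)) m) = (\<Oplus>n\<in>{m. mcoeff P m \<noteq> 0} - S. \<epsilon> (mcoeff (?t n) m))"
        unfolding mcoeff_sum by (rule \<epsilon>_sum[symmetric]) simp
      also have "\<dots> = \<zero>" by (rule add.finprod_one_eqI) (rule zero)
      finally show ?thesis .
    qed
    ultimately show "r (sum ?t S) m = r (subst P G) m"
      by (simp add: rec_form_def \<epsilon>_add \<epsilon>_closed del: mcoeff_sum)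
  qed
  finally show ?thesis .
qed

lemma comp_map_r: "comp_map K (\<lambda>i. r (F i)) (\<lambda>i. r (G i)) = (\<lambda>i. r (compose F G i))"
  by (simp add: comp_map_def compose_def subst3_r)

lemma id_map_r: "id_map K = (\<lambda>i. r (xvar i))"
  by (simp add: id_map_def r_xvar)

lemma iter_map_r: "iter_map K (\<lambda>i. r (F i)) n = (\<lambda>i. r (iterate F n i))"
proof (induction n)
  case (Suc n)
  have "iter_map K (\<lambda>i. r (F i)) (Suc n) = comp_map K (\<lambda>i. r (F i)) (iter_map K (\<lambda>i. r (F i)) n)"
    by (simp add: iter_map_def)
  also have "\<dots> = (\<lambda>i. r (iterate F (Suc n) i))" unfolding Suc comp_map_r by (simp add: compose_def iterate_Suc)
  finally show ?case .
qed (simp add: iter_map_def id_map_r)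

lemma homogeneous_r: "form d P \<Longrightarrow> homogeneous K d (r P)"
proof -
  assume d: "form d P"
  have "size m = d" if "r P m \<noteq> \<zero>" for m
  proof (rule ccontr)
    assume "size m \<noteq> d"
    then have "mcoeff P m = 0" using d unfolding form_iff by blast
    with that show False by (simp add: rec_form_def \<epsilon>_0)
  qed
  then show ?thesis unfolding homogeneous_def using r_closed by blast
qed

lemma rat_map_r:
  assumes "\<And>i. form d (F i)" "r (F i) \<noteq> \<zero>\<^bsub>RR\<^esub>" shows "rat_map K (\<lambda>i. r (F i))"
  unfolding rat_map_def rat_map_of_degree_def using assms homogeneous_r by blast

lemma birational_r:
  assumes F: "\<And>i. form d (F i)" and G: "\<And>i. form e (G i)"
    and "same (compose G F) xvar" "same (compose F G) xvar"
    and GF: "r (subst (G i) F) \<noteq> \<zero>\<^bsub>RR\<^esub>" and FG: "r (subst (F j) G) \<noteq> \<zero>\<^bsub>RR\<^esub>"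
  shows "birational K (\<lambda>i. r (F i))"
proof -
  have nz: "r P \<noteq> \<zero>\<^bsub>RR\<^esub>" if "r (subst P H) \<noteq> \<zero>\<^bsub>RR\<^esub>" for P H
  proof
    assume "r P = \<zero>\<^bsub>RR\<^esub>"
    then have "r P = r 0" by (simp only: r_0)
    then have "r P m = r 0 m" for m by (rule fun_cong)
    then have "\<epsilon> (mcoeff P m) = \<zero>" for m by (simp add: rec_form_def \<epsilon>_0)
    then have "subst3 K (r P) (\<lambda>i. r (H i)) = \<zero>\<^bsub>RR\<^esub>" by (simp add: subst3_def rec_form_def)
    with that show False by (simp add: subst3_r)
  qed
  have one: "r (xvar 0) \<noteq> \<zero>\<^bsub>RR\<^esub>"
  proof
    assume "r (xvar 0) = \<zero>\<^bsub>RR\<^esub>"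
    then have "r (xvar 0) = r 0" by (simp only: r_0)
    then have "r (xvar 0) {#0#} = r 0 {#0#}" by (rule fun_cong)
    then have "\<epsilon> (mcoeff (xvar 0) {#0#}) = \<epsilon> (mcoeff 0 {#0#})" by (simp only: rec_form_def)
    then have "\<one> = \<zero>" by (simp add: xvar_def mcoeff_mterm \<epsilon>_0 \<epsilon>_1)
    then have "carrier K = {\<zero>}" using one_zeroD by simp
    then have "\<epsilon> c = \<zero>" for c using \<epsilon>_closed by auto
    then have "r P = r 0" for P by (simp add: rec_form_def)
    then show False using GF by (simp add: r_0)
  qed
  have same: "same_map K (comp_map K (\<lambda>i. r (A i)) (\<lambda>i. r (B i))) (id_map K)"
    if "\<And>i. form a (A i)" "\<And>i. form b (B i)" "same (compose A B) xvar" "r (subst (A k) B) \<noteq> \<zero>\<^bsub>RR\<^esub>" for A B a b k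
  proof -
    have "rat_map K (\<lambda>i. r (compose A B i))"
      by (rule rat_map_r[of "a * b" _ k]) (use that in \<open>simp_all add: compose_def form_subst\<close>)
    moreover have "rat_map K (\<lambda>i. r (xvar i))" by (rule rat_map_r[where F = xvar, OF form_xvar one])
    moreover have "r (compose A B i) \<otimes>\<^bsub>RR\<^esub> r (xvar j) = r (compose A B j) \<otimes>\<^bsub>RR\<^esub> r (xvar i)" for i j
      using that(3) by (simp add: same_def flip: r_mult)
    ultimately show ?thesis unfolding same_map_def comp_map_r id_map_r by blast
  qed
  have "rat_map K (\<lambda>i. r (F i))" by (rule rat_map_r[where F = F, OF F nz[OF FG]])
  moreover have "rat_map K (\<lambda>i. r (G i))" by (rule rat_map_r[where F = G, OF G nz[OF GF]])
  moreover have "same_map K (comp_map K (\<lambda>i. r (F i)) (\<lambda>i. r (G i))) (id_map K)"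
    by (rule same[OF _ _ assms(4) FG]) (rule F G)+
  moreover have "same_map K (comp_map K (\<lambda>i. r (G i)) (\<lambda>i. r (F i))) (id_map K)"
    by (rule same[OF _ _ assms(3) GF]) (rule F G)+
  ultimately show ?thesis unfolding birational_def by blast
qed

end

text \<open>
  If \<open>\<epsilon>\<close> is a bijection onto a field, then divisibility, reducedness and the degree of a map mean the same
  on both sides.
\<close>

locale poly3_iso = poly3_hom K \<epsilon>
  for K :: "('a, 'b) ring_scheme" (structure) and \<epsilon> :: "'k::field_gcd \<Rightarrow> 'a" +
  assumes \<epsilon>_inj: "\<epsilon> a = \<epsilon> b \<Longrightarrow> a = b"
begin

lemma \<epsilon>_eq_0: "\<epsilon> a = \<zero> \<longleftrightarrow> a = 0"
  using \<epsilon>_inj[of a 0] \<epsilon>_0 by auto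

lemma r_inj: "r P = r Q \<longleftrightarrow> P = Q"
proof
  assume eq: "r P = r Q"
  show "P = Q"
  proof (rule mcoeff_eqI)
    fix m
    have "r P m = r Q m" using eq by simp
    then show "mcoeff P m = mcoeff Q m" unfolding rec_form_def by (rule \<epsilon>_inj)
  qed
qed simp

lemma r_eq_0: "r P = \<zero>\<^bsub>RR\<^esub> \<longleftrightarrow> P = 0"
  using r_inj[of P 0] by (simp add: r_0)

lemma homogeneous_r_iff: "homogeneous K d (r P) \<longleftrightarrow> form d P"
  using r_closed[of P] unfolding homogeneous_def form_def by (simp add: rec_form_def \<epsilon>_eq_0)

lemma rat_map_of_degree_r:
  "rat_map_of_degree K d (\<lambda>i. r (F i)) \<longleftrightarrow> (\<forall>i. form d (F i)) \<and> (\<exists>i. F i \<noteq> 0)"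
  by (simp add: rat_map_of_degree_def homogeneous_r_iff r_eq_0)

lemma same_map_r:
  "same_map K (\<lambda>i. r (F i)) (\<lambda>i. r (G i)) \<longleftrightarrow>
     rat_map K (\<lambda>i. r (F i)) \<and> rat_map K (\<lambda>i. r (G i)) \<and> same F G"
  by (simp add: same_map_def same_def r_inj flip: r_mult)

lemma divides_r: "r P divides\<^bsub>RR\<^esub> r Q \<longleftrightarrow> P dvd Q"
proof
  assume "r P divides\<^bsub>RR\<^esub> r Q"
  then obtain c where "c \<in> carrier RR" "r Q = r P \<otimes>\<^bsub>RR\<^esub> c" by (auto simp: factor_def)
  moreover from this obtain C where "c = r C" using r_surj by blast
  ultimately have "Q = P * C" using r_inj by (simp flip: r_mult)
  then show "P dvd Q" by simp
next
  assume "P dvd Q"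
  then obtain C where "Q = P * C" by (rule dvdE)
  then have "r Q = r P \<otimes>\<^bsub>RR\<^esub> r C" by (simp add: r_mult)
  then show "r P divides\<^bsub>RR\<^esub> r Q" unfolding factor_def using r_closed by blast
qed

lemma unit_r: "r P \<in> Units RR \<longleftrightarrow> P dvd 1"
proof
  assume "r P \<in> Units RR"
  then obtain c where "c \<in> carrier RR" "r P \<otimes>\<^bsub>RR\<^esub> c = \<one>\<^bsub>RR\<^esub>" by (auto simp: Units_def)
  then have "r P divides\<^bsub>RR\<^esub> r 1" unfolding factor_def r_1 by (metis)
  then show "P dvd 1" by (simp only: divides_r)
next
  assume "P dvd 1"
  then obtain C where C: "1 = P * C" by (rule dvdE)
  then have "r P \<otimes>\<^bsub>RR\<^esub> r C = \<one>\<^bsub>RR\<^esub>" "r C \<otimes>\<^bsub>RR\<^esub> r P = \<one>\<^bsub>RR\<^esub>"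
    by (simp_all add: mult.commute flip: r_1 r_mult)
  then show "r P \<in> Units RR" unfolding Units_def using r_closed by blast
qed

lemma no_common_factor_r: "no_common_factor K (\<lambda>i. r (G i)) \<longleftrightarrow> reduced G"
proof -
  have "no_common_factor K (\<lambda>i. r (G i)) \<longleftrightarrow> (\<forall>H. (\<forall>i. r H divides\<^bsub>RR\<^esub> r (G i)) \<longrightarrow> r H \<in> Units RR)"
    unfolding no_common_factor_def using r_closed r_surj by metis
  then show ?thesis by (simp add: divides_r unit_r reduced_def)
qed

lemma r_triple: "(\<And>i. G' i \<in> carrier RR) \<Longrightarrow> \<exists>G. G' = (\<lambda>i. r (G i))"
proof -
  assume "\<And>i. G' i \<in> carrier RR"
  then have "\<forall>i. \<exists>P. G' i = r P" by (intro allI r_surj)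
  from choice[OF this] obtain G where "\<forall>i. G' i = r (G i)" by (rule exE)
  then show ?thesis by (intro exI[of _ G] ext) simp
qed

lemma rat_map_triple: "rat_map_of_degree K d G' \<Longrightarrow> \<exists>G. G' = (\<lambda>i. r (G i))"
  by (rule r_triple) (simp add: rat_map_of_degree_def homogeneous_def)

lemma map_degree_r:
  assumes "rat_map K (\<lambda>i. r (F i))"
  shows "map_degree K (\<lambda>i. r (F i)) = red_degree F"
proof -
  have "(\<exists>G. rat_map_of_degree K d G \<and> no_common_factor K G \<and> same_map K (\<lambda>i. r (F i)) G) \<longleftrightarrow>
      (\<exists>G. (\<forall>i. form d (G i)) \<and> (\<exists>i. G i \<noteq> 0) \<and> reduced G \<and> same F G)" (is "?L \<longleftrightarrow> ?R") for d
  proof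
    assume ?L
    then obtain G' where G': "rat_map_of_degree K d G'" "no_common_factor K G'" "same_map K (\<lambda>i. r (F i)) G'" by blast
    obtain G where G: "G' = (\<lambda>i. r (G i))" using rat_map_triple[OF G'(1)] by blast
    from G' show ?R unfolding G rat_map_of_degree_r no_common_factor_r same_map_r by blast
  next
    assume ?R
    then obtain G where G: "\<forall>i. form d (G i)" "\<exists>i. G i \<noteq> 0" "reduced G" "same F G" by blast
    then have "rat_map_of_degree K d (\<lambda>i. r (G i))" by (simp add: rat_map_of_degree_r)
    moreover from this have "rat_map K (\<lambda>i. r (G i))" unfolding rat_map_def by blast
    ultimately show ?L using G assms no_common_factor_r same_map_r by blast
  qed
  then show ?thesis unfolding map_degree_def red_degree_def by simp
qed

lemma cremona_of_birational:
  assumes "birational K (\<lambda>i. r (F i))" "infinite (UNIV :: 'k set)"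
  shows "\<exists>G v w D E. cremona F G v w D E"
proof -
  from assms(1) obtain G' where G': "rat_map K (\<lambda>i. r (F i))" "rat_map K G'"
    "same_map K (comp_map K (\<lambda>i. r (F i)) G') (id_map K)"
    "same_map K (comp_map K G' (\<lambda>i. r (F i))) (id_map K)"
    unfolding birational_def by blast
  obtain d where "rat_map_of_degree K d G'" using G'(2) unfolding rat_map_def by blast
  from rat_map_triple[OF this] obtain G where G: "G' = (\<lambda>i. r (G i))" by blast
  obtain D where D: "\<And>i. form D (F i)" using G'(1) unfolding rat_map_def rat_map_of_degree_r by blast
  obtain E where E: "\<And>i. form E (G i)" using G'(2) unfolding G rat_map_def rat_map_of_degree_r by blast
  have fg: "same (compose F G) xvar" "\<exists>i. compose F G i \<noteq> 0" and gf: "same (compose G F) xvar" "\<exists>i. compose G F i \<noteq> 0"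
    using G'(3,4) unfolding G comp_map_r id_map_r same_map_r
    by (auto simp: rat_map_def rat_map_of_degree_r)
  obtain w where w: "\<And>i. compose F G i = w * xvar i" using same_reduced[OF fg(1) reduced_xvar] by blast
  obtain v where v: "\<And>i. compose G F i = v * xvar i" using same_reduced[OF gf(1) reduced_xvar] by blast
  have "v \<noteq> 0" "w \<noteq> 0" using fg(2) gf(2) v w by auto
  then have "cremona F G v w D E"
    using assms(2) D E v w by unfold_locales (simp_all add: compose_def)
  then show ?thesis by blast
qed

lemma map_degree_iterates:
  assumes "cremona F G v w D E"
  shows "map_degree K (iter_map K (\<lambda>i. r (F i)) n) = red_degree (iterate F n)"
proof -
  interpret cremona F G v w D E by (rule assms)
  have "rat_map_of_degree K (D ^ n) (\<lambda>i. r (iterate F n i))"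
    unfolding rat_map_of_degree_r
    using form_iterate[where F = F, OF form_F, of n] dominant_nonzero[OF dominant_iterate[of n], of 0] by blast
  then have "rat_map K (\<lambda>i. r (iterate F n i))" unfolding rat_map_def by blast
  then show ?thesis unfolding iter_map_r by (rule map_degree_r)
qed

end

section \<open>Degree laws common to all fields\<close>

text \<open>
  What is known about the degrees \<open>d n\<close> of the iterates of the integral map \<open>F\<close> over some field. The
  predicate \<open>nz\<close> holds for the integers that are not zero in that field. All constants are independent
  of the field.
\<close>

definition degree_laws :: "(3 \<Rightarrow> int form3) \<Rightarrow> (int \<Rightarrow> bool) \<Rightarrow> (nat \<Rightarrow> nat) \<Rightarrow> bool" where
  "degree_laws F nz d \<longleftrightarrow> (\<forall>n. 0 < d n) \<and> (\<forall>m n. d (m + n) \<le> d m * d n) \<and>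
     (\<forall>N l. 1 \<le> N \<longrightarrow> (\<lambda>n. root n (real (d n))) \<longlonglongrightarrow> l \<longrightarrow> real (d (2 * N)) \<le> 24 * real (d N) * l ^ N) \<and>
     (\<forall>n e. nz (degree_modulus (iterate F n) e) \<longrightarrow> (d n \<le> e \<longleftrightarrow> int_degree_le (iterate F n) e))"

lemma (in poly3_iso) degree_laws_record:
  assumes "int_cremona F G D E" "infinite (UNIV :: 'k set)"
    "\<epsilon> (of_int (mcoeff (subst (G i) F) m)) \<noteq> \<zero>" "\<epsilon> (of_int (mcoeff (subst (F j) G) m')) \<noteq> \<zero>"
  shows "degree_laws F (\<lambda>N. \<epsilon> (of_int N) \<noteq> \<zero>)
    (\<lambda>n. map_degree K (iter_map K (\<lambda>i m. \<epsilon> (of_int (mcoeff (F i) m))) n))"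
proof -
  let ?F = "\<lambda>i. int_form (F i) :: 'k form3"
  have "mcoeff (int_form (subst (G i) F) :: 'k form3) m \<noteq> 0" "mcoeff (int_form (subst (F j) G) :: 'k form3) m' \<noteq> 0"
    using assms(3,4) by (simp_all add: \<epsilon>_eq_0)
  then have nz: "int_form (subst (G i) F) \<noteq> (0 :: 'k form3)" "int_form (subst (F j) G) \<noteq> (0 :: 'k form3)"
    by (metis mcoeff_0)+
  obtain v w where cr: "cremona ?F (\<lambda>i. int_form (G i)) v w D E"
    using cremona_from_int[OF assms(1,2) nz] by blast
  interpret cremona ?F "\<lambda>i. int_form (G i)" v w D E by (rule cr)
  have "(\<lambda>i m. \<epsilon> (of_int (mcoeff (F i) m))) = (\<lambda>i. r (?F i))" by (simp add: rec_form_def)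
  then have deg: "map_degree K (iter_map K (\<lambda>i m. \<epsilon> (of_int (mcoeff (F i) m))) n) = red_degree (iterate ?F n)" for n
    using map_degree_iterates[OF cr, of n] by simp
  have "red_degree (iterate ?F n) \<le> e \<longleftrightarrow> int_degree_le (iterate F n) e" if "of_int (degree_modulus (iterate F n) e) \<noteq> (0 :: 'k)" for n e
  proof -
    have "iterate ?F n = (\<lambda>i. int_form (iterate F n i))" by (simp add: int_form_iterate)
    moreover have "form (D ^ n) (iterate F n i)" for i
      using assms(1) by (intro form_iterate) (simp add: int_cremona_def)
    moreover have "int_form (iterate F n 0) \<noteq> (0 :: 'k form3)"
      unfolding int_form_iterate by (rule dominant_nonzero[OF dominant_iterate])
    ultimately show ?thesis using red_degree_le_iff_int[of "D ^ n" "iterate F n" 0 e] that by simp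
  qed
  then show ?thesis
    unfolding degree_laws_def deg \<epsilon>_eq_0
    using degree_pos degree_submult degree_growth by blast
qed

section \<open>The algebraic closure of the rationals\<close>

instance alg_closure :: ("Fields.field") field_gcd ..

definition Qbar :: "((rat list \<times> nat) multiset \<Rightarrow> rat) ring" where
  "Qbar = field.alg_closure rat_ring"

lemma algebraic_closure_Qbar: "algebraic_closure Qbar (range (ring.indexed_const rat_ring))"
proof -
  have "field rat_ring" by (rule field_from_type_algebra)
  from field.alg_closureE(1)[OF this] show ?thesis by (simp add: Qbar_def ring_of_type_algebra_def)
qed

interpretation Qbar: poly3_iso Qbar Rep_alg_closure
proof -
  interpret algebraic_closure Qbar "range (ring.indexed_const rat_ring)" by (rule algebraic_closure_Qbar)
  show "poly3_iso Qbar (Rep_alg_closure :: rat alg_closure \<Rightarrow> _)"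
  proof unfold_locales
    fix a b c :: "rat alg_closure" and x
    show "Rep_alg_closure c \<in> carrier Qbar" unfolding Qbar_def by (rule Rep_alg_closure)
    show "\<exists>c :: rat alg_closure. x = Rep_alg_closure c" if "x \<in> carrier Qbar"
      using Rep_alg_closure_cases[of x] that unfolding Qbar_def by blast
    show "Rep_alg_closure (0 :: rat alg_closure) = \<zero>\<^bsub>Qbar\<^esub>" unfolding Qbar_def by (rule zero_alg_closure.rep_eq)
    show "Rep_alg_closure (1 :: rat alg_closure) = \<one>\<^bsub>Qbar\<^esub>" unfolding Qbar_def by (rule one_alg_closure.rep_eq)
    show "Rep_alg_closure (a + b) = Rep_alg_closure a \<oplus>\<^bsub>Qbar\<^esub> Rep_alg_closure b"
      unfolding Qbar_def by (rule plus_alg_closure.rep_eq)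
    show "Rep_alg_closure (a * b) = Rep_alg_closure a \<otimes>\<^bsub>Qbar\<^esub> Rep_alg_closure b"
      unfolding Qbar_def by (rule times_alg_closure.rep_eq)
    show "a = b" if "Rep_alg_closure a = Rep_alg_closure b" using that by (simp add: Rep_alg_closure_inject)
  qed
qed

lemma to_closure_rat: "to_closure rat_ring (generic_fibre f) = (\<lambda>i m. Rep_alg_closure (of_int (f i m) :: rat alg_closure))"
  unfolding to_closure_def generic_fibre_def base_change_def
  by (simp flip: to_ac.rep_eq)

section \<open>The algebraic closures of the prime fields\<close>

definition to_Fpbar :: "nat \<Rightarrow> int \<Rightarrow> (int list \<times> nat) multiset \<Rightarrow> int" where
  "to_Fpbar p c = ring.indexed_const (Fp p) (c mod int p)"

text \<open>
  The degree laws over an algebraic closure of \<open>F\<^sub>p\<close>, for all integral birational maps whose inverse pair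
  stays nondegenerate modulo \<open>p\<close>.
\<close>

definition good_reduction :: "nat \<Rightarrow> bool" where
  "good_reduction p \<longleftrightarrow> (\<forall>F G D E i j m m'. int_cremona F G D E \<longrightarrow>
     \<not> int p dvd mcoeff (subst (G i) F) m \<longrightarrow> \<not> int p dvd mcoeff (subst (F j) G) m' \<longrightarrow>
     degree_laws F (\<lambda>N. \<not> int p dvd N)
       (\<lambda>n. map_degree (field.alg_closure (Fp p)) (iter_map (field.alg_closure (Fp p)) (\<lambda>i m. to_Fpbar p (mcoeff (F i) m)) n)))"

text \<open>
  The theory of degrees is developed over field types, and a type cannot depend on the variable
  \<open>p\<close>. But \<open>good_reduction p\<close> is a closed statement about \<open>p\<close>, so it is enough to prove it for one fixed
  prime that violates it whenever any prime does. An algebraic closure of the field with that many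
  elements is turned into a type below.
\<close>

definition worst_prime :: nat where
  "worst_prime = (SOME p. Factorial_Ring.prime p \<and>
     (good_reduction p \<longrightarrow> (\<forall>q. Factorial_Ring.prime q \<longrightarrow> good_reduction q)))"

lemma worst_prime: "Factorial_Ring.prime worst_prime"
    "good_reduction worst_prime \<Longrightarrow> Factorial_Ring.prime q \<Longrightarrow> good_reduction q"
proof -
  have "\<exists>p. Factorial_Ring.prime (p::nat) \<and> (good_reduction p \<longrightarrow> (\<forall>q. Factorial_Ring.prime q \<longrightarrow> good_reduction q))"
    using two_is_prime_nat by blast
  from someI_ex[OF this] show "Factorial_Ring.prime worst_prime"
    "good_reduction worst_prime \<Longrightarrow> Factorial_Ring.prime q \<Longrightarrow> good_reduction q"
    unfolding worst_prime_def[symmetric] by blast+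
qed

definition Fbar :: "((int list \<times> nat) multiset \<Rightarrow> int) ring" where
  "Fbar = field.alg_closure (Fp worst_prime)"

lemma field_Fp: "Factorial_Ring.prime p \<Longrightarrow> field (Fp p)"
  by (rule residues_prime.is_field) (simp add: residues_prime_def)

lemma Fbar:
  "algebraic_closure Fbar (ring.indexed_const (Fp worst_prime) ` carrier (Fp worst_prime))"
  "ring.indexed_const (Fp worst_prime) \<in> ring_hom (Fp worst_prime) Fbar"
  unfolding Fbar_def using field.alg_closureE[OF field_Fp[OF worst_prime(1)]] by blast+

lemma algebraically_closed_Fbar: "algebraically_closed Fbar"
proof -
  interpret algebraic_closure Fbar "ring.indexed_const (Fp worst_prime) ` carrier (Fp worst_prime)" by (rule Fbar)
  show ?thesis by (rule algebraically_closed_axioms)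
qed

interpretation Fbar: cring Fbar
proof -
  interpret algebraically_closed Fbar by (rule algebraically_closed_Fbar)
  show "cring Fbar" by (rule is_cring)
qed

lemma Fbar_units: "Units Fbar = carrier Fbar - {\<zero>\<^bsub>Fbar\<^esub>}" and Fbar_one_not_zero: "\<one>\<^bsub>Fbar\<^esub> \<noteq> \<zero>\<^bsub>Fbar\<^esub>"
proof -
  interpret F: algebraically_closed Fbar by (rule algebraically_closed_Fbar)
  show "Units Fbar = carrier Fbar - {\<zero>\<^bsub>Fbar\<^esub>}" by (rule F.field_Units)
  show "\<one>\<^bsub>Fbar\<^esub> \<noteq> \<zero>\<^bsub>Fbar\<^esub>" by (rule F.one_not_zero)
qed

typedef fbar = "carrier Fbar"
  using Fbar.zero_closed by blast

lemma Rep_fbar_closed [simp]: "Rep_fbar x \<in> carrier Fbar"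
  by (rule Rep_fbar)

instantiation fbar :: "Fields.field"
begin

definition "0 = Abs_fbar \<zero>\<^bsub>Fbar\<^esub>"
definition "1 = Abs_fbar \<one>\<^bsub>Fbar\<^esub>"
definition "x + y = Abs_fbar (Rep_fbar x \<oplus>\<^bsub>Fbar\<^esub> Rep_fbar y)"
definition "x * y = Abs_fbar (Rep_fbar x \<otimes>\<^bsub>Fbar\<^esub> Rep_fbar y)"
definition "- x = Abs_fbar (\<ominus>\<^bsub>Fbar\<^esub> Rep_fbar x)"
definition "x - y = x + - (y :: fbar)"
definition "inverse x = (if x = 0 then 0 else Abs_fbar (inv\<^bsub>Fbar\<^esub> Rep_fbar x))"
definition "x div y = x * inverse (y :: fbar)"

lemma Rep_fbar_simps:
  "Rep_fbar 0 = \<zero>\<^bsub>Fbar\<^esub>" "Rep_fbar 1 = \<one>\<^bsub>Fbar\<^esub>"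
  "Rep_fbar (x + y) = Rep_fbar x \<oplus>\<^bsub>Fbar\<^esub> Rep_fbar y"
  "Rep_fbar (x * y) = Rep_fbar x \<otimes>\<^bsub>Fbar\<^esub> Rep_fbar y"
  "Rep_fbar (- x) = \<ominus>\<^bsub>Fbar\<^esub> Rep_fbar x"
  by (simp_all add: zero_fbar_def one_fbar_def plus_fbar_def times_fbar_def uminus_fbar_def Abs_fbar_inverse)

instance
proof
  fix a b c :: fbar
  show "a * b * c = a * (b * c)" by (simp add: Rep_fbar_inject[symmetric] Rep_fbar_simps Fbar.m_assoc)
  show "a * b = b * a" by (simp add: Rep_fbar_inject[symmetric] Rep_fbar_simps Fbar.m_comm)
  show "1 * a = a" by (simp add: Rep_fbar_inject[symmetric] Rep_fbar_simps)
  show "a + b + c = a + (b + c)" by (simp add: Rep_fbar_inject[symmetric] Rep_fbar_simps Fbar.a_assoc)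
  show "a + b = b + a" by (simp add: Rep_fbar_inject[symmetric] Rep_fbar_simps Fbar.a_comm)
  show "0 + a = a" by (simp add: Rep_fbar_inject[symmetric] Rep_fbar_simps)
  show "- a + a = 0" by (simp add: Rep_fbar_inject[symmetric] Rep_fbar_simps Fbar.l_neg)
  show "a - b = a + - b" by (rule minus_fbar_def)
  show "(a + b) * c = a * c + b * c" by (simp add: Rep_fbar_inject[symmetric] Rep_fbar_simps Fbar.l_distr)
  show "0 \<noteq> (1 :: fbar)"
    using Fbar_one_not_zero by (simp add: Rep_fbar_inject[symmetric] Rep_fbar_simps)
  show "a div b = a * inverse b" by (rule divide_fbar_def)
  show "inverse (0 :: fbar) = 0" by (simp add: inverse_fbar_def)
  assume "a \<noteq> 0"
  then have "Rep_fbar a \<in> Units Fbar" by (simp add: Rep_fbar_inject[symmetric] Rep_fbar_simps Fbar_units)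
  then show "inverse a * a = 1"
    using \<open>a \<noteq> 0\<close> by (simp add: Rep_fbar_inject[symmetric] Rep_fbar_simps inverse_fbar_def Abs_fbar_inverse)
qed

end

instantiation fbar ::
  "{unique_euclidean_ring, normalization_euclidean_semiring, normalization_semidom_multiplicative}"
begin

definition [simp]: "normalize_fbar = (normalize_field :: fbar \<Rightarrow> _)"
definition [simp]: "unit_factor_fbar = (unit_factor_field :: fbar \<Rightarrow> _)"
definition [simp]: "modulo_fbar = (mod_field :: fbar \<Rightarrow> _)"
definition [simp]: "euclidean_size_fbar = (euclidean_size_field :: fbar \<Rightarrow> _)"
definition [simp]: "division_segment (x :: fbar) = 1"

instance
  by standard (simp_all add: dvd_field_iff field_split_simps split: if_splits)

end

instantiation fbar :: euclidean_ring_gcd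
begin

definition "gcd_fbar = (Euclidean_Algorithm.gcd :: fbar \<Rightarrow> _)"
definition "lcm_fbar = (Euclidean_Algorithm.lcm :: fbar \<Rightarrow> _)"
definition "Gcd_fbar = (Euclidean_Algorithm.Gcd :: fbar set \<Rightarrow> _)"
definition "Lcm_fbar = (Euclidean_Algorithm.Lcm :: fbar set \<Rightarrow> _)"

instance by standard (simp_all add: gcd_fbar_def lcm_fbar_def Gcd_fbar_def Lcm_fbar_def)

end

instance fbar :: field_gcd ..

lemma Rep_fbar_eval:
  "Fbar.eval (rev (map Rep_fbar cs)) (Rep_fbar x) = Rep_fbar (poly (Poly cs) x)"
proof (induction cs rule: rev_induct)
  case (snoc c cs)
  have "Rep_fbar (x ^ n) = Rep_fbar x [^]\<^bsub>Fbar\<^esub> n" for n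
    by (induction n) (simp_all add: Rep_fbar_simps Fbar.m_comm)
  then show ?case by (simp add: snoc Poly_append poly_monom Rep_fbar_simps Fbar.a_comm)
qed (simp add: Rep_fbar_simps)

lemma fbar_root:
  fixes p :: "fbar poly"
  assumes "0 < Polynomial.degree p"
  shows "\<exists>x. poly p x = 0"
proof -
  interpret algebraically_closed Fbar by (rule algebraically_closed_Fbar)
  define P where "P = rev (map Rep_fbar (Polynomial.coeffs p))"
  have p: "p \<noteq> 0" using assms by auto
  have "P \<noteq> []" using p by (simp add: P_def)
  moreover have "hd P \<noteq> \<zero>\<^bsub>Fbar\<^esub>"
  proof -
    have "hd P = Rep_fbar (Polynomial.lead_coeff p)"
      using p by (simp add: P_def hd_rev last_map last_coeffs_eq_coeff_degree)
    then show ?thesis using p Rep_fbar_inject[of "Polynomial.lead_coeff p" 0] by (simp add: Rep_fbar_simps)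
  qed
  ultimately have P: "P \<in> carrier (poly_ring Fbar)"
    by (auto simp: univ_poly_def polynomial_def P_def)
  then have "size (Fbar.roots P) = length P - 1" using roots_over_carrier[OF P] by (simp add: Fbar.splitted_def)
  also have "0 < \<dots>" using assms p by (simp add: P_def length_coeffs)
  finally obtain x where "x \<in># Fbar.roots P" by (metis multiset_nonemptyE nonempty_has_size)
  then have "Fbar.is_root P x" using roots_mem_iff_is_root[OF P] by simp
  then have x: "x \<in> carrier Fbar" "Fbar.eval P x = \<zero>\<^bsub>Fbar\<^esub>" by (simp_all add: Fbar.is_root_def)
  then have "Rep_fbar (Abs_fbar x) = x" by (simp add: Abs_fbar_inverse)
  then have "Rep_fbar (poly p (Abs_fbar x)) = Rep_fbar 0"
    using Rep_fbar_eval[of "Polynomial.coeffs p" "Abs_fbar x"] x by (simp add: Rep_fbar_simps P_def)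
  then show ?thesis by (auto simp: Rep_fbar_inject)
qed

text \<open>
  Over a finite field the polynomial \<open>1 + \<Prod>\<^sub>a (x - a)\<close> has no root.
\<close>

lemma infinite_fbar: "infinite (UNIV :: fbar set)"
proof
  assume fin: "finite (UNIV :: fbar set)"
  define q where "q = (\<Prod>a\<in>(UNIV :: fbar set). [:- a, 1:])"
  have "Polynomial.degree q = card (UNIV :: fbar set)"
    by (simp add: q_def degree_prod_eq_sum_degree)
  then have "0 < Polynomial.degree q" using fin by (simp add: card_gt_0_iff)
  then have "0 < Polynomial.degree (1 + q)" by (subst degree_add_eq_right) simp_all
  then obtain x where "poly (1 + q) x = 0" using fbar_root by blast
  moreover have "poly q x = 0" using fin by (simp add: q_def poly_prod prod_zero_iff)
  ultimately show False by simp
qed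

interpretation Fbar_iso: poly3_iso Fbar Rep_fbar
proof unfold_locales
  show "\<exists>c. x = Rep_fbar c" if "x \<in> carrier Fbar" for x
    using Rep_fbar_cases[OF that] by metis
qed (simp_all add: Rep_fbar_simps Rep_fbar_inject)

text \<open>
  Both sides are the unique ring homomorphism from the integers.
\<close>

lemma of_int_fbar: "Rep_fbar (of_int c) = to_Fpbar worst_prime c"
proof -
  interpret P: residues_prime worst_prime "Fp worst_prime"
    by (rule residues_prime.intro) (rule worst_prime(1))
  have mod: "c mod int worst_prime \<in> carrier (Fp worst_prime)" for c
    using P.p_prime by (simp add: P.res_carrier_eq prime_gt_0_nat)
  have add: "to_Fpbar worst_prime (a + b) = to_Fpbar worst_prime a \<oplus>\<^bsub>Fbar\<^esub> to_Fpbar worst_prime b" for a b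
    using ring_hom_add[OF Fbar(2) mod mod, of a b] by (simp add: to_Fpbar_def P.add_cong)
  have one: "to_Fpbar worst_prime 1 = \<one>\<^bsub>Fbar\<^esub>"
  proof -
    have "1 mod int worst_prime = 1" using prime_gt_1_nat[OF P.p_prime] by simp
    then show ?thesis using ring_hom_one[OF Fbar(2)] by (simp add: to_Fpbar_def P.res_one_eq)
  qed
  have closed: "to_Fpbar worst_prime c \<in> carrier Fbar" for c
    unfolding to_Fpbar_def by (rule ring_hom_closed[OF Fbar(2) mod])
  define g where "g c = Abs_fbar (to_Fpbar worst_prime c)" for c
  have g: "Rep_fbar (g c) = to_Fpbar worst_prime c" for c by (simp add: g_def Abs_fbar_inverse closed)
  have g_add: "g (a + b) = g a + g b" for a b
    by (simp add: Rep_fbar_inject[symmetric] Rep_fbar_simps g add)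
  have g_1: "g 1 = 1" by (simp add: Rep_fbar_inject[symmetric] Rep_fbar_simps g one)
  have g_0: "g 0 = 0" using g_add[of 0 0] by (metis add_0 add_right_cancel)
  have g_minus: "g (- a) = - g a" for a using g_add[of a "- a"] g_0 by (simp add: eq_neg_iff_add_eq_0 add.commute)
  have "g (int n) = of_nat n" for n by (induction n) (simp_all add: g_0 g_1 g_add)
  then have "g c = of_int c" for c by (cases c rule: int_cases2) (simp_all add: g_minus)
  with g show ?thesis by metis
qed

lemma to_Fpbar_eq_0: "to_Fpbar worst_prime c = \<zero>\<^bsub>Fbar\<^esub> \<longleftrightarrow> int worst_prime dvd c"
proof -
  interpret P: residues_prime worst_prime "Fp worst_prime"
    by (rule residues_prime.intro) (rule worst_prime(1))
  have "ring.indexed_const (Fp worst_prime) \<zero>\<^bsub>Fp worst_prime\<^esub> = \<zero>\<^bsub>Fbar\<^esub>"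
    using ring_hom_zero[OF Fbar(2)] P.ring_axioms Fbar.ring_axioms by blast
  then have "to_Fpbar worst_prime c = \<zero>\<^bsub>Fbar\<^esub> \<longleftrightarrow> c mod int worst_prime = 0"
    unfolding to_Fpbar_def by (metis P.res_zero_eq P.indexed_const_eq_iff)
  then show ?thesis by (simp add: dvd_eq_mod_eq_0)
qed

theorem good_reduction: "Factorial_Ring.prime p \<Longrightarrow> good_reduction p"
proof (rule worst_prime(2))
  show "good_reduction worst_prime" unfolding good_reduction_def
  proof (intro allI impI)
    fix F G D E i j m m'
    assume "int_cremona F G D E" "\<not> int worst_prime dvd mcoeff (subst (G i) F) m" "\<not> int worst_prime dvd mcoeff (subst (F j) G) m'"
    then have "degree_laws F (\<lambda>N. Rep_fbar (of_int N) \<noteq> \<zero>\<^bsub>Fbar\<^esub>)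
        (\<lambda>n. map_degree Fbar (iter_map Fbar (\<lambda>i m. Rep_fbar (of_int (mcoeff (F i) m))) n))"
      using infinite_fbar by (intro Fbar_iso.degree_laws_record) (simp_all add: of_int_fbar to_Fpbar_eq_0)
    then show "degree_laws F (\<lambda>N. \<not> int worst_prime dvd N)
       (\<lambda>n. map_degree (field.alg_closure (Fp worst_prime)) (iter_map (field.alg_closure (Fp worst_prime)) (\<lambda>i m. to_Fpbar worst_prime (mcoeff (F i) m)) n))"
      by (simp add: of_int_fbar to_Fpbar_eq_0 flip: Fbar_def)
  qed
qed

section \<open>Passing to the limit\<close>

lemma eventually_primes_at_top:
  "eventually P primes_at_top \<longleftrightarrow> (\<exists>N. \<forall>p\<ge>N. Factorial_Ring.prime p \<longrightarrow> P p)"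
  unfolding primes_at_top_def eventually_inf_principal by (simp add: eventually_at_top_linorder)

lemma eventually_not_dvd:
  assumes "c \<noteq> (0 :: int)" shows "\<forall>\<^sub>F p in primes_at_top. \<not> int p dvd c"
  unfolding eventually_primes_at_top
proof (intro exI[of _ "nat \<bar>c\<bar> + 1"] allI impI notI)
  fix p assume "nat \<bar>c\<bar> + 1 \<le> p" "int p dvd c"
  then have "int p \<le> \<bar>c\<bar>" using dvd_imp_le_int[OF assms, of "int p"] by simp
  with \<open>nat \<bar>c\<bar> + 1 \<le> p\<close> show False by linarith
qed

lemma degree_laws_limit:
  assumes "degree_laws F nz d"
  obtains l where "(\<lambda>n. root n (real (d n))) \<longlonglongrightarrow> l" "1 \<le> l" "\<And>n. 1 \<le> n \<Longrightarrow> l \<le> root n (real (d n))"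
    "\<And>N. 1 \<le> N \<Longrightarrow> real (d (2 * N)) \<le> 24 * real (d N) * l ^ N"
proof -
  have "1 \<le> real (d n)" for n using assms by (simp add: degree_laws_def Suc_le_eq)
  moreover have "real (d (m + n)) \<le> real (d m) * real (d n)" for m n
    using assms by (simp add: degree_laws_def flip: of_nat_mult)
  ultimately obtain l where l: "(\<lambda>n. root n (real (d n))) \<longlonglongrightarrow> l" "1 \<le> l" "\<forall>n\<ge>1. l \<le> root n (real (d n))"
    using submultiplicative_root_limit[of "\<lambda>n. real (d n)"] by blast
  then have "real (d (2 * N)) \<le> 24 * real (d N) * l ^ N" if "1 \<le> N" for N
    using assms that by (simp add: degree_laws_def)
  with that l show thesis by blast
qed

text \<open>
  The \<open>n\<close>-th root of \<open>d\<^sub>2\<^sub>n\<close> tends to \<open>l\<^sup>2\<close>, and the \<open>n\<close>-th root of the constant tends to \<open>1\<close>.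
\<close>

lemma degree_ratio_limit:
  fixes d :: "nat \<Rightarrow> nat"
  assumes lim: "(\<lambda>n. root n (real (d n))) \<longlonglongrightarrow> l" and "1 \<le> l"
  shows "(\<lambda>n. root n (real (d (2 * n)) / (24 * real (d n)))) \<longlonglongrightarrow> l"
proof -
  have "(\<lambda>n. root (2 * n) (real (d (2 * n)))) \<longlonglongrightarrow> l"
    using LIMSEQ_subseq_LIMSEQ[OF lim, of "\<lambda>n. 2 * n"] by (simp add: strict_mono_def o_def)
  then have "(\<lambda>n. root (2 * n) (real (d (2 * n))) ^ 2) \<longlonglongrightarrow> l ^ 2" by (rule tendsto_power)
  moreover have "(\<lambda>n. root n (24 :: real)) \<longlonglongrightarrow> 1" by (rule LIMSEQ_root_const) simp
  ultimately have "(\<lambda>n. root (2 * n) (real (d (2 * n))) ^ 2 / (root n 24 * root n (real (d n)))) \<longlonglongrightarrow> l ^ 2 / (1 * l)"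
    using lim assms(2) by (intro tendsto_divide tendsto_mult) auto
  moreover have "l ^ 2 / (1 * l) = l" using assms(2) by (simp add: power2_eq_square)
  ultimately have "(\<lambda>n. root (2 * n) (real (d (2 * n))) ^ 2 / (root n 24 * root n (real (d n)))) \<longlonglongrightarrow> l" by simp
  then show ?thesis
  proof (rule Lim_transform_eventually, intro eventually_sequentiallyI[of 1])
    fix n :: nat assume "1 \<le> n"
    then show "root (2 * n) (real (d (2 * n))) ^ 2 / (root n 24 * root n (real (d n))) =
        root n (real (d (2 * n)) / (24 * real (d n)))"
      by (simp add: real_root_divide real_root_mult real_root_mult_exp)
  qed
qed

text \<open>
  For fixed \<open>n\<close> the degrees \<open>dp p n\<close> and \<open>d n\<close> agree for all large \<open>p\<close>. Upper bounds for the limit at \<open>p\<close> come from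
  submultiplicativity at one \<open>n\<close>, lower bounds from the growth law at one \<open>n\<close>.
\<close>

lemma limit_of_degree_limits:
  assumes Q: "degree_laws F (\<lambda>N. N \<noteq> 0) d"
    and P: "\<forall>\<^sub>F p in primes_at_top. degree_laws F (\<lambda>N. \<not> int p dvd N) (dp p)"
  shows "((\<lambda>p. lim (\<lambda>n. root n (real (dp p n)))) \<longlongrightarrow> lim (\<lambda>n. root n (real (d n)))) primes_at_top"
proof -
  obtain l where l: "(\<lambda>n. root n (real (d n))) \<longlonglongrightarrow> l" "1 \<le> l" using degree_laws_limit[OF Q] by metis
  have limQ: "lim (\<lambda>n. root n (real (d n))) = l" using l(1) by (rule limI)
  define lp where "lp p = lim (\<lambda>n. root n (real (dp p n)))" for p
  have lp: "\<forall>\<^sub>F p in primes_at_top. 1 \<le> lp p \<and> (\<forall>n\<ge>1. lp p \<le> root n (real (dp p n))) \<and>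
      (\<forall>N\<ge>1. real (dp p (2 * N)) \<le> 24 * real (dp p N) * lp p ^ N)"
    using P
  proof eventually_elim
    case (elim p)
    obtain l' where l': "(\<lambda>n. root n (real (dp p n))) \<longlonglongrightarrow> l'" "1 \<le> l'" "\<And>n. 1 \<le> n \<Longrightarrow> l' \<le> root n (real (dp p n))"
      "\<And>N. 1 \<le> N \<Longrightarrow> real (dp p (2 * N)) \<le> 24 * real (dp p N) * l' ^ N"
      using degree_laws_limit[OF elim] by metis
    moreover have "lp p = l'" unfolding lp_def using l'(1) by (rule limI)
    ultimately show ?case by simp
  qed
  have eq: "\<forall>\<^sub>F p in primes_at_top. dp p n = d n" for n
  proof -
    \<comment> \<open>The value \<open>d n\<close> is determined by the truth of \<open>d n \<le> m\<close> for \<open>m = d n - 1\<close> and \<open>m = d n\<close>.\<close>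
    define e where "e = d n - 1"
    have dn: "d n = Suc e" using Q by (simp add: degree_laws_def e_def)
    have "\<forall>\<^sub>F p in primes_at_top. \<not> int p dvd degree_modulus (iterate F n) m" for m
      by (rule eventually_not_dvd[OF degree_modulus_nonzero])
    from P this[of e] this[of "Suc e"] show ?thesis
    proof eventually_elim
      case (elim p)
      have "dp p n \<le> m \<longleftrightarrow> d n \<le> m" if "\<not> int p dvd degree_modulus (iterate F n) m" for m
        using Q elim(1) that degree_modulus_nonzero unfolding degree_laws_def by metis
      from this[OF elim(2)] this[OF elim(3)] dn show ?case by simp
    qed
  qed
  have "(lp \<longlongrightarrow> l) primes_at_top"
  proof (rule order_tendstoI)
    fix a assume "l < a"
    then have "\<forall>\<^sub>F n in sequentially. root n (real (d n)) < a" by (rule order_tendstoD(2)[OF l(1)])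
    then obtain N where "\<And>n. N \<le> n \<Longrightarrow> root n (real (d n)) < a" by (auto simp: eventually_sequentially)
    then have n: "root (Suc N) (real (d (Suc N))) < a" by simp
    from lp eq[of "Suc N"] show "\<forall>\<^sub>F p in primes_at_top. lp p < a"
    proof eventually_elim
      case (elim p)
      then have "\<forall>n\<ge>1. lp p \<le> root n (real (dp p n))" by blast
      from this[rule_format, of "Suc N"] have "lp p \<le> root (Suc N) (real (dp p (Suc N)))" by simp
      with elim(2) n show ?case by simp
    qed
  next
    fix a assume "a < l"
    then have "\<forall>\<^sub>F n in sequentially. a < root n (real (d (2 * n)) / (24 * real (d n)))"
      by (rule order_tendstoD(1)[OF degree_ratio_limit[OF l]])
    then obtain N where N: "\<And>n. N \<le> n \<Longrightarrow> a < root n (real (d (2 * n)) / (24 * real (d n)))"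
      by (auto simp: eventually_sequentially)
    define n where "n = Suc N"
    then have n: "1 \<le> n" "a < root n (real (d (2 * n)) / (24 * real (d n)))" using N[of n] by simp_all
    have dn: "0 < real (d n)" using Q by (simp add: degree_laws_def)
    from lp eq[of n] eq[of "2 * n"] show "\<forall>\<^sub>F p in primes_at_top. a < lp p"
    proof eventually_elim
      case (elim p)
      then have "real (d (2 * n)) \<le> 24 * real (d n) * lp p ^ n" using n(1) by auto
      then have "real (d (2 * n)) / (24 * real (d n)) \<le> lp p ^ n" using dn by (simp add: field_simps)
      then have "root n (real (d (2 * n)) / (24 * real (d n))) \<le> root n (lp p ^ n)" using n(1) by simp
      also have "\<dots> = lp p" using n(1) elim(1) by (simp add: real_root_power_cancel)
      finally show ?case using n(2) by simp
    qed
  qed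
  then show ?thesis unfolding limQ lp_def .
qed

section \<open>Reduction of maps modulo primes\<close>

interpretation Int_poly: poly3_hom int_ring "\<lambda>c :: int. c"
proof -
  interpret cring int_ring by (rule int_is_cring)
  show "poly3_hom int_ring (\<lambda>c :: int. c)" by unfold_locales simp_all
qed

lemma integral_form:
  assumes "homogeneous int_ring d p"
  shows "\<exists>P. form d P \<and> p = (\<lambda>m. mcoeff P m)"
proof -
  have "p \<in> carrier (poly3_ring int_ring)" using assms by (simp add: homogeneous_def)
  then obtain P where "p = rec_form (\<lambda>c. c) P" using Int_poly.r_surj by blast
  then have P: "p = (\<lambda>m. mcoeff P m)" by (simp add: rec_form_def)
  moreover have "form d P" using assms unfolding P homogeneous_def form_def by simp
  ultimately show ?thesis by blast
qed

lemma poly3_hom_Fp: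
  assumes "Factorial_Ring.prime p" shows "poly3_hom (Fp p) (\<lambda>c. c mod int p)"
proof -
  interpret P: residues_prime p "Fp p" by (rule residues_prime.intro) (rule assms)
  have p: "1 < int p" using prime_gt_1_nat[OF assms] by simp
  show ?thesis
  proof unfold_locales
    show "\<exists>c. x = c mod int p" if "x \<in> carrier (Fp p)" for x
      using that by (intro exI[of _ x]) (simp add: P.res_carrier_eq)
  qed (use p in \<open>simp_all add: P.res_carrier_eq P.res_zero_eq P.res_one_eq P.res_add_eq P.res_mult_eq mod_simps\<close>)
qed

lemma birational_mod_prime:
  assumes p: "Factorial_Ring.prime p" and "int_cremona F G D E"
    and "\<not> int p dvd mcoeff (subst (G i) F) m" "\<not> int p dvd mcoeff (subst (F j) G) m'"
  shows "birational (Fp p) (reduce_mod p (\<lambda>i m. mcoeff (F i) m))"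
proof -
  interpret P: residues_prime p "Fp p" by (rule residues_prime.intro) (rule p)
  interpret H: poly3_hom "Fp p" "\<lambda>c. c mod int p" by (rule poly3_hom_Fp[OF p])
  have nz: "H.r P \<noteq> \<zero>\<^bsub>H.RR\<^esub>" if "\<not> int p dvd mcoeff P m" for P m
  proof
    assume "H.r P = \<zero>\<^bsub>H.RR\<^esub>"
    then have "H.r P = H.r 0" by (simp only: H.r_0)
    then have "H.r P m = H.r 0 m" by (rule fun_cong)
    with that show False by (simp add: rec_form_def dvd_eq_mod_eq_0)
  qed
  have "birational (Fp p) (\<lambda>i. H.r (F i))"
    using assms(2) nz[OF assms(3)] nz[OF assms(4)]
    by (intro H.birational_r[of D F E G i j]) (simp_all add: int_cremona_def compose_def)
  then show ?thesis by (simp add: reduce_mod_def base_change_def rec_form_def)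
qed

theorem theorem1p5:
  fixes f :: "3 \<Rightarrow> int poly3"
  assumes "\<exists>d. \<forall>i. homogeneous int_ring d (f i)"
    and "birational (field.alg_closure rat_ring) (to_closure rat_ring (generic_fibre f))"
  shows "(\<forall>\<^sub>F p in primes_at_top. birational (Fp p) (reduce_mod p f)) \<and>
         ((\<lambda>p. lambda1 (Fp p) (reduce_mod p f)) \<longlongrightarrow> lambda1 rat_ring (generic_fibre f)) primes_at_top"
proof -
  obtain d where "\<forall>i. homogeneous int_ring d (f i)" using assms(1) by blast
  then have "\<forall>i. \<exists>P. form d P \<and> f i = (\<lambda>m. mcoeff P m)" by (intro allI integral_form) simp
  from choice[OF this] obtain F where F: "\<And>i. form d (F i)" "\<And>i. f i = (\<lambda>m. mcoeff (F i) m)" by blast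
  have f: "f = (\<lambda>i m. mcoeff (F i) m)" using F(2) by (intro ext) simp
  let ?\<epsilon> = "Rep_alg_closure :: rat alg_closure \<Rightarrow> _"
  have gen: "to_closure rat_ring (generic_fibre f) = (\<lambda>i m. ?\<epsilon> (of_int (mcoeff (F i) m)))"
    unfolding to_closure_rat f ..
  then have "birational Qbar (\<lambda>i. Qbar.r (int_form (F i) :: rat alg_closure form3))"
    using assms(2) by (simp add: rec_form_def Qbar_def)
  moreover have inf: "infinite (UNIV :: rat alg_closure set)" by (rule infinite_UNIV_char_0)
  ultimately obtain G v w D E where cr: "cremona (\<lambda>i. int_form (F i) :: rat alg_closure form3) G v w D E"
    using Qbar.cremona_of_birational[of "\<lambda>i. int_form (F i)"] by blast
  interpret cremona "\<lambda>i. int_form (F i) :: rat alg_closure form3" G v w D E by (rule cr)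
  have "form D (F i)" for i
    using form_F[of i] unfolding form_def by simp
  from inverse_over_int[OF cr this] obtain H i j where H: "int_cremona F H D E" "subst (H i) F \<noteq> 0" "subst (F j) H \<noteq> 0"
    by blast
  obtain m where m: "mcoeff (subst (H i) F) m \<noteq> 0" using H(2) by (rule nonzero_cfE)
  obtain m' where m': "mcoeff (subst (F j) H) m' \<noteq> 0" using H(3) by (rule nonzero_cfE)
  note large = eventually_not_dvd[OF m] eventually_not_dvd[OF m']
  have prime: "\<forall>\<^sub>F p in primes_at_top. Factorial_Ring.prime p" unfolding eventually_primes_at_top by blast
  have bir: "\<forall>\<^sub>F p in primes_at_top. birational (Fp p) (reduce_mod p f)"
    using prime large
  proof eventually_elim
    case (elim p)
    then show ?case unfolding f by (intro birational_mod_prime[OF _ H(1)])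
  qed
  let ?d = "\<lambda>n. map_degree Qbar (iter_map Qbar (to_closure rat_ring (generic_fibre f)) n)"
  let ?dp = "\<lambda>p n. map_degree (field.alg_closure (Fp p))
      (iter_map (field.alg_closure (Fp p)) (to_closure (Fp p) (reduce_mod p f)) n)"
  have Q: "degree_laws F (\<lambda>N. N \<noteq> 0) ?d"
  proof -
    have nz: "?\<epsilon> (of_int N) \<noteq> \<zero>\<^bsub>Qbar\<^esub> \<longleftrightarrow> N \<noteq> 0" for N by (simp add: Qbar.\<epsilon>_eq_0)
    show ?thesis
      using Qbar.degree_laws_record[OF H(1) inf, of i m j m'] m m' unfolding gen nz by simp
  qed
  have P: "\<forall>\<^sub>F p in primes_at_top. degree_laws F (\<lambda>N. \<not> int p dvd N) (?dp p)"
    using prime large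
  proof eventually_elim
    case (elim p)
    have "to_closure (Fp p) (reduce_mod p f) = (\<lambda>i m. to_Fpbar p (mcoeff (F i) m))"
      by (simp add: f to_closure_def reduce_mod_def base_change_def to_Fpbar_def)
    then show ?case
      using good_reduction[OF elim(1), unfolded good_reduction_def, rule_format, OF H(1) elim(2,3)] by simp
  qed
  have "((\<lambda>p. lambda1 (Fp p) (reduce_mod p f)) \<longlongrightarrow> lambda1 rat_ring (generic_fibre f)) primes_at_top"
    using limit_of_degree_limits[OF Q P] unfolding lambda1_def dynamical_degree_def Qbar_def .
  with bir show ?thesis ..
qed

end
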